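(* Let $A:E\to E$ be a hyperbolic bundle automorphism covering a homeomorphism $f:X\to X$, and let $\phi:E\to E$ belong to $\mathcal{C}^{0,1}_b(E;\delta)$. Then there exists a homeomorphism $\mathcal H:E\to E$, mapping each fiber $E_x$ to itself by $\mathcal H_x:E_x\to E_x$, such that $$\mathcal H_{f(x)}\circ (A_x+\phi_x)=A_x\circ \mathcal H_x\qquad\text{for all } x\in X.$$ Moreover, $\mathcal H$ can be chosen so that $\mathcal H_x=\mathrm{Id}+h_x$ for all $x\in X$, where $h_x:E_x\to E_x$ is bounded and Hölder continuous with exponent $\alpha$, for $$\alpha\in\Big(0,\ \min\Big\{\frac{\log(\tau+\delta)}{\log(\ell-\delta)},\ \frac{\log\{(1-\delta)/\tau\}}{\log(L+\delta)}\Big\}\Big).$$ The inverse of $\mathcal H_x$ is also of the form $\mathrm{Id}+\tilde h_x$ for all $x\in X$, where $\tilde h_x:E_x\to E_x$ is also bounded and Hölder continuous with the same exponent $\alpha$.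
   Context: $X$ is a compact metric space, $\pi:E\to X$ is a continuous (real, finite rank) vector bundle with fibers $E_x$, equipped with a continuous Riemannian metric, which induces a norm $|\cdot|_x$ on each $E_x$. A continuous bundle automorphism $A:E\to E$ covering a homeomorphism $f:X\to X$ (so $A_x:E_x\to E_{f(x)}$ is a linear isomorphism) is hyperbolic if there is a continuous splitting $E_x=E^s_x\oplus E^u_x$ ($x\in X$) with $A(E^s_x)=E^s_{f(x)}$, $A(E^u_x)=E^u_{f(x)}$, and constants $C>0$, $\lambda\in(0,1)$ such that for all $n\ge 0$ and $x\in X$: $|A^n v|_{f^n(x)}\le C\lambda^n|v|_x$ for $v\in E^s_x$ and $|A^{-n}v|_{f^{-n}(x)}\le C\lambda^n|v|_x$ for $v\in E^u_x$. Adapted norm. Fix $N\ge 1$ with $C\lambda^N<1$. For $v\in E^s_x$ put $\|v\|_x=\sum_{n=0}^{N-1}|A^n v|_{f^n(x)}$; for $v\in E^u_x$ put $\|v\|_x=\sum_{n=0}^{N-1}|A^{-n}v|_{f^{-n}(x)}$; for $v=v^s+v^u$ with $v^s\in E^s_x$, $v^u\in E^u_x$ put $\|v\|_x=\max\{\|v^s\|_x,\|v^u\|_x\}$. This is a continuous norm on $E$, uniformly equivalent to the original one, and there is a constant $\tau\in(0,1)$ (fixed from now on) such that for all $x\in X$: $\|A v\|_{f(x)}\le\tau\|v\|_x$ for $v\in E^s_x$ and $\|A^{-1}v\|_{f^{-1}(x)}\le\tau\|v\|_x$ for $v\in E^u_x$. All norms, operator norms, Lipschitz and Hölder conditions are taken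 with respect to $\|\cdot\|$. Constants $0<\ell\le L<\infty$ are fixed with $\ell\|v\|_x\le\|A_xv\|_{f(x)}\le L\|v\|_x$ for all $x\in X$, $v\in E_x$. For a constant $\delta<\min\{1-\tau,\ell\}$, $\mathcal{C}^{0,1}_b(E;\delta)$ is the set of continuous maps $\phi:E\to E$ covering $f$ (so $\phi_x:E_x\to E_{f(x)}$) such that for all $x\in X$: $\phi_x$ is Lipschitz with $\mathrm{Lip}(\phi_x)\le\delta$; $A_x+\phi_x:E_x\to E_{f(x)}$ is a homeomorphism; and $B_\phi:=\sup_{x\in X}\sup_{v\in E_x}\|\phi_x(v)\|<\infty$. *)

theory Defs
  imports "HOL-Analysis.Analysis"
begin

text \<open>
  A vector bundle is given by the topology \<open>E\<close> of its total space alone. The points of the total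
  space are pairs \<open>(x, v)\<close>, with \<open>v\<close> in the fibre over \<open>x\<close>, and the projection is \<^const>\<open>fst\<close>. The
  fibres are linear subspaces of a real vector space type, which serves only to supply the linear
  operations: it carries no topology and has no bearing on the topology of \<open>E\<close>.
\<close>

definition fiber :: "('x \<times> 'v) topology \<Rightarrow> 'x \<Rightarrow> 'v set" where
  "fiber E x = {v. (x, v) \<in> topspace E}"

definition fiber_space :: "('x \<times> 'v) topology \<Rightarrow> 'x \<Rightarrow> ('x \<times> 'v) topology" where
  "fiber_space E x = subtopology E ({x} \<times> UNIV)"

text \<open>
  The rank \<open>n\<close> belongs to the local trivialization, so it is only locally constant.
  \<^const>\<open>Euclidean_space\<close> consists of functions \<^typ>\<open>nat \<Rightarrow> real\<close>, a type without a vector space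
  instance; linearity of the trivialization is therefore written out in coordinates.
\<close>

definition vector_bundle :: "('x::topological_space \<times> 'v::real_vector) topology \<Rightarrow> bool" where
  "vector_bundle E \<longleftrightarrow>
     continuous_map E euclidean fst \<and>
     (\<forall>x. subspace (fiber E x)) \<and>
     (\<forall>x. \<exists>U n \<psi>. open U \<and> x \<in> U \<and>
        homeomorphic_map (subtopology E (U \<times> UNIV))
          (prod_topology (top_of_set U) (Euclidean_space n)) (\<lambda>(y, v). (y, \<psi> y v)) \<and>
        (\<forall>y\<in>U. \<forall>u\<in>fiber E y. \<forall>v\<in>fiber E y. \<forall>a b.
           \<psi> y (a *\<^sub>R u + b *\<^sub>R v) = (\<lambda>i. a * \<psi> y u i + b * \<psi> y v i)))"

definition subbundle ::
  "('x::topological_space \<times> 'v::real_vector) topology \<Rightarrow> ('x \<Rightarrow> 'v set) \<Rightarrow> bool" where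
  "subbundle E S \<longleftrightarrow>
     (\<forall>x. S x \<subseteq> fiber E x) \<and> vector_bundle (subtopology E (Sigma UNIV S))"

text \<open>Continuity of the metric refers to the fibre product of \<open>E\<close> with itself over the base.\<close>

definition riemannian_metric ::
  "('x::topological_space \<times> 'v::real_vector) topology \<Rightarrow> ('x \<Rightarrow> 'v \<Rightarrow> 'v \<Rightarrow> real) \<Rightarrow> bool" where
  "riemannian_metric E g \<longleftrightarrow>
     (\<forall>x. \<forall>u\<in>fiber E x. \<forall>v\<in>fiber E x. g x u v = g x v u) \<and>
     (\<forall>x. \<forall>u\<in>fiber E x. \<forall>v\<in>fiber E x. \<forall>w\<in>fiber E x. \<forall>a b.
        g x (a *\<^sub>R u + b *\<^sub>R v) w = a * g x u w + b * g x v w) \<and>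
     (\<forall>x. \<forall>v\<in>fiber E x. v \<noteq> 0 \<longrightarrow> 0 < g x v v) \<and>
     continuous_map (subtopology (prod_topology E E) {(p, q). fst p = fst q}) euclideanreal
       (\<lambda>(p, q). g (fst p) (snd p) (snd q))"

definition metric_norm :: "('x \<Rightarrow> 'v \<Rightarrow> 'v \<Rightarrow> real) \<Rightarrow> 'x \<times> 'v \<Rightarrow> real" where
  "metric_norm g = (\<lambda>(x, v). sqrt (g x v v))"

text \<open>The map of total spaces that covers \<open>f\<close> and has the fibre maps \<open>F x\<close>.\<close>

definition total_map :: "('x \<Rightarrow> 'x) \<Rightarrow> ('x \<Rightarrow> 'v \<Rightarrow> 'v) \<Rightarrow> 'x \<times> 'v \<Rightarrow> 'x \<times> 'v" where
  "total_map f F = (\<lambda>(x, v). (f x, F x v))"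

definition total_inv ::
  "('x \<times> 'v) topology \<Rightarrow> ('x \<Rightarrow> 'x) \<Rightarrow> ('x \<Rightarrow> 'v \<Rightarrow> 'v) \<Rightarrow> 'x \<times> 'v \<Rightarrow> 'x \<times> 'v" where
  "total_inv E f F = inv_into (topspace E) (total_map f F)"

definition bundle_automorphism ::
  "('x::topological_space \<times> 'v::real_vector) topology \<Rightarrow> ('x \<Rightarrow> 'x) \<Rightarrow> ('x \<Rightarrow> 'v \<Rightarrow> 'v) \<Rightarrow> bool" where
  "bundle_automorphism E f A \<longleftrightarrow>
     homeomorphic_map E E (total_map f A) \<and>
     (\<forall>x. \<forall>u\<in>fiber E x. \<forall>v\<in>fiber E x. \<forall>a b. A x (a *\<^sub>R u + b *\<^sub>R v) = a *\<^sub>R A x u + b *\<^sub>R A x v)"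

definition hyperbolic_splitting ::
  "('x::topological_space \<times> 'v::real_vector) topology \<Rightarrow> ('x \<Rightarrow> 'x) \<Rightarrow> ('x \<Rightarrow> 'v \<Rightarrow> 'v) \<Rightarrow>
   ('x \<times> 'v \<Rightarrow> real) \<Rightarrow> ('x \<Rightarrow> 'v set) \<Rightarrow> ('x \<Rightarrow> 'v set) \<Rightarrow> real \<Rightarrow> real \<Rightarrow> bool" where
  "hyperbolic_splitting E f A nrm Es Eu C lam \<longleftrightarrow>
     subbundle E Es \<and> subbundle E Eu \<and>
     (\<forall>x. Es x \<inter> Eu x = {0} \<and> fiber E x = {s + u |s u. s \<in> Es x \<and> u \<in> Eu x}) \<and>
     (\<forall>x. A x ` Es x = Es (f x) \<and> A x ` Eu x = Eu (f x)) \<and>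
     0 < C \<and> 0 < lam \<and> lam < 1 \<and>
     (\<forall>n x. \<forall>v\<in>Es x. nrm ((total_map f A ^^ n) (x, v)) \<le> C * lam ^ n * nrm (x, v)) \<and>
     (\<forall>n x. \<forall>v\<in>Eu x. nrm ((total_inv E f A ^^ n) (x, v)) \<le> C * lam ^ n * nrm (x, v))"

text \<open>The component of \<open>v\<close> in \<open>S x\<close> along \<open>T x\<close>.\<close>

definition component :: "('x \<Rightarrow> 'v::real_vector set) \<Rightarrow> ('x \<Rightarrow> 'v set) \<Rightarrow> 'x \<Rightarrow> 'v \<Rightarrow> 'v" where
  "component S T x v = (THE s. s \<in> S x \<and> v - s \<in> T x)"

definition adapted_norm ::
  "('x \<times> 'v::real_vector) topology \<Rightarrow> ('x \<Rightarrow> 'x) \<Rightarrow> ('x \<Rightarrow> 'v \<Rightarrow> 'v) \<Rightarrow>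
   ('x \<times> 'v \<Rightarrow> real) \<Rightarrow> ('x \<Rightarrow> 'v set) \<Rightarrow> ('x \<Rightarrow> 'v set) \<Rightarrow> nat \<Rightarrow> 'x \<times> 'v \<Rightarrow> real" where
  "adapted_norm E f A nrm Es Eu N = (\<lambda>(x, v).
     max (\<Sum>n<N. nrm ((total_map f A ^^ n) (x, component Es Eu x v)))
         (\<Sum>n<N. nrm ((total_inv E f A ^^ n) (x, component Eu Es x v))))"

text \<open>The set of perturbations \<open>\<phi>\<close>, for a given norm \<open>nrm\<close>. As in \<^const>\<open>lipschitz_on\<close>, a Lipschitz
  constant is nonnegative by definition.\<close>

definition perturbation_class ::
  "('x::topological_space \<times> 'v::real_vector) topology \<Rightarrow> ('x \<Rightarrow> 'x) \<Rightarrow> ('x \<Rightarrow> 'v \<Rightarrow> 'v) \<Rightarrow>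
   ('x \<times> 'v \<Rightarrow> real) \<Rightarrow> real \<Rightarrow> ('x \<Rightarrow> 'v \<Rightarrow> 'v) set" where
  "perturbation_class E f A nrm \<delta> = {\<phi>.
     continuous_map E E (total_map f \<phi>) \<and>
     0 \<le> \<delta> \<and>
     (\<forall>x. \<forall>u\<in>fiber E x. \<forall>v\<in>fiber E x. nrm (f x, \<phi> x u - \<phi> x v) \<le> \<delta> * nrm (x, u - v)) \<and>
     (\<forall>x. homeomorphic_map (fiber_space E x) (fiber_space E (f x))
            (total_map f (\<lambda>y v. A y v + \<phi> y v))) \<and>
     bdd_above {nrm (f x, \<phi> x v) |x v. v \<in> fiber E x}}"

definition bounded_on_fiber ::
  "('x \<times> 'v) topology \<Rightarrow> ('x \<times> 'v \<Rightarrow> real) \<Rightarrow> 'x \<Rightarrow> ('v \<Rightarrow> 'v) \<Rightarrow> bool" where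
  "bounded_on_fiber E nrm x h \<longleftrightarrow> (\<exists>B. \<forall>v\<in>fiber E x. nrm (x, h v) \<le> B)"

definition holder_on_fiber ::
  "('x \<times> 'v::real_vector) topology \<Rightarrow> ('x \<times> 'v \<Rightarrow> real) \<Rightarrow> real \<Rightarrow> 'x \<Rightarrow> ('v \<Rightarrow> 'v) \<Rightarrow> bool" where
  "holder_on_fiber E nrm \<alpha> x h \<longleftrightarrow>
     (\<exists>K. \<forall>u\<in>fiber E x. \<forall>v\<in>fiber E x. nrm (x, h u - h v) \<le> K * nrm (x, u - v) powr \<alpha>)"

end

theory Submission
  imports Defs
begin

text \<open>
  Both \<open>h\<close> and \<open>h'\<close> are bounded solutions of one functional equation
  \<open>h (\<Gamma> v) = A (h v) + \<psi> v (h v)\<close>: with \<open>\<Gamma> = A + \<phi>\<close>, \<open>\<psi> v k = - \<phi> v\<close> the map \<open>id + h\<close>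
  conjugates \<open>A + \<phi>\<close> to \<open>A\<close>, and with \<open>\<Gamma> = A\<close>, \<open>\<psi> v k = \<phi> (v + k)\<close> the map \<open>id + h'\<close>
  conjugates \<open>A\<close> to \<open>A + \<phi>\<close>. Solving the stable component forwards and the unstable component
  backwards turns the equation into a fixed point problem for a contraction with rate \<open>\<tau> + \<delta>\<close> in the
  supremum norm. The contraction preserves continuity and, when
  \<open>(\<tau> + \<delta>) (l - \<delta>)\<^sup>-\<^sup>\<alpha> < 1\<close> and \<open>\<tau> ((L + \<delta>)\<^sup>\<alpha> + \<delta>) < 1\<close>, a uniform Hoelder bound, so both pass to
  the limit of the iterates. The same contraction gives uniqueness of bounded solutions, and this
  shows that the two conjugacies are inverse to each other: their compositions minus the identity are
  bounded solutions of equations of the same type that have the solution \<open>0\<close>.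
\<close>

subsection \<open>Bundle charts\<close>

text \<open>The displacement \<open>h\<close> is only known to be Hoelder, so \<open>id + h\<close>
  cannot be inverted by a Lipschitz perturbation argument; this is why the inverse is constructed as
  the solution of a second equation. The exponent is limited because the stable part of the operator
  precomposes with the inverse of \<Gamma>, with Lipschitz constant
  \<open>1 / (l - \<delta>)\<close>, and the unstable part with \<Gamma>, with constant
  \<open>L + \<delta>\<close>. Both constants serve \<open>A\<close> and \<open>A + \<phi>\<close>
  alike, so the two conjugacies share their exponents. The topological difficulty is that the norm
  is known only to be continuous on the total space, and vectors over different base points cannot
  be subtracted. Compactness of the unit sphere in chart coordinates bounds the coordinates by the
  norm, locally uniformly. From this come completeness of the fibres, a convergence criterion
  through norm differences and, for coordinates on two complementary subbundles, continuity of the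
  projections, on which continuity of the adapted norm depends.\<close>

definition coords :: "nat \<Rightarrow> (nat \<Rightarrow> real) set" where
  "coords n = {a. \<forall>i\<ge>n. a i = 0}"

text \<open>The product topology is the type class topology of
  \<open>nat \<Rightarrow> real\<close>, so chart arguments can be carried out with
  \<open>continuous_on\<close>, \<open>compact\<close> and ordinary limits.\<close>

lemma Euclidean_space_eq_coords: "Euclidean_space n = top_of_set (coords n)"
  by (simp add: Euclidean_space_def coords_def euclidean_product_topology)

text \<open>A local trivialization with its inverse family \<open>\<rho>\<close> made explicit.
  There is no linearity clause for \<open>\<rho>\<close>, because it follows from the one for
  \<open>\<psi>\<close>.\<close>

definition bundle_chart ::
  "('x::topological_space \<times> 'v::real_vector) topology \<Rightarrow> 'x set \<Rightarrow> nat \<Rightarrow>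
   ('x \<Rightarrow> 'v \<Rightarrow> nat \<Rightarrow> real) \<Rightarrow> ('x \<Rightarrow> (nat \<Rightarrow> real) \<Rightarrow> 'v) \<Rightarrow> bool" where
  "bundle_chart E U n \<psi> \<rho> \<longleftrightarrow> open U \<and>
     homeomorphic_maps (subtopology E (U \<times> UNIV)) (top_of_set (U \<times> coords n))
       (\<lambda>(y, v). (y, \<psi> y v)) (\<lambda>(y, a). (y, \<rho> y a)) \<and>
     (\<forall>y\<in>U. \<forall>u\<in>fiber E y. \<forall>v\<in>fiber E y. \<forall>a b.
        \<psi> y (a *\<^sub>R u + b *\<^sub>R v) = (\<lambda>i. a * \<psi> y u i + b * \<psi> y v i))"

lemma vector_bundle_subspace: "vector_bundle E \<Longrightarrow> subspace (fiber E x)"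
  by (simp add: vector_bundle_def)

lemma vector_bundle_fst: "vector_bundle E \<Longrightarrow> continuous_map E euclidean fst"
  by (simp add: vector_bundle_def)

lemma mem_fiber_iff: "v \<in> fiber E x \<longleftrightarrow> (x, v) \<in> topspace E"
  by (simp add: fiber_def)

lemma vector_bundle_chart:
  assumes "vector_bundle E"
  obtains U n \<psi> \<rho> where "x \<in> U" "bundle_chart E U n \<psi> \<rho>"
proof -
  obtain U n \<psi> where U: "open U" "x \<in> U" and
    hom: "homeomorphic_map (subtopology E (U \<times> UNIV))
          (prod_topology (top_of_set U) (Euclidean_space n)) (\<lambda>(y, v). (y, \<psi> y v))" and
    lin: "\<forall>y\<in>U. \<forall>u\<in>fiber E y. \<forall>v\<in>fiber E y. \<forall>a b.
           \<psi> y (a *\<^sub>R u + b *\<^sub>R v) = (\<lambda>i. a * \<psi> y u i + b * \<psi> y v i)"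
  proof -
    from assms have "\<exists>U n \<psi>. open U \<and> x \<in> U \<and>
        homeomorphic_map (subtopology E (U \<times> UNIV))
          (prod_topology (top_of_set U) (Euclidean_space n)) (\<lambda>(y, v). (y, \<psi> y v)) \<and>
        (\<forall>y\<in>U. \<forall>u\<in>fiber E y. \<forall>v\<in>fiber E y. \<forall>a b.
           \<psi> y (a *\<^sub>R u + b *\<^sub>R v) = (\<lambda>i. a * \<psi> y u i + b * \<psi> y v i))"
      unfolding vector_bundle_def by simp
    then show ?thesis using that by (elim exE conjE)
  qed
  from hom have "homeomorphic_map (subtopology E (U \<times> UNIV))
          (top_of_set (U \<times> coords n)) (\<lambda>(y, v). (y, \<psi> y v))"
    by (simp add: Euclidean_space_eq_coords)
  then obtain k where k: "homeomorphic_maps (subtopology E (U \<times> UNIV))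
          (top_of_set (U \<times> coords n)) (\<lambda>(y, v). (y, \<psi> y v)) k"
    using homeomorphic_map_maps by blast
  \<comment> \<open>The abstract inverse \<open>k\<close> preserves base points, being a right
    inverse of a map that does; hence it has the fibrewise form required of
    \<open>\<rho>\<close>.\<close>
  have keq: "k (y, a) = (y, snd (k (y, a)))" if "(y, a) \<in> U \<times> coords n" for y a
  proof -
    have "(\<lambda>(y, v). (y, \<psi> y v)) (k (y, a)) = (y, a)"
      using k that by (auto simp: homeomorphic_maps_def)
    then show ?thesis by (cases "k (y, a)") auto
  qed
  have "homeomorphic_maps (subtopology E (U \<times> UNIV))
          (top_of_set (U \<times> coords n)) (\<lambda>(y, v). (y, \<psi> y v)) (\<lambda>(y, a). (y, snd (k (y, a))))"
    by (rule homeomorphic_maps_eq[OF k]) (use keq in auto)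
  then show thesis
    using that[of U n \<psi> "\<lambda>y a. snd (k (y, a))"] U lin by (auto simp: bundle_chart_def)
qed

context
  fixes E :: "('x::topological_space \<times> 'v::real_vector) topology" and U n \<psi> \<rho>
  assumes chart: "bundle_chart E U n \<psi> \<rho>"
begin

lemma chart_open: "open U"
  using chart by (simp add: bundle_chart_def)

lemma chart_maps:
  "continuous_map (subtopology E (U \<times> UNIV)) (top_of_set (U \<times> coords n)) (\<lambda>(y, v). (y, \<psi> y v))"
  "continuous_map (top_of_set (U \<times> coords n)) (subtopology E (U \<times> UNIV)) (\<lambda>(y, a). (y, \<rho> y a))"
  using chart by (auto simp: bundle_chart_def homeomorphic_maps_def)

lemma chart_inverse:
  assumes "y \<in> U"
  shows "v \<in> fiber E y \<Longrightarrow> \<psi> y v \<in> coords n" "v \<in> fiber E y \<Longrightarrow> \<rho> y (\<psi> y v) = v"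
    "a \<in> coords n \<Longrightarrow> \<rho> y a \<in> fiber E y" "a \<in> coords n \<Longrightarrow> \<psi> y (\<rho> y a) = a"
proof -
  note m = chart[unfolded bundle_chart_def homeomorphic_maps_def]
  show "\<psi> y v \<in> coords n" "\<rho> y (\<psi> y v) = v" if "v \<in> fiber E y"
  proof -
    have p: "(y, v) \<in> topspace (subtopology E (U \<times> UNIV))"
      using assms that by (simp add: mem_fiber_iff)
    have "(\<lambda>(y, a). (y, \<rho> y a)) ((\<lambda>(y, v). (y, \<psi> y v)) (y, v)) = (y, v)" using p m by blast
    then show "\<rho> y (\<psi> y v) = v" by simp
    show "\<psi> y v \<in> coords n"
      using continuous_map_image_subset_topspace[OF chart_maps(1)] p by auto
  qed
  show "\<rho> y a \<in> fiber E y" "\<psi> y (\<rho> y a) = a" if "a \<in> coords n"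
  proof -
    have p: "(y, a) \<in> topspace (top_of_set (U \<times> coords n))"
      using assms that by simp
    show "\<psi> y (\<rho> y a) = a" using p m by auto
    show "\<rho> y a \<in> fiber E y"
      using continuous_map_image_subset_topspace[OF chart_maps(2)] p by (auto simp: mem_fiber_iff)
  qed
qed

lemma chart_linear:
  assumes "y \<in> U" "u \<in> fiber E y" "v \<in> fiber E y"
  shows "\<psi> y (a *\<^sub>R u + b *\<^sub>R v) i = a * \<psi> y u i + b * \<psi> y v i"
  using chart assms by (simp add: bundle_chart_def)

lemma chart_linear_inv:
  assumes "y \<in> U" "c \<in> coords n" "d \<in> coords n" and E: "subspace (fiber E y)"
  shows "\<rho> y (\<lambda>i. a * c i + b * d i) = a *\<^sub>R \<rho> y c + b *\<^sub>R \<rho> y d"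
proof -
  have *: "a *\<^sub>R \<rho> y c + b *\<^sub>R \<rho> y d \<in> fiber E y"
    using assms chart_inverse(3) by (simp add: subspace_add subspace_scale)
  have "\<psi> y (a *\<^sub>R \<rho> y c + b *\<^sub>R \<rho> y d) = (\<lambda>i. a * c i + b * d i)"
    using assms by (auto simp: fun_eq_iff chart_linear chart_inverse)
  then show ?thesis using chart_inverse(2)[OF assms(1) *] by simp
qed

text \<open>Over a neighbourhood of \<open>x\<close> the total space is a product of the base with a
  coordinate space, so convergence in \<open>E\<close> reduces to convergence in the base and of
  each real coordinate. All later limits in bundles are computed through this equivalence.\<close>

lemma chart_limitin_iff:
  assumes "x \<in> U" and fst: "continuous_map E euclidean fst"
  shows "limitin E F (x, v) \<F> \<longleftrightarrow> v \<in> fiber E x \<and> (\<forall>\<^sub>F z in \<F>. F z \<in> topspace E) \<and>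
     ((\<lambda>z. fst (F z)) \<longlongrightarrow> x) \<F> \<and> (\<forall>i. ((\<lambda>z. \<psi> (fst (F z)) (snd (F z)) i) \<longlongrightarrow> \<psi> x v i) \<F>)"
    (is "?L \<longleftrightarrow> ?R")
proof
  assume L: ?L
  have 1: "v \<in> fiber E x" using limitin_topspace[OF L] by (simp add: mem_fiber_iff)
  have 2: "\<forall>\<^sub>F z in \<F>. F z \<in> topspace E" using L by (simp add: limitin_def)
  have 3: "((\<lambda>z. fst (F z)) \<longlongrightarrow> x) \<F>"
    using continuous_map_limit[OF fst L] by (simp add: o_def)
  have "\<forall>\<^sub>F z in \<F>. fst (F z) \<in> U" using topological_tendstoD[OF 3 chart_open assms(1)] .
  then have "limitin (subtopology E (U \<times> UNIV)) F (x, v) \<F>"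
    using L assms(1) by (auto simp: limitin_subtopology mem_Times_iff)
  from continuous_map_limit[OF chart_maps(1) this]
  have "((\<lambda>z. (fst (F z), \<psi> (fst (F z)) (snd (F z)))) \<longlongrightarrow> (x, \<psi> x v)) \<F>"
    by (simp add: limitin_subtopology o_def case_prod_unfold)
  then have "((\<lambda>z. \<psi> (fst (F z)) (snd (F z))) \<longlongrightarrow> \<psi> x v) \<F>"
    using tendsto_snd by fastforce
  then have "limitin (product_topology (\<lambda>i. euclidean) UNIV) (\<lambda>z. \<psi> (fst (F z)) (snd (F z))) (\<psi> x v) \<F>"
    by (simp add: euclidean_product_topology)
  then have 4: "\<forall>i. ((\<lambda>z. \<psi> (fst (F z)) (snd (F z)) i) \<longlongrightarrow> \<psi> x v i) \<F>"
    by (simp add: limitin_componentwise)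
  show ?R using 1 2 3 4 by auto
next
  assume R: ?R
  then have ev: "\<forall>\<^sub>F z in \<F>. fst (F z) \<in> U"
    using topological_tendstoD[OF _ chart_open assms(1)] by auto
  have "limitin (product_topology (\<lambda>i. euclidean) UNIV) (\<lambda>z. \<psi> (fst (F z)) (snd (F z))) (\<psi> x v) \<F>"
    using R by (subst limitin_componentwise) auto
  then have "((\<lambda>z. \<psi> (fst (F z)) (snd (F z))) \<longlongrightarrow> \<psi> x v) \<F>"
    by (simp add: euclidean_product_topology)
  then have T: "((\<lambda>z. (fst (F z), \<psi> (fst (F z)) (snd (F z)))) \<longlongrightarrow> (x, \<psi> x v)) \<F>"
    using R by (intro tendsto_Pair) auto
  have ev2: "\<forall>\<^sub>F z in \<F>. fst (F z) \<in> U \<and> snd (F z) \<in> fiber E (fst (F z))"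
    using ev R by (auto simp: mem_fiber_iff eventually_conj_iff)
  then have "\<forall>\<^sub>F z in \<F>. (fst (F z), \<psi> (fst (F z)) (snd (F z))) \<in> U \<times> coords n"
    by eventually_elim (simp add: chart_inverse)
  moreover have "(x, \<psi> x v) \<in> U \<times> coords n" using R assms(1) by (simp add: chart_inverse)
  ultimately have "limitin (top_of_set (U \<times> coords n)) (\<lambda>z. (fst (F z), \<psi> (fst (F z)) (snd (F z)))) (x, \<psi> x v) \<F>"
    unfolding limitin_subtopology limitin_canonical_iff using T by blast
  from continuous_map_limit[OF chart_maps(2) this]
  have "limitin E (\<lambda>z. (fst (F z), \<rho> (fst (F z)) (\<psi> (fst (F z)) (snd (F z))))) (x, v) \<F>"
    using R assms(1) by (simp add: limitin_subtopology o_def case_prod_unfold chart_inverse)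
  \<comment> \<open>Going through the chart and back returns \<open>F z\<close> only while
    \<open>F z\<close> lies over \<open>U\<close>, which holds eventually.\<close>
  moreover have "\<forall>\<^sub>F z in \<F>. (fst (F z), \<rho> (fst (F z)) (\<psi> (fst (F z)) (snd (F z)))) = F z"
    using ev2 by eventually_elim (auto simp: chart_inverse)
  ultimately show ?L by (rule limitin_transform_eventually[rotated])
qed

lemma chart_continuous_inv:
  "continuous_map (top_of_set (U \<times> coords n)) E (\<lambda>(y, a). (y, \<rho> y a))"
  using chart_maps(2) by (simp add: continuous_map_in_subtopology)

end

section \<open>A compactness estimate in chart coordinates\<close>

text \<open>On the compact l1 unit sphere \<open>q (x, _)\<close> has a positive minimum, continuity
  keeps half of it over nearby base points, and homogeneity extends the bound from the sphere to all
  of \<open>coords n\<close>. Positivity is demanded over the single point \<open>x\<close> and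
  thereby obtained nearby.\<close>

lemma coords_norm_lower_bound:
  fixes q :: "'x::topological_space \<times> (nat \<Rightarrow> real) \<Rightarrow> real"
  assumes U: "open U" "x \<in> U" and cont: "continuous_on (U \<times> coords n) q"
    and hom: "\<And>y a t. y \<in> U \<Longrightarrow> a \<in> coords n \<Longrightarrow> q (y, \<lambda>i. t * a i) = \<bar>t\<bar> * q (y, a)"
    and pos: "\<And>a. a \<in> coords n \<Longrightarrow> a \<noteq> (\<lambda>i. 0) \<Longrightarrow> 0 < q (x, a)"
  obtains c V where "0 < c" "open V" "x \<in> V" "V \<subseteq> U"
    "\<And>y a. y \<in> V \<Longrightarrow> a \<in> coords n \<Longrightarrow> c * (\<Sum>i<n. \<bar>a i\<bar>) \<le> q (y, a)"
proof -
  define K where "K = coords n \<inter> {a. (\<Sum>i<n. \<bar>a i\<bar>) = 1}"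
  \<comment> \<open>A box that is compact by Tychonoff, with the coordinates from \<open>n\<close>
    on pinned to \<open>0\<close>; the l1 sphere \<open>K\<close> is a closed subset of it.\<close>
  define J where "J = PiE UNIV (\<lambda>i. if i < n then {-1..1::real} else {0})"
  have contp: "continuous_on S (\<lambda>a::nat \<Rightarrow> real. a i)" for S i
    by (rule continuous_on_product_then_coordinatewise) (rule continuous_on_id)
  have "compactin (product_topology (\<lambda>i::nat. euclidean) UNIV) J"
    unfolding J_def by (subst compactin_PiE) auto
  then have "compact J" by (simp add: euclidean_product_topology)
  moreover have "closed {a::nat \<Rightarrow> real. (\<Sum>i<n. \<bar>a i\<bar>) = 1}"
    by (intro closed_Collect_eq continuous_intros contp)
  ultimately have "compact (J \<inter> {a. (\<Sum>i<n. \<bar>a i\<bar>) = 1})" by (rule compact_Int_closed)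
  moreover have "J \<inter> {a. (\<Sum>i<n. \<bar>a i\<bar>) = 1} = K"
  proof -
    have "a \<in> J" if "a \<in> K" for a
    proof -
      have "\<bar>a i\<bar> \<le> 1" if "i < n" for i
        using \<open>a \<in> K\<close> member_le_sum[of i "{..<n}" "\<lambda>i. \<bar>a i\<bar>"] that by (auto simp: K_def)
      then have "a i \<in> (if i < n then {-1..1} else {0})" for i
        using that by (cases "i < n") (simp_all add: abs_le_iff K_def coords_def minus_le_iff)
      then show ?thesis by (simp add: J_def PiE_iff del: if_split)
    qed
    moreover have "a \<in> coords n" if "a \<in> J" for a
    proof -
      have "a i \<in> (if i < n then {-1..1} else {0})" for i using PiE_mem[OF that[unfolded J_def]] by simp
      then have "a i = 0" if "i \<ge> n" for i using that by (metis leD singletonD)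
      then show ?thesis by (simp add: coords_def)
    qed
    ultimately show ?thesis by (auto simp: K_def)
  qed
  ultimately have K: "compact K" by simp
  have KS: "K \<subseteq> coords n" by (auto simp: K_def)
  have contK: "continuous_on (U \<times> K) q"
    using cont by (rule continuous_on_subset) (use KS in auto)
  have "\<exists>e>0. \<forall>a\<in>K. e \<le> q (x, a)"
  proof (cases "K = {}")
    case False
    have "continuous_on K (\<lambda>a. q (x, a))"
      by (rule continuous_on_compose2[OF contK]) (use U in \<open>auto intro!: continuous_intros\<close>)
    then obtain a where a: "a \<in> K" "\<forall>b\<in>K. q (x, a) \<le> q (x, b)"
      using continuous_attains_inf[OF K False] by blast
    have "a \<noteq> (\<lambda>i. 0)" using a(1) by (auto simp: K_def)
    then show ?thesis using a pos KS by blast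
  \<comment> \<open>The sphere is empty when \<open>n = 0\<close>, and then any positive constant
    will do.\<close>
  qed (auto intro: exI[of _ 1])
  then obtain e where e: "e > 0" "\<And>a. a \<in> K \<Longrightarrow> e \<le> q (x, a)" by blast
  \<comment> \<open>Compactness of \<open>K\<close> makes continuity at \<open>x\<close> uniform
    over the sphere, so one neighbourhood costs at most half of the minimum
    \<open>e\<close>.\<close>
  obtain W where W: "x \<in> W" "open W" "\<forall>y\<in>W \<inter> U. \<forall>a\<in>K. dist (q (y, a)) (q (x, a)) \<le> e / 2"
    using continuous_on_prod_compactE[OF contK K U(2), of "e / 2"] e by auto
  show thesis
  proof (rule that[of "e / 2" "W \<inter> U"])
    fix y a assume y: "y \<in> W \<inter> U" and a: "a \<in> coords n"
    define s where "s = (\<Sum>i<n. \<bar>a i\<bar>)"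
    have "s \<ge> 0" by (simp add: s_def sum_nonneg)
    show "e / 2 * s \<le> q (y, a)"
    proof (cases "s = 0")
      case True
      then have "\<forall>i<n. a i = 0" by (simp add: s_def sum_nonneg_eq_0_iff)
      then have "a = (\<lambda>i. 0 * a i)" using a by (auto simp: coords_def fun_eq_iff) (metis not_le)
      then have "q (y, a) = 0" using hom[of y a 0] y a by simp
      then show ?thesis using True by simp
    next
      case False
      then have s: "s > 0" using \<open>s \<ge> 0\<close> by simp
      have k: "(\<lambda>i. inverse s * a i) \<in> K"
        using s a by (auto simp: K_def coords_def abs_mult simp flip: sum_distrib_left s_def)
      have "e / 2 \<le> q (y, \<lambda>i. inverse s * a i)"
using bspec[OF bspec[OF W(3) y] k, unfolded dist_real_def] e(2)[OF k] by linarith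
      also have "\<dots> = inverse s * q (y, a)" using hom[of y a "inverse s"] y a s by simp
      finally show ?thesis using s by (simp add: field_simps)
    qed
  qed (use U W e in auto)
qed

lemma snd_mem_fiber: "p \<in> topspace E \<Longrightarrow> fst p = x \<Longrightarrow> snd p \<in> fiber E x"
  by (auto simp: fiber_def)

text \<open>In a chart the vector space operations act coordinate by coordinate, hence they are
  continuous on the fibre product. The assumption \<open>eq\<close> gives the sum a meaning, as both
  vectors must lie over the same base point.\<close>

lemma limitin_fiber_combination:
  assumes E: "vector_bundle E" and F: "limitin E F (x, u) \<F>" and G: "limitin E G (x, v) \<F>"
    and eq: "\<forall>\<^sub>F z in \<F>. fst (F z) = fst (G z)"
  shows "limitin E (\<lambda>z. (fst (F z), a *\<^sub>R snd (F z) + b *\<^sub>R snd (G z))) (x, a *\<^sub>R u + b *\<^sub>R v) \<F>"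
proof -
  obtain U n \<psi> \<rho> where x: "x \<in> U" and ch: "bundle_chart E U n \<psi> \<rho>"
    using vector_bundle_chart[OF E] by metis
  note iff = chart_limitin_iff[OF ch x vector_bundle_fst[OF E]]
  note F' = F[unfolded iff] and G' = G[unfolded iff]
  have sub: "subspace (fiber E y)" for y using E by (rule vector_bundle_subspace)
  have evU: "\<forall>\<^sub>F z in \<F>. fst (F z) \<in> U"
    using F' topological_tendstoD[OF _ chart_open[OF ch] x] by auto
  have uv: "a *\<^sub>R u + b *\<^sub>R v \<in> fiber E x"
    using F' G' sub by (simp add: subspace_add subspace_scale)
  have ev: "\<forall>\<^sub>F z in \<F>. fst (F z) \<in> U \<and> fst (F z) = fst (G z) \<and>
      snd (F z) \<in> fiber E (fst (F z)) \<and> snd (G z) \<in> fiber E (fst (F z))"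
    using conjunct1[OF conjunct2[OF F']] conjunct1[OF conjunct2[OF G']] evU eq
    by eventually_elim (auto intro: snd_mem_fiber)
  have in_top: "\<forall>\<^sub>F z in \<F>. (fst (F z), a *\<^sub>R snd (F z) + b *\<^sub>R snd (G z)) \<in> topspace E"
    using ev by eventually_elim (use sub in \<open>auto simp: subspace_add subspace_scale simp flip: mem_fiber_iff\<close>)
  have co: "((\<lambda>z. \<psi> (fst (F z)) (a *\<^sub>R snd (F z) + b *\<^sub>R snd (G z)) i) \<longlongrightarrow> \<psi> x (a *\<^sub>R u + b *\<^sub>R v) i) \<F>" for i
  proof -
    have "((\<lambda>z. a * \<psi> (fst (F z)) (snd (F z)) i + b * \<psi> (fst (G z)) (snd (G z)) i)
        \<longlongrightarrow> a * \<psi> x u i + b * \<psi> x v i) \<F>"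
      using F' G' by (intro tendsto_intros) auto
    moreover have "\<forall>\<^sub>F z in \<F>. \<psi> (fst (F z)) (a *\<^sub>R snd (F z) + b *\<^sub>R snd (G z)) i =
        a * \<psi> (fst (F z)) (snd (F z)) i + b * \<psi> (fst (G z)) (snd (G z)) i"
      using ev by eventually_elim (auto simp: chart_linear[OF ch])
    ultimately show ?thesis
      using F' G' x by (simp add: chart_linear[OF ch] tendsto_cong)
  qed
  show ?thesis
    unfolding iff fst_conv snd_conv using F' uv in_top co by blast
qed

lemma eventually_atin_topspace: "\<forall>\<^sub>F z in atin Z a. z \<in> topspace Z"
  by (auto simp: eventually_atin)

lemma continuous_map_fiber_combination:
  assumes E: "vector_bundle E" and F: "continuous_map Z E (\<lambda>z. (p z, F z))"
    and G: "continuous_map Z E (\<lambda>z. (p z, G z))"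
  shows "continuous_map Z E (\<lambda>z. (p z, a *\<^sub>R F z + b *\<^sub>R G z))"
  unfolding continuous_map_atin
proof
  fix z assume z: "z \<in> topspace Z"
  show "limitin E (\<lambda>z. (p z, a *\<^sub>R F z + b *\<^sub>R G z)) (p z, a *\<^sub>R F z + b *\<^sub>R G z) (atin Z z)"
    using limitin_fiber_combination[OF E, of "\<lambda>z. (p z, F z)" "p z" "F z" "atin Z z" "\<lambda>z. (p z, G z)" "G z" a b]
      F G z by (simp add: continuous_map_atin)
qed

text \<open>Freezing the chart coordinates of \<open>v\<close> yields a vector over each nearby base
  point. Such a section supplies the reference vector in the same fibre that norm differences
  require.\<close>

lemma local_section:
  assumes E: "vector_bundle E" and v: "v \<in> fiber E x"
  obtains \<sigma> where "limitin E (\<lambda>y. (y, \<sigma> y)) (x, v) (nhds x)"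
proof -
  obtain U n \<psi> \<rho> where x: "x \<in> U" and ch: "bundle_chart E U n \<psi> \<rho>"
    using vector_bundle_chart[OF E] by metis
  define \<sigma> where "\<sigma> y = \<rho> y (\<psi> x v)" for y
  have c: "\<psi> x v \<in> coords n" using chart_inverse(1)[OF ch x v] .
  have evU: "\<forall>\<^sub>F y in nhds x. y \<in> U"
    using chart_open[OF ch] x by (rule eventually_nhds_in_open)
  have 1: "\<forall>\<^sub>F y in nhds x. (y, \<sigma> y) \<in> topspace E"
    using evU by eventually_elim (simp add: \<sigma>_def chart_inverse[OF ch] c flip: mem_fiber_iff)
  have "\<forall>\<^sub>F y in nhds x. \<psi> y (\<sigma> y) i = \<psi> x v i" for i
    using evU by eventually_elim (simp add: \<sigma>_def chart_inverse[OF ch] c)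
  then have 2: "((\<lambda>y. \<psi> y (\<sigma> y) i) \<longlongrightarrow> \<psi> x v i) (nhds x)" for i
    by (rule tendsto_eventually)
  have "limitin E (\<lambda>y. (y, \<sigma> y)) (x, v) (nhds x)"
    unfolding chart_limitin_iff[OF ch x vector_bundle_fst[OF E]] fst_conv snd_conv
    using v 1 2 by (auto intro: filterlim_ident)
  then show thesis by (rule that)
qed

lemma limitin_compose_filterlim:
  assumes "limitin X f l F" "filterlim g F G"
  shows "limitin X (\<lambda>z. f (g z)) l G"
  using assms eventually_compose_filterlim[of _ F g G] unfolding limitin_def by blast

subsection \<open>Norms on a bundle\<close>

text \<open>The adapted norm is a maximum of sums and does not come from an inner product, so only
  the norm axioms are kept. The sole link between norm and topology is
  \<open>norm_continuous\<close>.\<close>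

locale normed_bundle =
  fixes E :: "('x::topological_space \<times> 'v::real_vector) topology" and \<nu> :: "'x \<times> 'v \<Rightarrow> real"
  assumes is_bundle: "vector_bundle E"
    and norm_continuous: "continuous_map E euclideanreal \<nu>"
    and norm_triangle: "u \<in> fiber E x \<Longrightarrow> v \<in> fiber E x \<Longrightarrow> \<nu> (x, u + v) \<le> \<nu> (x, u) + \<nu> (x, v)"
    and norm_scale: "v \<in> fiber E x \<Longrightarrow> \<nu> (x, a *\<^sub>R v) = \<bar>a\<bar> * \<nu> (x, v)"
    and norm_pos: "v \<in> fiber E x \<Longrightarrow> v \<noteq> 0 \<Longrightarrow> 0 < \<nu> (x, v)"
begin

lemma fiber_subspace: "subspace (fiber E x)"
  using is_bundle by (rule vector_bundle_subspace)

lemma fiber_closed [simp]: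
  "0 \<in> fiber E x"
  "u \<in> fiber E x \<Longrightarrow> v \<in> fiber E x \<Longrightarrow> u + v \<in> fiber E x"
  "u \<in> fiber E x \<Longrightarrow> v \<in> fiber E x \<Longrightarrow> u - v \<in> fiber E x"
  "u \<in> fiber E x \<Longrightarrow> - u \<in> fiber E x"
  "u \<in> fiber E x \<Longrightarrow> a *\<^sub>R u \<in> fiber E x"
  using fiber_subspace[of x] by (auto simp: subspace_add subspace_diff subspace_scale subspace_0 subspace_neg)

lemma norm_zero [simp]: "\<nu> (x, 0) = 0"
  using norm_scale[of 0 x 0] by simp

lemma norm_nonneg: "v \<in> fiber E x \<Longrightarrow> 0 \<le> \<nu> (x, v)"
  using norm_pos[of v x] by (cases "v = 0") auto

lemma norm_eq_zero: "v \<in> fiber E x \<Longrightarrow> \<nu> (x, v) \<le> 0 \<Longrightarrow> v = 0"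
  using norm_pos[of v x] by fastforce

lemma norm_minus: "v \<in> fiber E x \<Longrightarrow> \<nu> (x, - v) = \<nu> (x, v)"
  using norm_scale[of v x "-1"] by simp

lemma norm_diff_commute: "u \<in> fiber E x \<Longrightarrow> v \<in> fiber E x \<Longrightarrow> \<nu> (x, u - v) = \<nu> (x, v - u)"
  using norm_minus[of "u - v" x] by simp

lemma norm_diff_le: "u \<in> fiber E x \<Longrightarrow> v \<in> fiber E x \<Longrightarrow> \<nu> (x, u - v) \<le> \<nu> (x, u) + \<nu> (x, v)"
  using norm_triangle[of u x "- v"] by (simp add: norm_minus)

lemma norm_diff_triangle:
  "u \<in> fiber E x \<Longrightarrow> v \<in> fiber E x \<Longrightarrow> w \<in> fiber E x \<Longrightarrow> \<nu> (x, u - w) \<le> \<nu> (x, u - v) + \<nu> (x, v - w)"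
  using norm_triangle[of "u - v" x "v - w"] by simp

lemma continuous_map_total_sum:
  assumes "continuous_map E E (total_map a F)" "continuous_map E E (total_map a F')"
  shows "continuous_map E E (total_map a (\<lambda>x v. s *\<^sub>R F x v + t *\<^sub>R F' x v))"
  using continuous_map_fiber_combination[OF is_bundle, of E "\<lambda>p. a (fst p)" "\<lambda>p. F (fst p) (snd p)"
      "\<lambda>p. F' (fst p) (snd p)" s t] assms
  by (simp add: total_map_def case_prod_unfold)

section \<open>From norm estimates to convergence in the total space\<close>

text \<open>Written in chart coordinates, the norm is absolutely homogeneous, positive and
  continuous, so \<open>coords_norm_lower_bound\<close> applies. Each single coordinate is then
  dominated by the norm, uniformly near \<open>x\<close>.\<close>

lemma chart_coordinate_bound:
  assumes ch: "bundle_chart E U n \<psi> \<rho>" and x: "x \<in> U"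
  obtains c V where "0 < c" "open V" "x \<in> V" "V \<subseteq> U"
    "\<And>y v i. y \<in> V \<Longrightarrow> v \<in> fiber E y \<Longrightarrow> c * \<bar>\<psi> y v i\<bar> \<le> \<nu> (y, v)"
proof -
  define q where "q = \<nu> \<circ> (\<lambda>(y, a). (y, \<rho> y a))"
  have z: "(\<lambda>i. 0) \<in> coords n" by (simp add: coords_def)
  have cont: "continuous_on (U \<times> coords n) q"
    using continuous_map_compose[OF chart_continuous_inv[OF ch] norm_continuous]
    by (simp add: q_def)
  have lin: "\<rho> y (\<lambda>i. t * a i) = t *\<^sub>R \<rho> y a" if "y \<in> U" "a \<in> coords n" for y a t
    using chart_linear_inv[OF ch that that(2) fiber_subspace, of t 0] by simp
  have hom: "q (y, \<lambda>i. t * a i) = \<bar>t\<bar> * q (y, a)" if "y \<in> U" "a \<in> coords n" for y a t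
    using that by (simp add: q_def lin norm_scale chart_inverse[OF ch])
  have pos: "0 < q (x, a)" if "a \<in> coords n" "a \<noteq> (\<lambda>i. 0)" for a
  proof -
    have "\<rho> x a \<noteq> 0"
      using chart_inverse(4)[OF ch x that(1)] chart_inverse(4)[OF ch x z] lin[OF x z, of 0] that(2) by fastforce
    then show ?thesis using that x by (simp add: q_def norm_pos chart_inverse[OF ch])
  qed
  obtain c V where V: "0 < c" "open V" "x \<in> V" "V \<subseteq> U"
    "\<And>y a. y \<in> V \<Longrightarrow> a \<in> coords n \<Longrightarrow> c * (\<Sum>i<n. \<bar>a i\<bar>) \<le> q (y, a)"
    using coords_norm_lower_bound[OF chart_open[OF ch] x cont hom pos] by metis
  have "c * \<bar>\<psi> y v i\<bar> \<le> \<nu> (y, v)" if y: "y \<in> V" and v: "v \<in> fiber E y" for y v i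
  proof -
    have yU: "y \<in> U" using y V by auto
    note inv = chart_inverse[OF ch yU]
    have "\<bar>\<psi> y v i\<bar> \<le> (\<Sum>i<n. \<bar>\<psi> y v i\<bar>)"
    proof (cases "i < n")
      case True
      then show ?thesis by (intro member_le_sum) auto
    next
      case False
      then show ?thesis using inv(1)[OF v] by (auto simp: coords_def sum_nonneg)
    qed
    then have "c * \<bar>\<psi> y v i\<bar> \<le> c * (\<Sum>i<n. \<bar>\<psi> y v i\<bar>)" using V(1) by (intro mult_left_mono) auto
    also have "\<dots> \<le> \<nu> (y, v)" using V(5)[OF y inv(1)[OF v]] v by (simp add: q_def inv)
    finally show ?thesis .
  qed
  then show thesis using that V by blast
qed

text \<open>Near the limit point the coordinates of \<open>F\<close> and of the reference family
  \<open>S\<close> differ by at most \<open>1 / c\<close> times the norm of the difference, so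
  \<open>F\<close> has the same coordinate limits as \<open>S\<close>.\<close>

lemma limitin_of_norm_diff:
  assumes S: "limitin E S p \<F>" and eq: "\<forall>\<^sub>F z in \<F>. fst (F z) = fst (S z)"
    and F: "\<forall>\<^sub>F z in \<F>. F z \<in> topspace E"
    and lim: "((\<lambda>z. \<nu> (fst (S z), snd (F z) - snd (S z))) \<longlongrightarrow> 0) \<F>"
  shows "limitin E F p \<F>"
proof -
  obtain x v where p: "p = (x, v)" by fastforce
  obtain U n \<psi> \<rho> where x: "x \<in> U" and ch: "bundle_chart E U n \<psi> \<rho>"
    using vector_bundle_chart[OF is_bundle] by metis
  obtain c V where V: "0 < c" "open V" "x \<in> V" "V \<subseteq> U"
    "\<And>y v i. y \<in> V \<Longrightarrow> v \<in> fiber E y \<Longrightarrow> c * \<bar>\<psi> y v i\<bar> \<le> \<nu> (y, v)"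
    using chart_coordinate_bound[OF ch x] by metis
  note iff = chart_limitin_iff[OF ch x vector_bundle_fst[OF is_bundle]]
  note S' = S[unfolded p iff]
  have "\<forall>\<^sub>F z in \<F>. fst (S z) \<in> V" using S' topological_tendstoD[OF _ V(2,3)] by auto
  moreover have "\<forall>\<^sub>F z in \<F>. S z \<in> topspace E" using S' by blast
  ultimately have ev: "\<forall>\<^sub>F z in \<F>. fst (S z) \<in> V \<and> fst (F z) = fst (S z) \<and>
      snd (F z) \<in> fiber E (fst (S z)) \<and> snd (S z) \<in> fiber E (fst (S z))"
    using F eq by eventually_elim (auto intro: snd_mem_fiber)
  have co: "((\<lambda>z. \<psi> (fst (F z)) (snd (F z)) i) \<longlongrightarrow> \<psi> x v i) \<F>" for i
  proof -
    have "((\<lambda>z. \<psi> (fst (F z)) (snd (F z)) i - \<psi> (fst (S z)) (snd (S z)) i) \<longlongrightarrow> 0) \<F>"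
    proof (rule Lim_null_comparison)
      show "\<forall>\<^sub>F z in \<F>. norm (\<psi> (fst (F z)) (snd (F z)) i - \<psi> (fst (S z)) (snd (S z)) i)
         \<le> inverse c * \<nu> (fst (S z), snd (F z) - snd (S z))"
        using ev
      proof eventually_elim
        case (elim z)
        then have "\<psi> (fst (S z)) (snd (F z) - snd (S z)) i = \<psi> (fst (F z)) (snd (F z)) i - \<psi> (fst (S z)) (snd (S z)) i"
          using chart_linear[OF ch, of "fst (S z)" "snd (F z)" "snd (S z)" 1 "-1" i] V by auto
        moreover have "c * \<bar>\<psi> (fst (S z)) (snd (F z) - snd (S z)) i\<bar> \<le> \<nu> (fst (S z), snd (F z) - snd (S z))"
          using elim V by simp
        ultimately have "c * \<bar>\<psi> (fst (F z)) (snd (F z)) i - \<psi> (fst (S z)) (snd (S z)) i\<bar> \<le> \<nu> (fst (S z), snd (F z) - snd (S z))"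
          by simp
        then show ?case using V(1) by (simp add: field_simps)
      qed
      show "((\<lambda>z. inverse c * \<nu> (fst (S z), snd (F z) - snd (S z))) \<longlongrightarrow> 0) \<F>"
        using tendsto_mult_left[OF lim, of "inverse c"] by simp
    qed
    from tendsto_add[OF this, of "\<lambda>z. \<psi> (fst (S z)) (snd (S z)) i" "\<psi> x v i"] S'
    show ?thesis by simp
  qed
  have "((\<lambda>z. fst (F z)) \<longlongrightarrow> x) \<F>"
    using S' eq tendsto_cong[OF eq] by blast
  then show ?thesis unfolding p iff using S' F co by blast
qed

lemma limitin_norm:
  assumes "limitin E F p \<F>" shows "((\<lambda>z. \<nu> (F z)) \<longlongrightarrow> \<nu> p) \<F>"
  using continuous_map_limit[OF norm_continuous assms] by (simp add: o_def)

lemma limitin_norm_diff: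
  assumes "limitin E F (x, u) \<F>" "limitin E G (x, v) \<F>" "\<forall>\<^sub>F z in \<F>. fst (F z) = fst (G z)"
  shows "((\<lambda>z. \<nu> (fst (F z), snd (F z) - snd (G z))) \<longlongrightarrow> \<nu> (x, u - v)) \<F>"
  using limitin_norm[OF limitin_fiber_combination[OF is_bundle assms, of 1 "-1"]] by simp

text \<open>Convergence is tested against a local section through the limit point.\<close>

lemma continuous_map_uniform_limit:
  assumes cont: "\<And>k. continuous_map Z E (\<lambda>z. (p z, F k z))"
    and G: "\<And>z. z \<in> topspace Z \<Longrightarrow> G z \<in> fiber E (p z)"
    and lim: "e \<longlonglongrightarrow> 0" and bound: "\<And>k z. z \<in> topspace Z \<Longrightarrow> \<nu> (p z, G z - F k z) \<le> e k"
  shows "continuous_map Z E (\<lambda>z. (p z, G z))"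
  unfolding continuous_map_atin
proof
  fix z0 assume z0: "z0 \<in> topspace Z"
  have Fin: "F k z \<in> fiber E (p z)" if "z \<in> topspace Z" for k z
    using continuous_map_image_subset_topspace[OF cont[of k]] that by (auto simp: mem_fiber_iff)
  obtain \<sigma> where \<sigma>: "limitin E (\<lambda>y. (y, \<sigma> y)) (p z0, G z0) (nhds (p z0))"
    using local_section[OF is_bundle G[OF z0]] by blast
  have limF: "limitin E (\<lambda>z. (p z, F k z)) (p z0, F k z0) (atin Z z0)" for k
    using cont[of k] z0 by (simp add: continuous_map_atin)
  have p: "(p \<longlongrightarrow> p z0) (atin Z z0)"
    using continuous_map_limit[OF vector_bundle_fst[OF is_bundle] limF] by (simp add: o_def)
  have S: "limitin E (\<lambda>z. (p z, \<sigma> (p z))) (p z0, G z0) (atin Z z0)"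
    using limitin_compose_filterlim[OF \<sigma> p] .
  have evS: "\<forall>\<^sub>F z in atin Z z0. \<sigma> (p z) \<in> fiber E (p z)"
    using limitinD[OF S openin_topspace limitin_topspace[OF S]] by (simp add: mem_fiber_iff)
  show "limitin E (\<lambda>z. (p z, G z)) (p z0, G z0) (atin Z z0)"
  proof (rule limitin_of_norm_diff[OF S])
    show "\<forall>\<^sub>F z in atin Z z0. (p z, G z) \<in> topspace E"
      using eventually_atin_topspace by eventually_elim (simp add: G flip: mem_fiber_iff)
    show "((\<lambda>z. \<nu> (fst (p z, \<sigma> (p z)), snd (p z, G z) - snd (p z, \<sigma> (p z)))) \<longlongrightarrow> 0) (atin Z z0)"
    proof (rule tendstoI)
      fix \<epsilon> :: real assume "\<epsilon> > 0"
      then obtain k where "e k < \<epsilon> / 2"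
        using order_tendstoD(2)[OF lim, of "\<epsilon> / 2"] eventually_happens'[OF sequentially_bot] by force
      \<comment> \<open>Both families converge, so their fibrewise distance tends to the distance at
        \<open>z0\<close>, which the uniform error bound already makes smaller than
        \<open>\<epsilon> / 2\<close>.\<close>
      have "((\<lambda>z. \<nu> (p z, F k z - \<sigma> (p z))) \<longlongrightarrow> \<nu> (p z0, F k z0 - G z0)) (atin Z z0)"
        using limitin_norm_diff[OF limF S] by simp
      moreover have "\<nu> (p z0, F k z0 - G z0) < \<epsilon> / 2"
        using bound[OF z0, of k] norm_diff_commute[OF Fin[OF z0] G[OF z0]] \<open>e k < \<epsilon> / 2\<close> by simp
      ultimately have "\<forall>\<^sub>F z in atin Z z0. \<nu> (p z, F k z - \<sigma> (p z)) < \<epsilon> / 2"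
        by (rule order_tendstoD)
      then show "\<forall>\<^sub>F z in atin Z z0. dist (\<nu> (fst (p z, \<sigma> (p z)), snd (p z, G z) - snd (p z, \<sigma> (p z)))) 0 < \<epsilon>"
        using evS eventually_atin_topspace
      proof eventually_elim
        case (elim z)
        have "\<nu> (p z, G z - \<sigma> (p z)) \<le> \<nu> (p z, G z - F k z) + \<nu> (p z, F k z - \<sigma> (p z))"
          using elim G Fin by (intro norm_diff_triangle) auto
        also have "\<dots> < \<epsilon>" using elim bound[of z k] \<open>e k < \<epsilon> / 2\<close> by simp
        finally show ?case using norm_nonneg[of "G z - \<sigma> (p z)" "p z"] elim G by simp
      qed
    qed
  qed simp
qed

text \<open>By the coordinate bound the chart coordinates form real Cauchy sequences. Their limit
  lies in \<open>coords n\<close>, the inverse chart returns it to the fibre, and continuity of the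
  norm turns coordinate convergence back into norm convergence.\<close>

lemma fiber_complete:
  assumes v: "\<And>k. v k \<in> fiber E x" and Cau: "\<And>e. 0 < e \<Longrightarrow> \<exists>K. \<forall>m\<ge>K. \<forall>n\<ge>K. \<nu> (x, v m - v n) < e"
  obtains w where "w \<in> fiber E x" "(\<lambda>k. \<nu> (x, w - v k)) \<longlonglongrightarrow> 0"
proof -
  obtain U n \<psi> \<rho> where x: "x \<in> U" and ch: "bundle_chart E U n \<psi> \<rho>"
    using vector_bundle_chart[OF is_bundle] by metis
  obtain c V where V: "0 < c" "open V" "x \<in> V" "V \<subseteq> U"
    "\<And>y v i. y \<in> V \<Longrightarrow> v \<in> fiber E y \<Longrightarrow> c * \<bar>\<psi> y v i\<bar> \<le> \<nu> (y, v)"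
    using chart_coordinate_bound[OF ch x] by metis
  have "convergent (\<lambda>k. \<psi> x (v k) i)" for i
  proof (rule Cauchy_convergent, rule metric_CauchyI)
    fix e :: real assume e: "e > 0"
    then obtain K where K: "\<forall>m\<ge>K. \<forall>n\<ge>K. \<nu> (x, v m - v n) < c * e" using Cau[of "c * e"] V by auto
    show "\<exists>M. \<forall>m\<ge>M. \<forall>n\<ge>M. dist (\<psi> x (v m) i) (\<psi> x (v n) i) < e"
    proof (intro exI allI impI)
      fix m n assume mn: "m \<ge> K" "n \<ge> K"
      have "c * \<bar>\<psi> x (v m - v n) i\<bar> < c * e"
        using V(5)[OF V(3), of "v m - v n" i] K mn v by (smt (verit) fiber_closed)
      then have "\<bar>\<psi> x (v m - v n) i\<bar> < e" using V(1) by simp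
      moreover have "\<psi> x (v m - v n) i = \<psi> x (v m) i - \<psi> x (v n) i"
        using chart_linear[OF ch x v v, of 1 m "-1" n] by simp
      ultimately show "dist (\<psi> x (v m) i) (\<psi> x (v n) i) < e" by (simp add: dist_real_def)
    qed
  qed
  then obtain a where a: "\<And>i. (\<lambda>k. \<psi> x (v k) i) \<longlonglongrightarrow> a i" unfolding convergent_def by metis
  have "a i = 0" if "i \<ge> n" for i
  proof -
      have "(\<lambda>k. \<psi> x (v k) i) = (\<lambda>k. 0)"
        using chart_inverse(1)[OF ch x v] that by (simp add: coords_def)
      then show ?thesis using a[of i] by (simp add: LIMSEQ_const_iff)
  qed
  then have an: "a \<in> coords n" by (simp add: coords_def)
  define w where "w = \<rho> x a"
  have w: "w \<in> fiber E x" "\<psi> x w = a" using an x by (auto simp: w_def chart_inverse[OF ch])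
  have "limitin E (\<lambda>k. (x, v k)) (x, w) sequentially"
    unfolding chart_limitin_iff[OF ch x vector_bundle_fst[OF is_bundle]] using a v w by (simp flip: mem_fiber_iff)
  moreover have "limitin E (\<lambda>k::nat. (x, w)) (x, w) sequentially" using w by (simp flip: mem_fiber_iff)
  ultimately have "(\<lambda>k. \<nu> (x, w - v k)) \<longlonglongrightarrow> \<nu> (x, w - w)"
    using limitin_norm_diff[of "\<lambda>k. (x, w)" x w sequentially "\<lambda>k. (x, v k)" w] by simp
  then show thesis using that w by simp
qed

end

subsection \<open>Continuity of the components of a splitting\<close>

lemma subtopology_Sigma_fiber: "fiber (subtopology E (Sigma UNIV S)) x = fiber E x \<inter> S x"
  by (auto simp: fiber_def)

locale bundle_splitting = normed_bundle E \<nu>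
  for E :: "('x::topological_space \<times> 'v::real_vector) topology" and \<nu> +
  fixes S T :: "'x \<Rightarrow> 'v set"
  assumes S: "subbundle E S" and T: "subbundle E T"
    and S_Int_T: "S x \<inter> T x = {0}" and fiber_sum: "fiber E x = {s + u |s u. s \<in> S x \<and> u \<in> T x}"
begin

lemma S_bundle: "vector_bundle (subtopology E (Sigma UNIV S))"
  and T_bundle: "vector_bundle (subtopology E (Sigma UNIV T))"
  using S T by (auto simp: subbundle_def)

lemma S_le: "v \<in> S x \<Longrightarrow> v \<in> fiber E x" and T_le: "v \<in> T x \<Longrightarrow> v \<in> fiber E x"
  using S T by (auto simp: subbundle_def)

lemma fiber_S: "fiber (subtopology E (Sigma UNIV S)) x = S x"
  and fiber_T: "fiber (subtopology E (Sigma UNIV T)) x = T x"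
  using S_le T_le by (auto simp: subtopology_Sigma_fiber)

lemma subspace_S: "subspace (S x)" and subspace_T: "subspace (T x)"
  using vector_bundle_subspace[OF S_bundle, of x] vector_bundle_subspace[OF T_bundle, of x]
  by (simp_all add: fiber_S fiber_T)

lemma component_eqI:
  assumes "s \<in> S x" "v - s \<in> T x" shows "component S T x v = s"
  unfolding component_def
proof (rule the_equality)
  show "s \<in> S x \<and> v - s \<in> T x" using assms by simp
  fix s' assume s': "s' \<in> S x \<and> v - s' \<in> T x"
  have "s' - s \<in> S x" using s' assms subspace_S by (auto intro: subspace_diff)
  moreover have "s' - s \<in> T x"
    using subspace_diff[OF subspace_T assms(2), of "v - s'"] s' by simp
  ultimately have "s' - s = 0" using S_Int_T by blast
  then show "s' = s" by simp
qed

lemma component_mem: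
  assumes "v \<in> fiber E x"
  shows "component S T x v \<in> S x" "v - component S T x v \<in> T x"
proof -
  obtain s u where "s \<in> S x" "u \<in> T x" "v = s + u" using assms fiber_sum by auto
  then show "component S T x v \<in> S x" "v - component S T x v \<in> T x" using component_eqI[of s x v] by auto
qed

lemma component_linear:
  assumes "u \<in> fiber E x" "v \<in> fiber E x"
  shows "component S T x (a *\<^sub>R u + b *\<^sub>R v) = a *\<^sub>R component S T x u + b *\<^sub>R component S T x v"
proof (rule component_eqI)
  show "a *\<^sub>R component S T x u + b *\<^sub>R component S T x v \<in> S x"
    using component_mem assms subspace_S by (intro subspace_add subspace_scale) auto
  have "a *\<^sub>R (u - component S T x u) + b *\<^sub>R (v - component S T x v) \<in> T x"
    using component_mem assms subspace_T by (intro subspace_add subspace_scale) auto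
  then show "a *\<^sub>R u + b *\<^sub>R v - (a *\<^sub>R component S T x u + b *\<^sub>R component S T x v) \<in> T x"
    by (simp add: algebra_simps)
qed

text \<open>Lets every fact about the component in \<open>S\<close> along \<open>T\<close> be reused
  for the complementary component.\<close>

lemma splitting_swap: "bundle_splitting E \<nu> T S"
  by unfold_locales (use S T S_Int_T fiber_sum in \<open>auto, (metis add.commute)+\<close>)

lemma component_other:
  assumes "v \<in> fiber E x" shows "component T S x v = v - component S T x v"
  using component_mem[OF assms] by (intro bundle_splitting.component_eqI[OF splitting_swap]) auto

lemma component_sum: "v \<in> fiber E x \<Longrightarrow> component S T x v + component T S x v = v"
  by (simp add: component_other)

lemma component_of_S: "s \<in> S x \<Longrightarrow> component S T x s = s" "s \<in> S x \<Longrightarrow> component T S x s = 0"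
proof -
  show 1: "s \<in> S x \<Longrightarrow> component S T x s = s"
    using subspace_T subspace_0 by (intro component_eqI) auto
  show "s \<in> S x \<Longrightarrow> component T S x s = 0"
    using 1 by (simp add: component_other S_le)
qed

text \<open>Coordinates \<open>\<psi> y s\<close> and \<open>\<psi>' y u\<close> are joined to one vector with \<open>k + m\<close> entries, whose two
  halves are recovered by \<open>lo\<close> and \<open>hi\<close>, in order to apply \<open>coords_norm_lower_bound\<close>.\<close>

lemma S_coordinate_bound:
  assumes ch: "bundle_chart (subtopology E (Sigma UNIV S)) U k \<psi> \<rho>" and x: "x \<in> U"
  obtains c V where "0 < c" "open V" "x \<in> V" "V \<subseteq> U"
    "\<And>y s u i. y \<in> V \<Longrightarrow> s \<in> S y \<Longrightarrow> u \<in> T y \<Longrightarrow> c * \<bar>\<psi> y s i\<bar> \<le> \<nu> (y, s + u)"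
proof -
  obtain U' m \<psi>' \<rho>' where x': "x \<in> U'" and ch': "bundle_chart (subtopology E (Sigma UNIV T)) U' m \<psi>' \<rho>'"
    using vector_bundle_chart[OF T_bundle] by metis
  define lo where "lo c = (\<lambda>i. if i < k then c i else 0)" for c :: "nat \<Rightarrow> real"
  define hi where "hi c = (\<lambda>i. c (k + i))" for c :: "nat \<Rightarrow> real"
  note inv = chart_inverse[OF ch, unfolded fiber_S] and inv' = chart_inverse[OF ch', unfolded fiber_T]
  have lo: "lo c \<in> coords k" for c by (simp add: lo_def coords_def)
  have hi: "hi c \<in> coords m" if "c \<in> coords (k + m)" for c using that by (simp add: hi_def coords_def)
  define W where "W = U \<inter> U'"
  have W: "open W" "x \<in> W" "W \<subseteq> U" using x x' chart_open[OF ch] chart_open[OF ch'] by (auto simp: W_def)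
  \<comment> \<open>The norm of the sum of the two reconstructed vectors, as a function of the
    joined coordinates. Its positivity over \<open>x\<close> expresses that \<open>S x\<close> and
    \<open>T x\<close> meet only in \<open>0\<close>.\<close>
  define q where "q = \<nu> \<circ> (\<lambda>p. (fst p, 1 *\<^sub>R \<rho> (fst p) (lo (snd p)) + 1 *\<^sub>R \<rho>' (fst p) (hi (snd p))))"
  have contp: "continuous_on X (\<lambda>p. snd p i)" for X :: "('x \<times> (nat \<Rightarrow> real)) set" and i :: nat
    by (rule continuous_on_product_then_coordinatewise) (rule continuous_on_snd[OF continuous_on_id])
  have "continuous_on (W \<times> coords (k + m)) (\<lambda>p. (fst p, lo (snd p)))"
  proof (intro continuous_on_Pair continuous_on_fst continuous_on_id continuous_on_coordinatewise_then_product)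
    show "continuous_on (W \<times> coords (k + m)) (\<lambda>p. lo (snd p) i)" for i
      by (cases "i < k") (simp_all add: lo_def contp)
  qed
  then have "continuous_map (top_of_set (W \<times> coords (k + m))) (top_of_set (U \<times> coords k)) (\<lambda>p. (fst p, lo (snd p)))"
    using lo W by (auto simp: continuous_map_in_subtopology)
  from continuous_map_compose[OF this chart_continuous_inv[OF ch]]
  have 1: "continuous_map (top_of_set (W \<times> coords (k + m))) E (\<lambda>p. (fst p, \<rho> (fst p) (lo (snd p))))"
    by (simp add: o_def continuous_map_in_subtopology)
  have "continuous_on (W \<times> coords (k + m)) (\<lambda>p. (fst p, hi (snd p)))"
  proof (intro continuous_on_Pair continuous_on_fst continuous_on_id continuous_on_coordinatewise_then_product)
    show "continuous_on (W \<times> coords (k + m)) (\<lambda>p. hi (snd p) i)" for i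
      by (simp add: hi_def contp)
  qed
  then have "continuous_map (top_of_set (W \<times> coords (k + m))) (top_of_set (U' \<times> coords m)) (\<lambda>p. (fst p, hi (snd p)))"
    using hi by (auto simp: continuous_map_in_subtopology W_def)
  from continuous_map_compose[OF this chart_continuous_inv[OF ch']]
  have 2: "continuous_map (top_of_set (W \<times> coords (k + m))) E (\<lambda>p. (fst p, \<rho>' (fst p) (hi (snd p))))"
    by (simp add: o_def continuous_map_in_subtopology)
  have cont: "continuous_on (W \<times> coords (k + m)) q"
    using continuous_map_compose[OF continuous_map_fiber_combination[OF is_bundle 1 2, of 1 1] norm_continuous]
    by (simp only: q_def continuous_map_iff_continuous)
  have q: "q (y, c) = \<nu> (y, \<rho> y (lo c) + \<rho>' y (hi c))" for y c by (simp add: q_def)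
  have lin: "\<rho> y (\<lambda>i. t * a i) = t *\<^sub>R \<rho> y a" if "y \<in> U" "a \<in> coords k" for y a t
    using chart_linear_inv[OF ch that that(2), of t 0] subspace_S by (simp add: fiber_S)
  have lin': "\<rho>' y (\<lambda>i. t * a i) = t *\<^sub>R \<rho>' y a" if "y \<in> U'" "a \<in> coords m" for y a t
    using chart_linear_inv[OF ch' that that(2), of t 0] subspace_T by (simp add: fiber_T)
  have hom: "q (y, \<lambda>i. t * c i) = \<bar>t\<bar> * q (y, c)" if "y \<in> W" "c \<in> coords (k + m)" for y c t
  proof -
    have "lo (\<lambda>i. t * c i) = (\<lambda>i. t * lo c i)" "hi (\<lambda>i. t * c i) = (\<lambda>i. t * hi c i)"
      by (auto simp: lo_def hi_def)
    moreover have "y \<in> U" "y \<in> U'" using that by (auto simp: W_def)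
    moreover have "\<rho> y (lo c) + \<rho>' y (hi c) \<in> fiber E y"
      using inv(3)[OF \<open>y \<in> U\<close> lo] inv'(3)[OF \<open>y \<in> U'\<close> hi[OF that(2)]] S_le T_le by simp
    ultimately show ?thesis
      using lo hi[OF that(2)] by (simp add: q lin lin' norm_scale flip: scaleR_add_right)
  qed
  have pos: "0 < q (x, c)" if c: "c \<in> coords (k + m)" "c \<noteq> (\<lambda>i. 0)" for c
  proof -
    have r: "\<rho> x (lo c) \<in> S x" "\<rho>' x (hi c) \<in> T x" using inv(3)[OF x lo] inv'(3)[OF x' hi[OF c(1)]] .
    have "\<rho> x (lo c) + \<rho>' x (hi c) \<noteq> 0"
    proof
      assume eq: "\<rho> x (lo c) + \<rho>' x (hi c) = 0"
      then have "\<rho> x (lo c) = - \<rho>' x (hi c)" by (simp add: eq_neg_iff_add_eq_0)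
      then have "\<rho> x (lo c) \<in> T x" using r(2) subspace_T by (simp add: subspace_neg)
      then have z1: "\<rho> x (lo c) = 0" using r(1) S_Int_T by blast
      then have z2: "\<rho>' x (hi c) = 0" using eq z1 by simp
      have z: "(\<lambda>i. 0) \<in> coords n" for n by (simp add: coords_def)
      have "\<rho> x (\<lambda>i. 0) = 0" "\<rho>' x (\<lambda>i. 0) = 0" using lin[OF x z, of 0] lin'[OF x' z, of 0] by auto
      then have l: "lo c = (\<lambda>i. 0)" and h: "hi c = (\<lambda>i. 0)"
        using inv(4)[OF x lo, of c] inv(4)[OF x z] inv'(4)[OF x' hi[OF c(1)]] inv'(4)[OF x' z] z1 z2 by auto
      have "c i = 0" for i
        using fun_cong[OF l, of i] fun_cong[OF h, of "i - k"] by (cases "i < k") (auto simp: lo_def hi_def)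
      then show False using c(2) by auto
    qed
    then show ?thesis using r S_le T_le by (simp add: q norm_pos)
  qed
  obtain c V where V: "0 < c" "open V" "x \<in> V" "V \<subseteq> W"
    "\<And>y a. y \<in> V \<Longrightarrow> a \<in> coords (k + m) \<Longrightarrow> c * (\<Sum>i<k+m. \<bar>a i\<bar>) \<le> q (y, a)"
    using coords_norm_lower_bound[OF W(1,2) cont hom pos] by metis
  have "c * \<bar>\<psi> y s i\<bar> \<le> \<nu> (y, s + u)" if y: "y \<in> V" and s: "s \<in> S y" and u: "u \<in> T y" for y s u i
  proof -
    have yU: "y \<in> U" "y \<in> U'" using y V by (auto simp: W_def)
    define a where "a j = (if j < k then \<psi> y s j else \<psi>' y u (j - k))" for j
    note ps = inv(1)[OF yU(1) s] and pu = inv'(1)[OF yU(2) u]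
    have a: "a \<in> coords (k + m)" using pu by (auto simp: a_def coords_def)
    have loa: "lo a = \<psi> y s" and hia: "hi a = \<psi>' y u"
      using ps by (auto simp: lo_def hi_def a_def coords_def)
    have "\<bar>\<psi> y s i\<bar> \<le> (\<Sum>j<k+m. \<bar>a j\<bar>)"
    proof (cases "i < k")
      case True
      then show ?thesis using member_le_sum[of i "{..<k+m}" "\<lambda>j. \<bar>a j\<bar>"] by (simp add: a_def)
    next
      case False
      then show ?thesis using ps by (auto simp: coords_def sum_nonneg)
    qed
    then have "c * \<bar>\<psi> y s i\<bar> \<le> c * (\<Sum>j<k+m. \<bar>a j\<bar>)" using V(1) by (intro mult_left_mono) auto
    also have "\<dots> \<le> \<nu> (y, s + u)"
      using V(5)[OF y a] inv(2)[OF yU(1) s] inv'(2)[OF yU(2) u] by (simp add: q loa hia)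
    finally show ?thesis .
  qed
  then show thesis using that V W by blast
qed

text \<open>Sections of \<open>S\<close> and \<open>T\<close> through the two components at
  \<open>p\<close> have a sum that approaches \<open>z\<close> in norm.
  \<open>S_coordinate_bound\<close> converts this into closeness of the \<open>S\<close> coordinates
  of the component of \<open>z\<close> to those of the section, whose limit is known.\<close>

lemma component_continuous: "continuous_map E E (\<lambda>p. (fst p, component S T (fst p) (snd p)))"
  unfolding continuous_map_atin
proof
  fix p assume p: "p \<in> topspace E"
  obtain x v where pv: "p = (x, v)" by fastforce
  have v: "v \<in> fiber E x" using p by (simp add: pv mem_fiber_iff)
  define s u where "s = component S T x v" and "u = v - s"
  have s: "s \<in> S x" and u: "u \<in> T x" using component_mem[OF v] by (auto simp: s_def u_def)
  obtain U k \<psi> \<rho> where x: "x \<in> U" and ch: "bundle_chart (subtopology E (Sigma UNIV S)) U k \<psi> \<rho>"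
    using vector_bundle_chart[OF S_bundle] by metis
  obtain c V where V: "0 < c" "open V" "x \<in> V" "V \<subseteq> U"
    "\<And>y s u i. y \<in> V \<Longrightarrow> s \<in> S y \<Longrightarrow> u \<in> T y \<Longrightarrow> c * \<bar>\<psi> y s i\<bar> \<le> \<nu> (y, s + u)"
    using S_coordinate_bound[OF ch x] by metis
  obtain \<sigma> where \<sigma>: "limitin (subtopology E (Sigma UNIV S)) (\<lambda>y. (y, \<sigma> y)) (x, s) (nhds x)"
    using local_section[OF S_bundle] s fiber_S by metis
  obtain \<tau> where \<tau>: "limitin (subtopology E (Sigma UNIV T)) (\<lambda>y. (y, \<tau> y)) (x, u) (nhds x)"
    using local_section[OF T_bundle] u fiber_T by metis
  define \<F> where "\<F> = atin E p"
  have id: "limitin E (\<lambda>z. z) (x, v) \<F>"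
    unfolding \<F>_def pv[symmetric] using p by (intro limitin_continuous_map) auto
  have fs: "(fst \<longlongrightarrow> x) \<F>"
    using continuous_map_limit[OF vector_bundle_fst[OF is_bundle] id] by (simp add: o_def)
  note \<sigma>' = limitin_compose_filterlim[OF \<sigma> fs] and \<tau>' = limitin_compose_filterlim[OF \<tau> fs]
  have "limitin E (\<lambda>z. (fst z, 1 *\<^sub>R \<sigma> (fst z) + 1 *\<^sub>R \<tau> (fst z))) (x, 1 *\<^sub>R s + 1 *\<^sub>R u) \<F>"
    using limitin_fiber_combination[OF is_bundle, of "\<lambda>z. (fst z, \<sigma> (fst z))" x s \<F> "\<lambda>z. (fst z, \<tau> (fst z))" u 1 1]
      \<sigma>' \<tau>' by (simp add: limitin_subtopology)
  then have "limitin E (\<lambda>z. (fst z, \<sigma> (fst z) + \<tau> (fst z))) (x, v) \<F>" by (simp add: u_def)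
  from limitin_norm_diff[OF id this]
  have D: "((\<lambda>z. \<nu> (fst z, snd z - (\<sigma> (fst z) + \<tau> (fst z)))) \<longlongrightarrow> 0) \<F>" by simp
  have 1: "\<forall>\<^sub>F z in \<F>. z \<in> topspace E" unfolding \<F>_def by (rule eventually_atin_topspace)
  have 2: "\<forall>\<^sub>F z in \<F>. fst z \<in> V" using topological_tendstoD[OF fs V(2,3)] .
  have 3: "\<forall>\<^sub>F z in \<F>. \<sigma> (fst z) \<in> S (fst z)" and 4: "\<forall>\<^sub>F z in \<F>. \<tau> (fst z) \<in> T (fst z)"
    using \<sigma>' \<tau>' by (auto simp: limitin_subtopology)
  let ?C = "\<lambda>z. component S T (fst z) (snd z)"
  have 5: "\<forall>\<^sub>F z in \<F>. (fst z, ?C z) \<in> topspace (subtopology E (Sigma UNIV S))"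
    using 1 by eventually_elim
      (use component_mem(1) S_le in \<open>auto simp: mem_fiber_iff[symmetric] intro!: snd_mem_fiber\<close>)
  have co: "((\<lambda>z. \<psi> (fst z) (?C z) i) \<longlongrightarrow> \<psi> x s i) \<F>" for i
  proof -
    have "((\<lambda>z. \<psi> (fst z) (?C z) i - \<psi> (fst z) (\<sigma> (fst z)) i) \<longlongrightarrow> 0) \<F>"
    proof (rule Lim_null_comparison)
      show "\<forall>\<^sub>F z in \<F>. norm (\<psi> (fst z) (?C z) i - \<psi> (fst z) (\<sigma> (fst z)) i)
          \<le> inverse c * \<nu> (fst z, snd z - (\<sigma> (fst z) + \<tau> (fst z)))"
        using 1 2 3 4
      proof eventually_elim
        case (elim z)
        have z: "snd z \<in> fiber E (fst z)" using elim(1) by (rule snd_mem_fiber) simp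
        \<comment> \<open>The difference of \<open>z\<close> and the sum of the sections is
          decomposed along the splitting, so the coordinate bound for a sum \<open>s + u\<close>
          applies to it.\<close>
        have "?C z - \<sigma> (fst z) \<in> S (fst z)" "(snd z - ?C z) - \<tau> (fst z) \<in> T (fst z)"
          using component_mem[OF z] elim subspace_S subspace_T by (auto intro: subspace_diff)
        from V(5)[OF elim(2) this, of i]
        have "c * \<bar>\<psi> (fst z) (?C z - \<sigma> (fst z)) i\<bar> \<le> \<nu> (fst z, snd z - (\<sigma> (fst z) + \<tau> (fst z)))"
          by (simp add: algebra_simps)
        moreover have "\<psi> (fst z) (?C z - \<sigma> (fst z)) i = \<psi> (fst z) (?C z) i - \<psi> (fst z) (\<sigma> (fst z)) i"
          using chart_linear[OF ch, of "fst z" "?C z" "\<sigma> (fst z)" 1 "-1" i] V(4) elim component_mem[OF z]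
          by (auto simp: fiber_S)
        ultimately have "c * \<bar>\<psi> (fst z) (?C z) i - \<psi> (fst z) (\<sigma> (fst z)) i\<bar> \<le> \<nu> (fst z, snd z - (\<sigma> (fst z) + \<tau> (fst z)))"
          by simp
        then show ?case using V(1) by (simp add: field_simps)
      qed
      show "((\<lambda>z. inverse c * \<nu> (fst z, snd z - (\<sigma> (fst z) + \<tau> (fst z)))) \<longlongrightarrow> 0) \<F>"
        using tendsto_mult_left[OF D, of "inverse c"] by simp
    qed
    moreover have "((\<lambda>z. \<psi> (fst z) (\<sigma> (fst z)) i) \<longlongrightarrow> \<psi> x s i) \<F>"
      using \<sigma>'[unfolded chart_limitin_iff[OF ch x vector_bundle_fst[OF S_bundle]]] by simp
    ultimately show ?thesis using tendsto_add by fastforce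
  qed
  have "limitin (subtopology E (Sigma UNIV S)) (\<lambda>z. (fst z, ?C z)) (x, s) \<F>"
    unfolding chart_limitin_iff[OF ch x vector_bundle_fst[OF S_bundle]] fst_conv snd_conv fiber_S
    using s 5 fs co by blast
  then show "limitin E (\<lambda>p. (fst p, component S T (fst p) (snd p))) (fst p, component S T (fst p) (snd p)) (atin E p)"
    by (simp add: limitin_subtopology \<F>_def pv s_def)
qed

end

subsection \<open>The adapted norm\<close>

text \<open>The inner product lives only on the fibres, which are subspaces of the type, so
  Cauchy-Schwarz and the triangle inequality are derived from the bilinear form directly.\<close>

lemma normed_bundle_metric_norm:
  fixes E :: "('x::topological_space \<times> 'v::real_vector) topology"
  assumes E: "vector_bundle E" and g: "riemannian_metric E g"
  shows "normed_bundle E (metric_norm g)"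
proof
  have sym: "g x u v = g x v u" if "u \<in> fiber E x" "v \<in> fiber E x" for x u v
    using g that unfolding riemannian_metric_def by blast
  have lin: "g x (a *\<^sub>R u + b *\<^sub>R v) w = a * g x u w + b * g x v w"
    if "u \<in> fiber E x" "v \<in> fiber E x" "w \<in> fiber E x" for x u v w a b
    using g that unfolding riemannian_metric_def by blast
  have pos: "0 < g x v v" if "v \<in> fiber E x" "v \<noteq> 0" for x v
    using g that unfolding riemannian_metric_def by blast
  have sub: "subspace (fiber E x)" for x using E by (rule vector_bundle_subspace)
  note cl = subspace_0[OF sub] subspace_add[OF sub] subspace_scale[OF sub]
  have scale: "g x (a *\<^sub>R u) w = a * g x u w" if "u \<in> fiber E x" "w \<in> fiber E x" for x u w a
    using lin[OF that(1) that(1) that(2), of a 0] by simp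
  have zero: "g x 0 0 = 0" for x using scale[OF cl(1) cl(1), of x 0] by simp
  have nonneg: "0 \<le> g x v v" if "v \<in> fiber E x" for x v
    using pos[OF that] zero[of x] by (cases "v = 0") auto
  have quad: "g x (a *\<^sub>R u + b *\<^sub>R v) (a *\<^sub>R u + b *\<^sub>R v) = a\<^sup>2 * g x u u + 2 * a * b * g x u v + b\<^sup>2 * g x v v"
    if uv: "u \<in> fiber E x" "v \<in> fiber E x" for x u v a b
  proof -
    let ?w = "a *\<^sub>R u + b *\<^sub>R v"
    have w: "?w \<in> fiber E x" using uv cl by simp
    have "g x ?w ?w = a * g x ?w u + b * g x ?w v"
      using lin[OF uv w] sym[OF w] uv by simp
    also have "\<dots> = a * (a * g x u u + b * g x v u) + b * (a * g x u v + b * g x v v)"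
      using lin uv by simp
    finally show ?thesis using sym[OF uv] by (simp add: power2_eq_square algebra_simps)
  qed
  show "vector_bundle E" by (rule E)
  show "continuous_map E euclideanreal (metric_norm g)"
  proof -
    \<comment> \<open>Restricting the metric to the diagonal of the fibre product gives continuity
      of the quadratic form.\<close>
    have "continuous_map E (subtopology (prod_topology E E) {(p, q). fst p = fst q}) (\<lambda>p. (p, p))"
      by (auto simp: continuous_map_in_subtopology continuous_map_paired)
    moreover have "continuous_map (subtopology (prod_topology E E) {(p, q). fst p = fst q}) euclideanreal
       (\<lambda>(p, q). g (fst p) (snd p) (snd q))" using g unfolding riemannian_metric_def by blast
    ultimately have "continuous_map E euclideanreal (\<lambda>p. g (fst p) (snd p) (snd p))"
      by (rule continuous_map_compose[unfolded o_def, THEN continuous_map_eq]) simp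
    then show ?thesis
      unfolding metric_norm_def case_prod_unfold by (rule continuous_map_sqrt)
  qed
  show "metric_norm g (x, u + v) \<le> metric_norm g (x, u) + metric_norm g (x, v)"
    if u: "u \<in> fiber E x" and v: "v \<in> fiber E x" for x u v
  proof -
    define p q where "p = sqrt (g x u u)" and "q = sqrt (g x v v)"
    have p: "p\<^sup>2 = g x u u" "q\<^sup>2 = g x v v" and p0: "0 \<le> p" "0 \<le> q"
      using nonneg u v by (auto simp: p_def q_def)
    have "g x u v \<le> p * q"
    proof (cases "p * q = 0")
      case True
      then have "g x u u = 0 \<or> g x v v = 0" using p by auto
      then have "u = 0 \<or> v = 0" using pos[OF u] pos[OF v] by (metis less_irrefl)
      moreover have "g x 0 v = 0" "g x 0 u = 0" using scale[OF cl(1), of _ x 0] u v by auto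
      ultimately show ?thesis using True sym u v cl(1) by (metis order_refl)
    next
      case False
      then have pq: "0 < p * q" using p0 by (auto simp: less_le)
      \<comment> \<open>Using the lengths \<open>q\<close> and \<open>p\<close> as coefficients,
        nonnegativity of the form becomes \<open>0 \<le> 2 * (p * q) * (p * q - g x u v)\<close>,
        and the positive factor cancels.\<close>
      have "0 \<le> g x (q *\<^sub>R u + (- p) *\<^sub>R v) (q *\<^sub>R u + (- p) *\<^sub>R v)"
        using u v by (intro nonneg cl)
      also have "\<dots> = q\<^sup>2 * g x u u - 2 * (q * p) * g x u v + p\<^sup>2 * g x v v"
        using quad[OF u v, of q "- p"] by simp
      also have "\<dots> = 2 * (p * q) * (p * q - g x u v)"
        by (simp only: p[symmetric]) (simp add: power2_eq_square algebra_simps)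
      finally show ?thesis using pq by (simp add: zero_le_mult_iff)
    qed
    moreover have "g x (u + v) (u + v) = g x u u + 2 * g x u v + g x v v" using quad[OF u v, of 1 1] by simp
    ultimately have "g x (u + v) (u + v) \<le> (p + q)\<^sup>2" using p by (simp add: power2_sum)
    then have "sqrt (g x (u + v) (u + v)) \<le> \<bar>p + q\<bar>" using real_sqrt_le_mono by fastforce
    then show ?thesis using p0 by (simp add: metric_norm_def p_def q_def)
  qed
  show "metric_norm g (x, a *\<^sub>R v) = \<bar>a\<bar> * metric_norm g (x, v)" if "v \<in> fiber E x" for x v a
    using quad[OF that that, of a 0] by (simp add: metric_norm_def real_sqrt_mult)
  show "0 < metric_norm g (x, v)" if "v \<in> fiber E x" "v \<noteq> 0" for x v
    using pos[OF that] by (simp add: metric_norm_def)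
qed

section \<open>Fibrewise linear maps and orbit sums of norms\<close>

text \<open>Base map and fibre maps are hidden behind existential quantifiers, so the notion is
  closed under iteration without formulas for the iterates. It is meant for powers of both
  \<open>total_map f A\<close> and \<open>total_inv E f A\<close>.\<close>

definition fiber_linear :: "('x \<times> 'v::real_vector) topology \<Rightarrow> ('x \<times> 'v \<Rightarrow> 'x \<times> 'v) \<Rightarrow> bool" where
  "fiber_linear E F \<longleftrightarrow> (\<forall>x. \<exists>y L. (\<forall>v\<in>fiber E x. F (x, v) = (y, L v) \<and> L v \<in> fiber E y) \<and>
     (\<forall>u\<in>fiber E x. \<forall>v\<in>fiber E x. \<forall>a b. L (a *\<^sub>R u + b *\<^sub>R v) = a *\<^sub>R L u + b *\<^sub>R L v))"

lemma fiber_linear_id: "fiber_linear E id"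
  by (auto simp: fiber_linear_def)

lemma fiber_linear_compose:
  assumes F: "fiber_linear E F" and G: "fiber_linear E G"
  shows "fiber_linear E (G \<circ> F)"
  unfolding fiber_linear_def
proof
  fix x
  obtain y L where L: "\<forall>v\<in>fiber E x. F (x, v) = (y, L v) \<and> L v \<in> fiber E y"
    "\<forall>u\<in>fiber E x. \<forall>v\<in>fiber E x. \<forall>a b. L (a *\<^sub>R u + b *\<^sub>R v) = a *\<^sub>R L u + b *\<^sub>R L v"
    using F unfolding fiber_linear_def by blast
  obtain z M where M: "\<forall>v\<in>fiber E y. G (y, v) = (z, M v) \<and> M v \<in> fiber E z"
    "\<forall>u\<in>fiber E y. \<forall>v\<in>fiber E y. \<forall>a b. M (a *\<^sub>R u + b *\<^sub>R v) = a *\<^sub>R M u + b *\<^sub>R M v"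
    using G unfolding fiber_linear_def by blast
  show "\<exists>y L. (\<forall>v\<in>fiber E x. (G \<circ> F) (x, v) = (y, L v) \<and> L v \<in> fiber E y) \<and>
     (\<forall>u\<in>fiber E x. \<forall>v\<in>fiber E x. \<forall>a b. L (a *\<^sub>R u + b *\<^sub>R v) = a *\<^sub>R L u + b *\<^sub>R L v)"
    using L M by (intro exI[of _ z] exI[of _ "M \<circ> L"]) auto
qed

lemma fiber_linear_funpow: "fiber_linear E F \<Longrightarrow> fiber_linear E (F ^^ n)"
  by (induction n) (auto simp: fiber_linear_compose fiber_linear_id)

lemma continuous_map_funpow: "continuous_map X X F \<Longrightarrow> continuous_map X X (F ^^ n)"
  by (induction n) (auto intro: continuous_map_compose)

context normed_bundle
begin

text \<open>A norm pulled back along a fibrewise linear map is a seminorm; every summand of the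
  adapted norm is of this kind.\<close>

lemma fiber_linear_seminorm:
  assumes F: "fiber_linear E F"
  shows "u \<in> fiber E x \<Longrightarrow> v \<in> fiber E x \<Longrightarrow> \<nu> (F (x, u + v)) \<le> \<nu> (F (x, u)) + \<nu> (F (x, v))"
    "v \<in> fiber E x \<Longrightarrow> \<nu> (F (x, a *\<^sub>R v)) = \<bar>a\<bar> * \<nu> (F (x, v))"
    "v \<in> fiber E x \<Longrightarrow> 0 \<le> \<nu> (F (x, v))"
proof -
  obtain y L where L: "\<forall>v\<in>fiber E x. F (x, v) = (y, L v) \<and> L v \<in> fiber E y"
    and lin': "\<forall>u\<in>fiber E x. \<forall>v\<in>fiber E x. \<forall>a b. L (a *\<^sub>R u + b *\<^sub>R v) = a *\<^sub>R L u + b *\<^sub>R L v"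
    using F unfolding fiber_linear_def by blast
  then have lin: "L (a *\<^sub>R u + b *\<^sub>R v) = a *\<^sub>R L u + b *\<^sub>R L v"
    if "u \<in> fiber E x" "v \<in> fiber E x" for u v a b using that by blast
  show "\<nu> (F (x, u + v)) \<le> \<nu> (F (x, u)) + \<nu> (F (x, v))" if "u \<in> fiber E x" "v \<in> fiber E x" for u v
    using L lin[OF that, of 1 1] norm_triangle that by simp
  show "\<nu> (F (x, a *\<^sub>R v)) = \<bar>a\<bar> * \<nu> (F (x, v))" if "v \<in> fiber E x" for v a
    using L lin[OF that that, of a 0] norm_scale that by simp
  show "0 \<le> \<nu> (F (x, v))" if "v \<in> fiber E x" for v
    using L norm_nonneg that by simp
qed

lemma normed_bundleI_fiberwise:
  assumes "continuous_map E euclideanreal \<mu>"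
    "\<And>x u v. u \<in> fiber E x \<Longrightarrow> v \<in> fiber E x \<Longrightarrow> \<mu> (x, u + v) \<le> \<mu> (x, u) + \<mu> (x, v)"
    "\<And>x v a. v \<in> fiber E x \<Longrightarrow> \<mu> (x, a *\<^sub>R v) = \<bar>a\<bar> * \<mu> (x, v)"
    "\<And>x v. v \<in> fiber E x \<Longrightarrow> v \<noteq> 0 \<Longrightarrow> 0 < \<mu> (x, v)"
  shows "normed_bundle E \<mu>"
  using assms is_bundle by unfold_locales auto

end

locale adapted_splitting = bundle_splitting E \<nu> S T
  for E :: "('x::topological_space \<times> 'v::real_vector) topology" and \<nu> S T +
  fixes f :: "'x \<Rightarrow> 'x" and A :: "'x \<Rightarrow> 'v \<Rightarrow> 'v" and N :: nat
  assumes f: "homeomorphic_map euclidean euclidean f" and A: "bundle_automorphism E f A"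
    and N: "1 \<le> N"
begin

abbreviation "\<mu> \<equiv> adapted_norm E f A \<nu> S T N"

lemma inj_f: "inj f" and surj_f: "surj f"
  using homeomorphic_imp_injective_map[OF f] homeomorphic_imp_surjective_map[OF f] by auto

lemma continuous_inv_f: "continuous_on UNIV (inv f)"
proof -
  obtain k where k: "homeomorphic_maps euclidean euclidean f k"
    using f homeomorphic_map_maps by blast
  then have c: "continuous_on UNIV k" and fk: "\<And>x. f (k x) = x"
    by (auto simp: homeomorphic_maps_def)
  have "k = inv f" using fk inj_f by (metis inv_f_f ext)
  then show ?thesis using c by simp
qed

text \<open>By injectivity, the continuous inverse supplied by the homeomorphism coincides with
  \<open>inv_into\<close> on the total space, so \<open>total_inv\<close> inherits its
  continuity.\<close>

lemma A_homeomorphic: "homeomorphic_maps E E (total_map f A) (total_inv E f A)"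
proof -
  have h: "homeomorphic_map E E (total_map f A)" using A by (simp add: bundle_automorphism_def)
  then obtain k where k: "homeomorphic_maps E E (total_map f A) k" using homeomorphic_map_maps by blast
  have inj: "inj_on (total_map f A) (topspace E)" using homeomorphic_imp_injective_map[OF h] .
  have "k p = total_inv E f A p" if "p \<in> topspace E" for p
  proof -
    have "k p \<in> topspace E" "total_map f A (k p) = p"
      using k that continuous_map_image_subset_topspace by (fastforce simp: homeomorphic_maps_def)+
    then show ?thesis unfolding total_inv_def using inv_into_f_f[OF inj, of "k p"] by simp
  qed
  then show ?thesis using homeomorphic_maps_eq[OF k] by auto
qed

lemma A_mem: "v \<in> fiber E x \<Longrightarrow> A x v \<in> fiber E (f x)"
  using A_homeomorphic continuous_map_image_subset_topspace
  by (fastforce simp: homeomorphic_maps_def total_map_def mem_fiber_iff)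

lemma A_linear:
  "u \<in> fiber E x \<Longrightarrow> v \<in> fiber E x \<Longrightarrow> A x (a *\<^sub>R u + b *\<^sub>R v) = a *\<^sub>R A x u + b *\<^sub>R A x v"
  using A by (simp add: bundle_automorphism_def)

definition "Ai y w = snd (total_inv E f A (y, w))"

text \<open>Because \<open>total_map f A\<close> covers the injective map \<open>f\<close>, its
  inverse covers \<open>inv f\<close>; this puts \<open>total_inv\<close> into the form of a bundle
  map with fibre part \<open>Ai\<close>.\<close>

lemma total_inv_eq:
  assumes "w \<in> fiber E y"
  shows "total_inv E f A (y, w) = (inv f y, Ai y w)" "Ai y w \<in> fiber E (inv f y)" "A (inv f y) (Ai y w) = w"
proof -
  have p: "(y, w) \<in> topspace E" using assms by (simp add: mem_fiber_iff)
  obtain x v where xv: "total_inv E f A (y, w) = (x, v)" by fastforce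
  have "total_map f A (total_inv E f A (y, w)) = (y, w)" "total_inv E f A (y, w) \<in> topspace E"
    using A_homeomorphic p continuous_map_image_subset_topspace by (fastforce simp: homeomorphic_maps_def)+
  then have "f x = y" "A x v = w" "v \<in> fiber E x" by (auto simp: xv total_map_def mem_fiber_iff)
  moreover from this have "x = inv f y" using inj_f by (metis inv_f_f)
  ultimately show "total_inv E f A (y, w) = (inv f y, Ai y w)" "Ai y w \<in> fiber E (inv f y)" "A (inv f y) (Ai y w) = w"
    by (auto simp: Ai_def xv)
qed

lemma Ai_A: "v \<in> fiber E x \<Longrightarrow> Ai (f x) (A x v) = v"
  using A_homeomorphic by (force simp: Ai_def homeomorphic_maps_def total_map_def mem_fiber_iff)

lemma Ai_linear:
  assumes "u \<in> fiber E y" "v \<in> fiber E y"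
  shows "Ai y (a *\<^sub>R u + b *\<^sub>R v) = a *\<^sub>R Ai y u + b *\<^sub>R Ai y v"
proof -
  have y: "f (inv f y) = y" using surj_f by (rule surj_f_inv_f)
  note u = total_inv_eq[OF assms(1)] and v = total_inv_eq[OF assms(2)]
  have "A (inv f y) (a *\<^sub>R Ai y u + b *\<^sub>R Ai y v) = a *\<^sub>R u + b *\<^sub>R v"
    using u v A_linear by simp
  then show ?thesis
    using Ai_A[of "a *\<^sub>R Ai y u + b *\<^sub>R Ai y v" "inv f y"] u v y by simp
qed

lemma continuous_total_A: "continuous_map E E (total_map f A)"
  and continuous_total_inv: "continuous_map E E (total_inv E f A)"
  using A_homeomorphic by (auto simp: homeomorphic_maps_def)

lemma continuous_total_Ai: "continuous_map E E (total_map (inv f) Ai)"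
  by (rule continuous_map_eq[OF continuous_total_inv])
    (auto simp: total_map_def total_inv_eq simp flip: mem_fiber_iff)

lemma fiber_linear_A: "fiber_linear E (total_map f A)"
  unfolding fiber_linear_def
proof
  fix x show "\<exists>y L. (\<forall>v\<in>fiber E x. total_map f A (x, v) = (y, L v) \<and> L v \<in> fiber E y) \<and>
     (\<forall>u\<in>fiber E x. \<forall>v\<in>fiber E x. \<forall>a b. L (a *\<^sub>R u + b *\<^sub>R v) = a *\<^sub>R L u + b *\<^sub>R L v)"
    by (intro exI[of _ "f x"] exI[of _ "A x"]) (auto simp: total_map_def A_mem A_linear)
qed

lemma fiber_linear_total_inv: "fiber_linear E (total_inv E f A)"
  unfolding fiber_linear_def
proof
  fix x show "\<exists>y L. (\<forall>v\<in>fiber E x. total_inv E f A (x, v) = (y, L v) \<and> L v \<in> fiber E y) \<and>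
     (\<forall>u\<in>fiber E x. \<forall>v\<in>fiber E x. \<forall>a b. L (a *\<^sub>R u + b *\<^sub>R v) = a *\<^sub>R L u + b *\<^sub>R L v)"
    by (intro exI[of _ "inv f x"] exI[of _ "Ai x"]) (auto simp: total_inv_eq Ai_linear)
qed

text \<open>The two sums in the adapted norm, taken on whole fibres instead of on the stable and
  unstable parts. There each is a continuous norm by itself, so only the projections remain to be
  composed with.\<close>

definition "forward_norm p = (\<Sum>n<N. \<nu> ((total_map f A ^^ n) p))"
definition "backward_norm p = (\<Sum>n<N. \<nu> ((total_inv E f A ^^ n) p))"

lemma orbit_norm:
  assumes F: "continuous_map E E F" "fiber_linear E F"
  shows "normed_bundle E (\<lambda>p. \<Sum>n<N. \<nu> ((F ^^ n) p))"
proof (rule normed_bundleI_fiberwise)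
  note semi = fiber_linear_seminorm[OF fiber_linear_funpow[OF F(2)]]
  show "continuous_map E euclideanreal (\<lambda>p. \<Sum>n<N. \<nu> ((F ^^ n) p))"
  proof (intro continuous_map_sum finite_lessThan)
    show "continuous_map E euclideanreal (\<lambda>p. \<nu> ((F ^^ n) p))" for n
      using continuous_map_compose[OF continuous_map_funpow[OF F(1)] norm_continuous, of n] by (simp add: o_def)
  qed
  fix x u v assume u: "u \<in> fiber E x" and v: "v \<in> fiber E x"
  show "(\<Sum>n<N. \<nu> ((F ^^ n) (x, u + v))) \<le> (\<Sum>n<N. \<nu> ((F ^^ n) (x, u))) + (\<Sum>n<N. \<nu> ((F ^^ n) (x, v)))"
    unfolding sum.distrib[symmetric] by (intro sum_mono semi u v)
next
  note semi = fiber_linear_seminorm[OF fiber_linear_funpow[OF F(2)]]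
  fix x v a assume v: "v \<in> fiber E x"
  show "(\<Sum>n<N. \<nu> ((F ^^ n) (x, a *\<^sub>R v))) = \<bar>a\<bar> * (\<Sum>n<N. \<nu> ((F ^^ n) (x, v)))"
    by (simp add: semi v sum_distrib_left)
  assume "v \<noteq> 0"
  \<comment> \<open>The summand \<open>n = 0\<close> is the original norm; it occurs because
    \<open>1 \<le> N\<close>, and it makes the sum positive definite.\<close>
  then have "0 < \<nu> ((F ^^ 0) (x, v))" using norm_pos v by simp
  also have "\<dots> \<le> (\<Sum>n<N. \<nu> ((F ^^ n) (x, v)))"
    using N by (intro member_le_sum semi(3) v) auto
  finally show "0 < (\<Sum>n<N. \<nu> ((F ^^ n) (x, v)))" .
qed

sublocale fwd: normed_bundle E forward_norm
  unfolding forward_norm_def[abs_def] by (rule orbit_norm[OF continuous_total_A fiber_linear_A])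

sublocale bwd: normed_bundle E backward_norm
  unfolding backward_norm_def[abs_def] by (rule orbit_norm[OF continuous_total_inv fiber_linear_total_inv])

lemma adapted_norm_eq:
  "\<mu> (x, v) = max (forward_norm (x, component S T x v)) (backward_norm (x, component T S x v))"
  by (simp add: adapted_norm_def forward_norm_def backward_norm_def)

lemma T_component_mem: "v \<in> fiber E x \<Longrightarrow> component T S x v \<in> T x"
  using bundle_splitting.component_mem(1)[OF splitting_swap] .

lemma component_fiber: "v \<in> fiber E x \<Longrightarrow> component S T x v \<in> fiber E x"
  "v \<in> fiber E x \<Longrightarrow> component T S x v \<in> fiber E x"
  using component_mem(1) S_le T_component_mem T_le by auto

text \<open>Continuity rests on that of both projections, the norm axioms on their linearity, and
  definiteness on the fact that a nonzero vector has a nonzero component.\<close>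

lemma adapted_normed_bundle: "normed_bundle E \<mu>"
proof (rule normed_bundleI_fiberwise)
  note cont = component_continuous bundle_splitting.component_continuous[OF splitting_swap]
  note lin = component_linear bundle_splitting.component_linear[OF splitting_swap]
  have "continuous_map E euclideanreal (\<lambda>p. max (forward_norm (fst p, component S T (fst p) (snd p)))
      (backward_norm (fst p, component T S (fst p) (snd p))))"
    using continuous_map_compose[OF cont(1) fwd.norm_continuous] continuous_map_compose[OF cont(2) bwd.norm_continuous]
    by (intro continuous_map_real_max) (simp_all add: o_def)
  then show "continuous_map E euclideanreal \<mu>"
    by (rule continuous_map_eq) (auto simp: adapted_norm_eq)
  fix x u v assume uv: "u \<in> fiber E x" "v \<in> fiber E x"
  have "forward_norm (x, component S T x (u + v)) \<le> forward_norm (x, component S T x u) + forward_norm (x, component S T x v)"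
    using lin(1)[OF uv, of 1 1] fwd.norm_triangle[OF component_fiber(1) component_fiber(1), OF uv] by simp
  moreover have "backward_norm (x, component T S x (u + v)) \<le> backward_norm (x, component T S x u) + backward_norm (x, component T S x v)"
    using lin(2)[OF uv, of 1 1] bwd.norm_triangle[OF component_fiber(2) component_fiber(2), OF uv] by simp
  ultimately show "\<mu> (x, u + v) \<le> \<mu> (x, u) + \<mu> (x, v)" unfolding adapted_norm_eq by linarith
next
  note lin = component_linear bundle_splitting.component_linear[OF splitting_swap]
  fix x v a assume v: "v \<in> fiber E x"
  show "\<mu> (x, a *\<^sub>R v) = \<bar>a\<bar> * \<mu> (x, v)"
    using lin(1)[OF v v, of a 0] lin(2)[OF v v, of a 0]
    by (simp add: adapted_norm_eq fwd.norm_scale bwd.norm_scale component_fiber v max_mult_distrib_left)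
  assume "v \<noteq> 0"
  then have "component S T x v \<noteq> 0 \<or> component T S x v \<noteq> 0"
    using component_sum[OF v] by auto
  then show "0 < \<mu> (x, v)"
    using fwd.norm_pos bwd.norm_pos component_fiber[OF v] by (auto simp: adapted_norm_eq less_max_iff_disj)
qed

text \<open>For a vector in \<open>S\<close> or in \<open>T\<close> one of the two terms of the
  maximum vanishes. The resulting box structure allows stable and unstable parts to be estimated
  separately.\<close>

lemma adapted_norm_max:
  assumes "v \<in> fiber E x"
  shows "\<mu> (x, v) = max (\<mu> (x, component S T x v)) (\<mu> (x, component T S x v))"
proof -
  note s = component_mem(1)[OF assms] and t = T_component_mem[OF assms]
  have "0 \<le> forward_norm (x, component S T x v)" "0 \<le> backward_norm (x, component T S x v)"
    using fwd.norm_nonneg bwd.norm_nonneg component_fiber[OF assms] by auto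
  then show ?thesis
    using component_of_S[OF s] bundle_splitting.component_of_S[OF splitting_swap t]
    by (simp add: adapted_norm_eq max_absorb1 max_absorb2)
qed

end

subsection \<open>Bounded solutions of the conjugacy equation\<close>

text \<open>Here the splitting appears only as a pair of complementary projections \<open>P\<close>
  and \<open>Q\<close>, with \<open>A_P\<close> expressing its invariance. The inverses
  \<open>fi\<close> and \<open>Ai\<close> are explicit data, so no choice operator enters the
  estimates.\<close>

locale hyperbolic_cocycle = normed_bundle E \<nu>
  for E :: "('x::topological_space \<times> 'v::real_vector) topology" and \<nu> +
  fixes f fi :: "'x \<Rightarrow> 'x" and A Ai P Q :: "'x \<Rightarrow> 'v \<Rightarrow> 'v" and \<tau> \<delta> :: real
  assumes f_fi [simp]: "f (fi x) = x" and fi_f [simp]: "fi (f x) = x"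
    and A_mem: "v \<in> fiber E x \<Longrightarrow> A x v \<in> fiber E (f x)"
    and Ai_mem: "v \<in> fiber E x \<Longrightarrow> Ai x v \<in> fiber E (fi x)"
    and A_Ai: "v \<in> fiber E x \<Longrightarrow> A (fi x) (Ai x v) = v"
    and Ai_A: "v \<in> fiber E x \<Longrightarrow> Ai (f x) (A x v) = v"
    and A_linear: "u \<in> fiber E x \<Longrightarrow> v \<in> fiber E x \<Longrightarrow> A x (a *\<^sub>R u + b *\<^sub>R v) = a *\<^sub>R A x u + b *\<^sub>R A x v"
    and Ai_linear: "u \<in> fiber E x \<Longrightarrow> v \<in> fiber E x \<Longrightarrow> Ai x (a *\<^sub>R u + b *\<^sub>R v) = a *\<^sub>R Ai x u + b *\<^sub>R Ai x v"
    and P_mem: "v \<in> fiber E x \<Longrightarrow> P x v \<in> fiber E x"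
    and Q_mem: "v \<in> fiber E x \<Longrightarrow> Q x v \<in> fiber E x"
    and P_linear: "u \<in> fiber E x \<Longrightarrow> v \<in> fiber E x \<Longrightarrow> P x (a *\<^sub>R u + b *\<^sub>R v) = a *\<^sub>R P x u + b *\<^sub>R P x v"
    and P_Q: "v \<in> fiber E x \<Longrightarrow> P x v + Q x v = v"
    and P_P: "v \<in> fiber E x \<Longrightarrow> P x (P x v) = P x v"
    and A_P: "v \<in> fiber E x \<Longrightarrow> P (f x) (A x v) = A x (P x v)"
    and norm_max: "v \<in> fiber E x \<Longrightarrow> \<nu> (x, v) = max (\<nu> (x, P x v)) (\<nu> (x, Q x v))"
    and A_contracts: "v \<in> fiber E x \<Longrightarrow> \<nu> (f x, A x (P x v)) \<le> \<tau> * \<nu> (x, P x v)"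
    and Ai_contracts: "v \<in> fiber E x \<Longrightarrow> \<nu> (fi x, Ai x (Q x v)) \<le> \<tau> * \<nu> (x, Q x v)"
    and A_continuous: "continuous_map E E (total_map f A)"
    and Ai_continuous: "continuous_map E E (total_map fi Ai)"
    and P_continuous: "continuous_map E E (total_map id P)"
    and Q_continuous: "continuous_map E E (total_map id Q)"
    and \<tau>: "0 < \<tau>" "\<tau> < 1" and \<delta>: "0 \<le> \<delta>" "\<tau> + \<delta> < 1"
begin

declare A_mem [simp] Ai_mem [simp] P_mem [simp] Q_mem [simp]

lemma Ai_mem' [simp]: "v \<in> fiber E (f x) \<Longrightarrow> Ai (f x) v \<in> fiber E x"
  using Ai_mem[of v "f x"] by simp

lemma A_mem' [simp]: "v \<in> fiber E (fi x) \<Longrightarrow> A (fi x) v \<in> fiber E x"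
  using A_mem[of v "fi x"] by simp

lemma Q_eq: "v \<in> fiber E x \<Longrightarrow> Q x v = v - P x v"
  using P_Q[of v x] by (simp add: eq_diff_eq add.commute)

lemma Q_linear: "u \<in> fiber E x \<Longrightarrow> v \<in> fiber E x \<Longrightarrow> Q x (a *\<^sub>R u + b *\<^sub>R v) = a *\<^sub>R Q x u + b *\<^sub>R Q x v"
  by (simp add: Q_eq P_linear algebra_simps)

lemma linear_rules:
  assumes "u \<in> fiber E x" "v \<in> fiber E x"
  shows "A x (u + v) = A x u + A x v" "A x (u - v) = A x u - A x v"
    "Ai x (u + v) = Ai x u + Ai x v" "Ai x (u - v) = Ai x u - Ai x v"
    "P x (u + v) = P x u + P x v" "P x (u - v) = P x u - P x v"
    "Q x (u + v) = Q x u + Q x v" "Q x (u - v) = Q x u - Q x v"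
  using A_linear[OF assms, of 1 1] A_linear[OF assms, of 1 "-1"]
    Ai_linear[OF assms, of 1 1] Ai_linear[OF assms, of 1 "-1"]
    P_linear[OF assms, of 1 1] P_linear[OF assms, of 1 "-1"]
    Q_linear[OF assms, of 1 1] Q_linear[OF assms, of 1 "-1"] by auto

lemma Q_P: "v \<in> fiber E x \<Longrightarrow> Q x (P x v) = 0"
  by (simp add: Q_eq P_P)

lemma P_Q_zero: "v \<in> fiber E x \<Longrightarrow> P x (Q x v) = 0"
  by (simp add: Q_eq P_P linear_rules)

lemma Q_Q: "v \<in> fiber E x \<Longrightarrow> Q x (Q x v) = Q x v"
  by (simp add: Q_eq[of "Q x v"] P_Q_zero)

lemma A_Q: "v \<in> fiber E x \<Longrightarrow> Q (f x) (A x v) = A x (Q x v)"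
  by (simp add: Q_eq A_P linear_rules)

lemma Ai_Q: "v \<in> fiber E (f x) \<Longrightarrow> Q x (Ai (f x) v) = Ai (f x) (Q (f x) v)"
  using A_Q[of "Ai (f x) v" x] A_Ai[of v "f x"] Ai_A[of "Q x (Ai (f x) v)" x] by simp

lemma P_norm: "v \<in> fiber E x \<Longrightarrow> \<nu> (x, P x v) \<le> \<nu> (x, v)"
  and Q_norm: "v \<in> fiber E x \<Longrightarrow> \<nu> (x, Q x v) \<le> \<nu> (x, v)"
  using norm_max[of v x] by auto

text \<open>The fixed points of \<open>graph_op\<close>, which is built from this map, are the solutions of
  \<open>h (\<Gamma> v) = A (h v) + \<psi> v (h v)\<close>: its stable part is solved for \<open>h (\<Gamma> v)\<close> and its unstable
  part for \<open>h v\<close>, so that both involve only the contracting directions of \<open>A\<close>.\<close>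

definition step :: "'x \<Rightarrow> 'v \<Rightarrow> 'v \<Rightarrow> 'v \<Rightarrow> 'v \<Rightarrow> 'v" where
  "step x a b c d = P x (A (fi x) a + b) + Ai (f x) (Q (f x) (c - d))"

context
  fixes x a b c d
  assumes mem: "a \<in> fiber E (fi x)" "b \<in> fiber E x" "c \<in> fiber E (f x)" "d \<in> fiber E (f x)"
begin

lemma step_mem: "step x a b c d \<in> fiber E x"
  using mem by (simp add: step_def)

text \<open>\<open>Ai\<close> preserves the range of \<open>Q\<close>, so the unstable summand of
  \<open>step\<close> is killed by \<open>P\<close>.\<close>

lemma P_step: "P x (step x a b c d) = P x (A (fi x) a + b)"
proof -
  have "P x (Ai (f x) (Q (f x) (c - d))) = P x (Q x (Ai (f x) (c - d)))"
    using mem Ai_Q[of "c - d" x] by simp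
  also have "\<dots> = 0" using mem by (simp add: P_Q_zero)
  finally show ?thesis using mem by (simp add: step_def linear_rules(5) P_P)
qed

lemma Q_step: "Q x (step x a b c d) = Ai (f x) (Q (f x) (c - d))"
  using mem by (simp add: step_def linear_rules(7) Q_P Ai_Q Q_Q)

text \<open>The max form of the norm separates the two summands. The bound is asymmetric since
  \<open>b\<close> is added after \<open>A\<close> has contracted, whereas \<open>d\<close> is
  subtracted before \<open>Ai\<close> contracts and so carries the factor
  \<open>\<tau>\<close>.\<close>

lemma step_norm:
  "\<nu> (x, step x a b c d) \<le> max (\<tau> * \<nu> (fi x, a) + \<nu> (x, b)) (\<tau> * (\<nu> (f x, c) + \<nu> (f x, d)))"
proof -
  have "P x (A (fi x) a + b) = A (fi x) (P (fi x) a) + P x b"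
    using mem A_P[of a "fi x"] by (simp add: linear_rules(5))
  then have "\<nu> (x, P x (step x a b c d)) \<le> \<nu> (x, A (fi x) (P (fi x) a)) + \<nu> (x, P x b)"
    using mem norm_triangle[of "A (fi x) (P (fi x) a)" x "P x b"] by (simp add: P_step)
  also have "\<nu> (x, A (fi x) (P (fi x) a)) \<le> \<tau> * \<nu> (fi x, P (fi x) a)"
    using A_contracts[OF mem(1)] by simp
  also have "\<dots> \<le> \<tau> * \<nu> (fi x, a)" using P_norm[OF mem(1)] \<tau> by simp
  also have "\<nu> (x, P x b) \<le> \<nu> (x, b)" using P_norm[OF mem(2)] .
  finally have 1: "\<nu> (x, P x (step x a b c d)) \<le> \<tau> * \<nu> (fi x, a) + \<nu> (x, b)" by simp
  have "\<nu> (x, Q x (step x a b c d)) \<le> \<tau> * \<nu> (f x, Q (f x) (c - d))"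
    using Ai_contracts[of "c - d" "f x"] mem by (simp add: Q_step)
  also have "\<dots> \<le> \<tau> * \<nu> (f x, c - d)" using Q_norm[of "c - d" "f x"] mem \<tau> by simp
  also have "\<dots> \<le> \<tau> * (\<nu> (f x, c) + \<nu> (f x, d))" using norm_diff_le[OF mem(3,4)] \<tau> by simp
  finally show ?thesis using 1 norm_max[OF step_mem] by (auto simp: le_max_iff_disj)
qed

lemma step_diff:
  assumes mem': "a' \<in> fiber E (fi x)" "b' \<in> fiber E x" "c' \<in> fiber E (f x)" "d' \<in> fiber E (f x)"
  shows "step x a b c d - step x a' b' c' d' = step x (a - a') (b - b') (c - c') (d - d')"
  using mem mem' by (simp add: step_def linear_rules)

end

end

section \<open>The graph operator and uniqueness of solutions\<close>

text \<open>\<open>\<psi>\<close> may depend on the unknown value \<open>k\<close>, as in the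
  equation of the inverse conjugacy. This locale holds just what contraction needs, because
  uniqueness is later applied to the equations of the two compositions.\<close>

locale conjugacy_equation = hyperbolic_cocycle E \<nu> f fi A Ai P Q \<tau> \<delta>
  for E :: "('x::topological_space \<times> 'v::real_vector) topology" and \<nu> f fi A Ai P Q \<tau> \<delta> +
  fixes \<Gamma> \<Gamma>i :: "'x \<Rightarrow> 'v \<Rightarrow> 'v" and \<psi> :: "'x \<Rightarrow> 'v \<Rightarrow> 'v \<Rightarrow> 'v"
  assumes \<Gamma>_mem: "v \<in> fiber E x \<Longrightarrow> \<Gamma> x v \<in> fiber E (f x)"
    and \<Gamma>i_mem: "v \<in> fiber E x \<Longrightarrow> \<Gamma>i x v \<in> fiber E (fi x)"
    and \<Gamma>_\<Gamma>i: "v \<in> fiber E x \<Longrightarrow> \<Gamma> (fi x) (\<Gamma>i x v) = v"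
    and \<Gamma>i_\<Gamma>: "v \<in> fiber E x \<Longrightarrow> \<Gamma>i (f x) (\<Gamma> x v) = v"
    and \<psi>_mem: "v \<in> fiber E x \<Longrightarrow> k \<in> fiber E x \<Longrightarrow> \<psi> x v k \<in> fiber E (f x)"
    and \<psi>_lipschitz: "v \<in> fiber E x \<Longrightarrow> k \<in> fiber E x \<Longrightarrow> k' \<in> fiber E x \<Longrightarrow>
        \<nu> (f x, \<psi> x v k - \<psi> x v k') \<le> \<delta> * \<nu> (x, k - k')"
begin

declare \<Gamma>_mem [simp] \<Gamma>i_mem [simp] \<psi>_mem [simp]

lemma \<psi>_mem' [simp]: "v \<in> fiber E (fi x) \<Longrightarrow> k \<in> fiber E (fi x) \<Longrightarrow> \<psi> (fi x) v k \<in> fiber E x"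
  using \<psi>_mem[of v "fi x" k] by simp

definition graph_op :: "('x \<Rightarrow> 'v \<Rightarrow> 'v) \<Rightarrow> 'x \<Rightarrow> 'v \<Rightarrow> 'v" where
  "graph_op h x w = step x (h (fi x) (\<Gamma>i x w)) (\<psi> (fi x) (\<Gamma>i x w) (h (fi x) (\<Gamma>i x w)))
     (h (f x) (\<Gamma> x w)) (\<psi> x w (h x w))"

definition fiber_map :: "('x \<Rightarrow> 'v \<Rightarrow> 'v) \<Rightarrow> bool" where
  "fiber_map h \<longleftrightarrow> (\<forall>x. \<forall>v\<in>fiber E x. h x v \<in> fiber E x)"

definition solution :: "('x \<Rightarrow> 'v \<Rightarrow> 'v) \<Rightarrow> bool" where
  "solution h \<longleftrightarrow> (\<forall>x. \<forall>v\<in>fiber E x. h (f x) (\<Gamma> x v) = A x (h x v) + \<psi> x v (h x v))"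

lemma fiber_mapD [simp]: "fiber_map h \<Longrightarrow> v \<in> fiber E x \<Longrightarrow> h x v \<in> fiber E x"
  by (simp add: fiber_map_def)

lemma fiber_map_graph_op: "fiber_map h \<Longrightarrow> fiber_map (graph_op h)"
  by (simp add: fiber_map_def[of "graph_op h"] graph_op_def step_mem)

text \<open>The equation at \<open>v\<close> is recovered from two fixed point identities at
  different places: its \<open>P\<close> part from the one at \<open>\<Gamma> x v\<close>, its
  \<open>Q\<close> part from the one at \<open>v\<close> after undoing \<open>Ai\<close>.\<close>

lemma graph_op_fixed_iff:
  assumes h: "fiber_map h"
  shows "solution h \<longleftrightarrow> (\<forall>x. \<forall>w\<in>fiber E x. graph_op h x w = h x w)"
proof
  assume sol: "solution h"
  show "\<forall>x. \<forall>w\<in>fiber E x. graph_op h x w = h x w"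
  proof (intro allI ballI)
    fix x w assume w: "w \<in> fiber E x"
    have "h x w = A (fi x) (h (fi x) (\<Gamma>i x w)) + \<psi> (fi x) (\<Gamma>i x w) (h (fi x) (\<Gamma>i x w))"
      using sol[unfolded solution_def, rule_format, of "\<Gamma>i x w" "fi x"] w by (simp add: \<Gamma>_\<Gamma>i)
    moreover have "h (f x) (\<Gamma> x w) - \<psi> x w (h x w) = A x (h x w)"
      using sol w by (simp add: solution_def)
    moreover have "Ai (f x) (Q (f x) (A x (h x w))) = Q x (h x w)"
      using h w by (simp add: A_Q Ai_A)
    ultimately show "graph_op h x w = h x w"
      using h w by (simp add: graph_op_def step_def P_Q)
  qed
next
  assume fixed: "\<forall>x. \<forall>w\<in>fiber E x. graph_op h x w = h x w"
  show "solution h" unfolding solution_def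
  proof (intro allI ballI)
    fix x v assume v: "v \<in> fiber E x"
    let ?r = "A x (h x v) + \<psi> x v (h x v)" and ?l = "h (f x) (\<Gamma> x v)"
    have m: "?r \<in> fiber E (f x)" "?l \<in> fiber E (f x)" using h v by auto
    have "P (f x) ?l = P (f x) (graph_op h (f x) (\<Gamma> x v))" using fixed v by simp
    also have "\<dots> = P (f x) ?r"
      using h v by (simp add: graph_op_def P_step \<Gamma>i_\<Gamma>)
    finally have p: "P (f x) ?l = P (f x) ?r" .
    have "Q x (h x v) = Q x (graph_op h x v)" using fixed v by simp
    also have "\<dots> = Ai (f x) (Q (f x) (?l - \<psi> x v (h x v)))"
      using h v by (simp add: graph_op_def Q_step)
    finally have "A x (Q x (h x v)) = Q (f x) (?l - \<psi> x v (h x v))"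
      using A_Ai[of "Q (f x) (?l - \<psi> x v (h x v))" "f x"] h v by simp
    then have "Q (f x) ?l = Q (f x) ?r"
      using h v A_Q[of "h x v" x] by (simp add: linear_rules)
    with p show "?l = ?r" using P_Q[OF m(1)] P_Q[OF m(2)] by metis
  qed
qed

text \<open>By linearity of \<open>step\<close> the difference is again a \<open>step\<close>. Its
  stable part is at most \<open>\<tau> * D + \<delta> * D\<close>, and its unstable part
  \<open>\<tau> * (D + \<delta> * D)\<close> is no larger because \<open>\<tau> < 1\<close>.\<close>

lemma graph_op_contracts:
  assumes h: "fiber_map h" and h': "fiber_map h'"
    and D: "\<And>x v. v \<in> fiber E x \<Longrightarrow> \<nu> (x, h x v - h' x v) \<le> D" and w: "w \<in> fiber E x"
  shows "\<nu> (x, graph_op h x w - graph_op h' x w) \<le> (\<tau> + \<delta>) * D"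
proof -
  let ?v = "\<Gamma>i x w"
  have v: "?v \<in> fiber E (fi x)" using w by simp
  have D0: "0 \<le> D" using D[OF w] norm_nonneg[of "h x w - h' x w" x] h h' w by (simp add: order_trans)
  have b: "\<nu> (x, \<psi> (fi x) ?v (h (fi x) ?v) - \<psi> (fi x) ?v (h' (fi x) ?v)) \<le> \<delta> * D"
    using \<psi>_lipschitz[OF v, of "h (fi x) ?v" "h' (fi x) ?v"] mult_left_mono[OF D[OF v] \<delta>(1)] h h' v by simp
  have d: "\<nu> (f x, \<psi> x w (h x w) - \<psi> x w (h' x w)) \<le> \<delta> * D"
    using \<psi>_lipschitz[OF w, of "h x w" "h' x w"] mult_left_mono[OF D[OF w] \<delta>(1)] h h' w by simp
  have "\<nu> (x, graph_op h x w - graph_op h' x w) \<le>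
      max (\<tau> * \<nu> (fi x, h (fi x) ?v - h' (fi x) ?v) + \<nu> (x, \<psi> (fi x) ?v (h (fi x) ?v) - \<psi> (fi x) ?v (h' (fi x) ?v)))
       (\<tau> * (\<nu> (f x, h (f x) (\<Gamma> x w) - h' (f x) (\<Gamma> x w)) + \<nu> (f x, \<psi> x w (h x w) - \<psi> x w (h' x w))))"
    unfolding graph_op_def using h h' w by (subst step_diff) (auto intro!: step_norm)
  also have "\<dots> \<le> max (\<tau> * D + \<delta> * D) (\<tau> * (D + \<delta> * D))"
    using b d D[OF v] D[of "\<Gamma> x w" "f x"] w \<tau> by (intro max.mono add_mono mult_left_mono) auto
  also have "\<tau> * (D + \<delta> * D) \<le> \<tau> * D + \<delta> * D"
    using mult_right_mono[of \<tau> 1 "\<delta> * D"] \<tau> \<delta> D0 by (simp add: algebra_simps)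
  finally show ?thesis by (simp add: algebra_simps)
qed

text \<open>Solutions are fixed points, so \<open>n\<close> contractions shrink the bound on their
  distance to \<open>(\<tau> + \<delta>) ^ n * D\<close>, which tends to \<open>0\<close>.\<close>

lemma solution_unique:
  assumes h: "fiber_map h" "solution h" and h': "fiber_map h'" "solution h'"
    and D: "\<And>x v. v \<in> fiber E x \<Longrightarrow> \<nu> (x, h x v - h' x v) \<le> D" and w: "w \<in> fiber E x"
  shows "h x w = h' x w"
proof -
  have le: "\<nu> (x, h x v - h' x v) \<le> (\<tau> + \<delta>) ^ n * D" if "v \<in> fiber E x" for n x v
    using that
  proof (induction n arbitrary: x v)
    case (Suc n)
    then show ?case
      using graph_op_contracts[OF h(1) h'(1), of "(\<tau> + \<delta>) ^ n * D" v x]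
        graph_op_fixed_iff[OF h(1)] graph_op_fixed_iff[OF h'(1)] h h' by (simp add: mult.assoc)
  qed (simp add: D)
  have "(\<lambda>n. (\<tau> + \<delta>) ^ n * D) \<longlonglongrightarrow> 0 * D"
    using \<tau> \<delta> by (intro tendsto_mult LIMSEQ_realpow_zero tendsto_const) auto
  then have "\<nu> (x, h x w - h' x w) \<le> 0" using le[OF w] LIMSEQ_le_const by fastforce
  then show ?thesis using norm_eq_zero[of "h x w - h' x w" x] h h' w by simp
qed

end

section \<open>Bounds preserved by the graph operator\<close>

text \<open>\<open>\<kappa>\<close> and \<open>\<Lambda>\<close> are Lipschitz constants of the
  inverse and of the map \<open>\<Gamma>\<close>. Continuity of \<open>\<psi>\<close> is stated
  along continuous families \<open>h\<close>, which avoids a topology on pairs of vectors in one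
  fibre.\<close>

locale bounded_conjugacy_equation = conjugacy_equation E \<nu> f fi A Ai P Q \<tau> \<delta> \<Gamma> \<Gamma>i \<psi>
  for E :: "('x::topological_space \<times> 'v::real_vector) topology" and \<nu> f fi A Ai P Q \<tau> \<delta> \<Gamma> \<Gamma>i \<psi> +
  fixes B \<kappa> \<Lambda> :: real
  assumes \<Gamma>_continuous: "continuous_map E E (total_map f \<Gamma>)"
    and \<Gamma>i_continuous: "continuous_map E E (total_map fi \<Gamma>i)"
    and \<psi>_continuous: "continuous_map E E (total_map id h) \<Longrightarrow>
        continuous_map E E (total_map f (\<lambda>x v. \<psi> x v (h x v)))"
    and B: "0 \<le> B" and \<psi>_bounded: "v \<in> fiber E x \<Longrightarrow> k \<in> fiber E x \<Longrightarrow> \<nu> (f x, \<psi> x v k) \<le> B"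
    and \<psi>_lipschitz2: "v \<in> fiber E x \<Longrightarrow> v' \<in> fiber E x \<Longrightarrow> k \<in> fiber E x \<Longrightarrow> k' \<in> fiber E x \<Longrightarrow>
        \<nu> (f x, \<psi> x v k - \<psi> x v' k') \<le> \<delta> * \<nu> (x, v - v') + \<delta> * \<nu> (x, k - k')"
    and \<Gamma>_lipschitz: "v \<in> fiber E x \<Longrightarrow> v' \<in> fiber E x \<Longrightarrow>
        \<nu> (f x, \<Gamma> x v - \<Gamma> x v') \<le> \<Lambda> * \<nu> (x, v - v')"
    and \<Gamma>i_lipschitz: "v \<in> fiber E x \<Longrightarrow> v' \<in> fiber E x \<Longrightarrow>
        \<nu> (fi x, \<Gamma>i x v - \<Gamma>i x v') \<le> \<kappa> * \<nu> (x, v - v')"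
    and \<kappa>: "0 \<le> \<kappa>" and \<Lambda>: "0 \<le> \<Lambda>"
begin

text \<open>The fixed point of \<open>\<lambda>t. \<tau> * t + B\<close>, chosen so that the ball of
  radius \<open>M\<close> in the supremum norm is invariant under \<open>graph_op\<close>.\<close>

definition M :: real where "M = B / (1 - \<tau>)"

lemma M_nonneg: "0 \<le> M"
  using B \<tau> by (simp add: M_def)

lemma M_fixed: "\<tau> * M + B = M"
  using \<tau> by (simp add: M_def field_simps)

lemma graph_op_bounded:
  assumes h: "fiber_map h" and hM: "\<And>x v. v \<in> fiber E x \<Longrightarrow> \<nu> (x, h x v) \<le> M" and w: "w \<in> fiber E x"
  shows "\<nu> (x, graph_op h x w) \<le> M"
proof -
  let ?v = "\<Gamma>i x w"
  have v: "?v \<in> fiber E (fi x)" using w by simp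
  have "\<nu> (x, graph_op h x w) \<le>
      max (\<tau> * \<nu> (fi x, h (fi x) ?v) + \<nu> (x, \<psi> (fi x) ?v (h (fi x) ?v)))
       (\<tau> * (\<nu> (f x, h (f x) (\<Gamma> x w)) + \<nu> (f x, \<psi> x w (h x w))))"
    unfolding graph_op_def using h w by (intro step_norm) auto
  also have "\<dots> \<le> max (\<tau> * M + B) (\<tau> * (M + B))"
    using hM[OF v] hM[of "\<Gamma> x w" "f x"] \<psi>_bounded[OF v, of "h (fi x) ?v"] \<psi>_bounded[OF w, of "h x w"] w v h \<tau>
    by (intro max.mono add_mono mult_left_mono) auto
  also have "\<tau> * (M + B) \<le> \<tau> * M + B"
    using mult_right_mono[of \<tau> 1 B] \<tau> B by (simp add: algebra_simps)
  finally show ?thesis using M_fixed by simp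
qed

text \<open>The operator is a combination of compositions of continuous total maps; the detours
  through the fibres over \<open>fi x\<close> and \<open>f x\<close> return to \<open>x\<close>
  because \<open>f\<close> and \<open>fi\<close> are mutually inverse.\<close>

lemma graph_op_continuous:
  assumes h: "continuous_map E E (total_map id h)"
  shows "continuous_map E E (total_map id (graph_op h))"
proof -
  have tm: "total_map a F \<circ> total_map b G = total_map (a \<circ> b) (\<lambda>x v. F (b x) (G x v))"
    for a b :: "'x \<Rightarrow> 'x" and F G :: "'x \<Rightarrow> 'v \<Rightarrow> 'v"
    by (auto simp: total_map_def)
  have comp: "continuous_map E E (total_map (a \<circ> b) (\<lambda>x v. F (b x) (G x v)))"
    if "continuous_map E E (total_map b G)" "continuous_map E E (total_map a F)"
    for a b :: "'x \<Rightarrow> 'x" and F G :: "'x \<Rightarrow> 'v \<Rightarrow> 'v"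
    using continuous_map_compose[OF that] by (simp only: tm)
  have ff: "f \<circ> fi = id" "fi \<circ> f = id" by (auto simp: fun_eq_iff)
  note \<psi>h = \<psi>_continuous[OF h]
  have a: "continuous_map E E (total_map id (\<lambda>x w. A (fi x) (h (fi x) (\<Gamma>i x w))))"
    using comp[OF comp[OF \<Gamma>i_continuous h] A_continuous] by (simp add: ff)
  have b: "continuous_map E E (total_map id (\<lambda>x w. \<psi> (fi x) (\<Gamma>i x w) (h (fi x) (\<Gamma>i x w))))"
    using comp[OF \<Gamma>i_continuous \<psi>h] by (simp add: ff)
  have c: "continuous_map E E (total_map f (\<lambda>x w. h (f x) (\<Gamma> x w)))"
    using comp[OF \<Gamma>_continuous h] by simp
  have "continuous_map E E (total_map id (\<lambda>x w. P x (1 *\<^sub>R A (fi x) (h (fi x) (\<Gamma>i x w))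
      + 1 *\<^sub>R \<psi> (fi x) (\<Gamma>i x w) (h (fi x) (\<Gamma>i x w)))))"
    using comp[OF continuous_map_total_sum[OF a b, of 1 1] P_continuous] by simp
  moreover have "continuous_map E E (total_map id (\<lambda>x w. Ai (f x) (Q (f x)
      (1 *\<^sub>R h (f x) (\<Gamma> x w) + (-1) *\<^sub>R \<psi> x w (h x w)))))"
    using comp[OF comp[OF continuous_map_total_sum[OF c \<psi>h, of 1 "-1"] Q_continuous] Ai_continuous] by (simp add: ff)
  ultimately show ?thesis
    using continuous_map_total_sum[where s = 1 and t = 1] by (fastforce simp: graph_op_def[abs_def] step_def)
qed

text \<open>At distance at least \<open>1\<close> the supremum bound suffices, as
  \<open>2 * M \<le> K\<close>. At smaller distances \<open>K1\<close> and \<open>K2\<close> say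
  that the stable and the unstable part reproduce the constant \<open>K\<close>.\<close>

lemma graph_op_hoelder:
  assumes h: "fiber_map h" and hM: "\<And>x v. v \<in> fiber E x \<Longrightarrow> \<nu> (x, h x v) \<le> M"
    and \<alpha>: "0 < \<alpha>" "\<alpha> \<le> 1"
    and K0: "0 \<le> K" and KM: "2 * M \<le> K"
    and K1: "(\<tau> + \<delta>) * \<kappa> powr \<alpha> * K + \<delta> * \<kappa> \<le> K"
    and K2: "\<tau> * (\<Lambda> powr \<alpha> + \<delta>) * K + \<tau> * \<delta> \<le> K"
    and hK: "\<And>x u v. u \<in> fiber E x \<Longrightarrow> v \<in> fiber E x \<Longrightarrow> \<nu> (x, h x u - h x v) \<le> K * \<nu> (x, u - v) powr \<alpha>"
    and u: "u \<in> fiber E x" and w: "w \<in> fiber E x"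
  shows "\<nu> (x, graph_op h x u - graph_op h x w) \<le> K * \<nu> (x, u - w) powr \<alpha>"
proof -
  define d where "d = \<nu> (x, u - w)"
  have d0: "0 \<le> d" using u w by (simp add: d_def norm_nonneg)
  have hop: "fiber_map (graph_op h)" using h by (rule fiber_map_graph_op)
  consider "d = 0" | "1 \<le> d" | "0 < d" "d < 1" using d0 by linarith
  then show ?thesis
  proof cases
    case 1
    then have "u = w" using norm_eq_zero[of "u - w" x] u w by (simp add: d_def)
    then show ?thesis by simp
  next
    case 2
    have "\<nu> (x, graph_op h x u - graph_op h x w) \<le> \<nu> (x, graph_op h x u) + \<nu> (x, graph_op h x w)"
      using hop u w by (intro norm_diff_le) auto
    also have "\<dots> \<le> K * 1"
      using graph_op_bounded[OF h hM, where x = x and w = u] graph_op_bounded[OF h hM, where x = x and w = w] u w KM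
      by simp
    also have "\<dots> \<le> K * d powr \<alpha>" using 2 \<alpha> K0 by (intro mult_left_mono ge_one_powr_ge_zero) auto
    finally show ?thesis by (simp add: d_def)
  next
    case 3
    \<comment> \<open>Here \<open>\<alpha> \<le> 1\<close> enters: the error terms that are
      Lipschitz in the base vector are absorbed into the Hoelder bound.\<close>
    have dd: "d \<le> d powr \<alpha>" using powr_mono'[of \<alpha> 1 d] 3 \<alpha> by simp
    let ?u = "\<Gamma>i x u" and ?w = "\<Gamma>i x w"
    have uw: "?u \<in> fiber E (fi x)" "?w \<in> fiber E (fi x)" "\<Gamma> x u \<in> fiber E (f x)" "\<Gamma> x w \<in> fiber E (f x)"
      using u w by auto
    define e where "e = \<nu> (fi x, ?u - ?w)"
    have e: "0 \<le> e" "e \<le> \<kappa> * d" using uw \<Gamma>i_lipschitz[OF u w] by (auto simp: e_def d_def norm_nonneg)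
    then have e\<alpha>: "e powr \<alpha> \<le> \<kappa> powr \<alpha> * d powr \<alpha>"
      using \<alpha> d0 \<kappa> powr_mono2[of \<alpha> e "\<kappa> * d"] by (simp add: powr_mult)
    have a: "\<nu> (fi x, h (fi x) ?u - h (fi x) ?w) \<le> K * (\<kappa> powr \<alpha> * d powr \<alpha>)"
      using hK[OF uw(1,2)] mult_left_mono[OF e\<alpha> K0] by (simp add: e_def)
    have "\<nu> (x, \<psi> (fi x) ?u (h (fi x) ?u) - \<psi> (fi x) ?w (h (fi x) ?w))
        \<le> \<delta> * e + \<delta> * \<nu> (fi x, h (fi x) ?u - h (fi x) ?w)"
      using \<psi>_lipschitz2[OF uw(1,2), of "h (fi x) ?u" "h (fi x) ?w"] uw h by (simp add: e_def)
    also have "\<dots> \<le> \<delta> * (\<kappa> * d powr \<alpha>) + \<delta> * (K * (\<kappa> powr \<alpha> * d powr \<alpha>))"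
      using a e mult_left_mono[OF dd \<kappa>] \<delta> by (intro add_mono mult_left_mono) auto
    finally have b: "\<nu> (x, \<psi> (fi x) ?u (h (fi x) ?u) - \<psi> (fi x) ?w (h (fi x) ?w))
      \<le> \<delta> * (\<kappa> * d powr \<alpha>) + \<delta> * (K * (\<kappa> powr \<alpha> * d powr \<alpha>))" .
    have "\<nu> (f x, \<Gamma> x u - \<Gamma> x w) powr \<alpha> \<le> \<Lambda> powr \<alpha> * d powr \<alpha>"
      using \<Gamma>_lipschitz[OF u w] \<alpha> d0 \<Lambda> uw powr_mono2[of \<alpha> "\<nu> (f x, \<Gamma> x u - \<Gamma> x w)" "\<Lambda> * d"]
      by (simp add: d_def powr_mult norm_nonneg)
    then have c: "\<nu> (f x, h (f x) (\<Gamma> x u) - h (f x) (\<Gamma> x w)) \<le> K * (\<Lambda> powr \<alpha> * d powr \<alpha>)"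
      using hK[OF uw(3,4)] K0 by (smt (verit) mult_left_mono)
    have "\<nu> (f x, \<psi> x u (h x u) - \<psi> x w (h x w)) \<le> \<delta> * d + \<delta> * \<nu> (x, h x u - h x w)"
      using \<psi>_lipschitz2[OF u w, of "h x u" "h x w"] u w h by (simp add: d_def)
    also have "\<dots> \<le> \<delta> * d powr \<alpha> + \<delta> * (K * d powr \<alpha>)"
      using hK[OF u w] dd \<delta> by (intro add_mono mult_left_mono) (auto simp: d_def)
    finally have g: "\<nu> (f x, \<psi> x u (h x u) - \<psi> x w (h x w)) \<le> \<delta> * d powr \<alpha> + \<delta> * (K * d powr \<alpha>)" .
    have "\<nu> (x, graph_op h x u - graph_op h x w) \<le>
      max (\<tau> * \<nu> (fi x, h (fi x) ?u - h (fi x) ?w) + \<nu> (x, \<psi> (fi x) ?u (h (fi x) ?u) - \<psi> (fi x) ?w (h (fi x) ?w)))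
       (\<tau> * (\<nu> (f x, h (f x) (\<Gamma> x u) - h (f x) (\<Gamma> x w)) + \<nu> (f x, \<psi> x u (h x u) - \<psi> x w (h x w))))"
      unfolding graph_op_def using h u w by (subst step_diff) (auto intro!: step_norm)
    also have "\<dots> \<le> max (\<tau> * (K * (\<kappa> powr \<alpha> * d powr \<alpha>)) + (\<delta> * (\<kappa> * d powr \<alpha>) + \<delta> * (K * (\<kappa> powr \<alpha> * d powr \<alpha>))))
       (\<tau> * (K * (\<Lambda> powr \<alpha> * d powr \<alpha>) + (\<delta> * d powr \<alpha> + \<delta> * (K * d powr \<alpha>))))"
      using a b c g \<tau> by (intro max.mono add_mono mult_left_mono) auto
    \<comment> \<open>The coefficients of \<open>d powr \<alpha>\<close> are exactly the left sides
      of \<open>K1\<close> and \<open>K2\<close>.\<close>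
    also have "\<dots> = max (((\<tau> + \<delta>) * \<kappa> powr \<alpha> * K + \<delta> * \<kappa>) * d powr \<alpha>)
        ((\<tau> * (\<Lambda> powr \<alpha> + \<delta>) * K + \<tau> * \<delta>) * d powr \<alpha>)"
      by (simp add: algebra_simps)
    also have "\<dots> \<le> K * d powr \<alpha>" using K1 K2 by (intro max.boundedI mult_right_mono) auto
    finally show ?thesis by (simp add: d_def)
  qed
qed

section \<open>The iterates and their limit\<close>

text \<open>The zero family is continuous, bounded by \<open>M\<close> and Hoelder with every
  constant \<open>K \<ge> 0\<close>, so all invariant bounds are available from the start.\<close>

definition iter :: "nat \<Rightarrow> 'x \<Rightarrow> 'v \<Rightarrow> 'v" where
  "iter n = (graph_op ^^ n) (\<lambda>x v. 0)"

lemma iter_simps: "iter 0 x v = 0" "iter (Suc n) = graph_op (iter n)"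
  by (simp_all add: iter_def)

lemma fiber_map_iter [simp]: "fiber_map (iter n)"
  by (induction n) (auto simp: iter_simps fiber_map_graph_op, simp add: fiber_map_def iter_simps)

lemma iter_bounded: "v \<in> fiber E x \<Longrightarrow> \<nu> (x, iter n x v) \<le> M"
  by (induction n arbitrary: x v) (simp_all add: iter_simps M_nonneg graph_op_bounded)

lemma iter_continuous: "continuous_map E E (total_map id (iter n))"
proof (induction n)
  case 0
  \<comment> \<open>The zero section is written as a linear combination, so that its continuity
    follows from that of the fibre operations.\<close>
  have "continuous_map E E (\<lambda>p. (fst p, 0 *\<^sub>R snd p + 0 *\<^sub>R snd p))"
    by (rule continuous_map_fiber_combination[OF is_bundle]) auto
  then show ?case by (simp add: iter_simps total_map_def case_prod_unfold)
next
  case (Suc n)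
  then show ?case unfolding iter_simps by (rule graph_op_continuous)
qed

text \<open>\<open>iter j\<close> is within \<open>M\<close> of \<open>iter 0 = 0\<close>, and
  \<open>n\<close> contractions shrink this distance. Comparing with all later iterates at once
  avoids summing a geometric series.\<close>

lemma iter_diff: "v \<in> fiber E x \<Longrightarrow> \<nu> (x, iter (n + j) x v - iter n x v) \<le> (\<tau> + \<delta>) ^ n * M"
proof (induction n arbitrary: x v)
  case 0
  then show ?case by (simp add: iter_simps iter_bounded)
next
  case (Suc n)
  then show ?case
    using graph_op_contracts[OF fiber_map_iter fiber_map_iter, of "n + j" n "(\<tau> + \<delta>) ^ n * M" v x]
    by (simp add: iter_simps mult.assoc)
qed

lemma rate_tendsto: "(\<lambda>n. c * ((\<tau> + \<delta>) ^ n * M)) \<longlonglongrightarrow> 0"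
proof -
  have "(\<lambda>n. (\<tau> + \<delta>) ^ n) \<longlonglongrightarrow> 0" using \<tau> \<delta> by (intro LIMSEQ_realpow_zero) auto
  from tendsto_mult_right[OF this, of M] tendsto_mult_left[of _ 0 sequentially c] show ?thesis by simp
qed

text \<open>Fibres are complete, so the iterates converge at each vector; the rate passes to the
  limit and does not depend on \<open>x\<close> or \<open>v\<close>, and choice collects the limits
  into one family.\<close>

lemma ex_limit:
  "\<exists>h. fiber_map h \<and> (\<forall>n x. \<forall>v\<in>fiber E x. \<nu> (x, h x v - iter n x v) \<le> (\<tau> + \<delta>) ^ n * M)"
proof -
  have "\<exists>w. w \<in> fiber E x \<and> (\<forall>n. \<nu> (x, w - iter n x v) \<le> (\<tau> + \<delta>) ^ n * M)" if v: "v \<in> fiber E x" for x v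
  proof -
    have Cau: "\<exists>K. \<forall>m\<ge>K. \<forall>n\<ge>K. \<nu> (x, iter m x v - iter n x v) < e" if "0 < e" for e
    proof -
      have "\<forall>\<^sub>F n in sequentially. 1 * ((\<tau> + \<delta>) ^ n * M) < e / 2"
        using that by (intro order_tendstoD(2)[OF rate_tendsto]) auto
      from eventually_happens'[OF sequentially_bot this]
      obtain K where K: "(\<tau> + \<delta>) ^ K * M < e / 2" by auto
      have le: "\<nu> (x, iter m x v - iter K x v) < e / 2" if "m \<ge> K" for m
        using iter_diff[OF v, of K "m - K"] K that by simp
      have "\<nu> (x, iter m x v - iter n x v) < e" if "m \<ge> K" "n \<ge> K" for m n
        using norm_diff_triangle[of "iter m x v" x "iter K x v" "iter n x v"] le[OF that(1)] le[OF that(2)]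
          norm_diff_commute[of "iter K x v" x "iter n x v"] v by simp
      then show ?thesis by blast
    qed
    obtain w where w: "w \<in> fiber E x" "(\<lambda>k. \<nu> (x, w - iter k x v)) \<longlonglongrightarrow> 0"
      using fiber_complete[of "\<lambda>k. iter k x v" x] Cau v by auto
    have "\<nu> (x, w - iter n x v) \<le> (\<tau> + \<delta>) ^ n * M" for n
    proof (rule LIMSEQ_le_const)
      have "(\<lambda>k. \<nu> (x, w - iter k x v) + (\<tau> + \<delta>) ^ n * M) \<longlonglongrightarrow> 0 + (\<tau> + \<delta>) ^ n * M"
        by (intro tendsto_add w tendsto_const)
      then show "(\<lambda>k. \<nu> (x, w - iter k x v) + (\<tau> + \<delta>) ^ n * M) \<longlonglongrightarrow> (\<tau> + \<delta>) ^ n * M" by simp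
      have "\<nu> (x, w - iter n x v) \<le> \<nu> (x, w - iter k x v) + (\<tau> + \<delta>) ^ n * M" if "k \<ge> n" for k
        using norm_diff_triangle[of w x "iter k x v" "iter n x v"] iter_diff[OF v, of n "k - n"] w v that by simp
      then show "\<exists>N. \<forall>k\<ge>N. \<nu> (x, w - iter n x v) \<le> \<nu> (x, w - iter k x v) + (\<tau> + \<delta>) ^ n * M" by blast
    qed
    then show ?thesis using w by blast
  qed
  then have "\<forall>x v. \<exists>w. v \<in> fiber E x \<longrightarrow> w \<in> fiber E x \<and> (\<forall>n. \<nu> (x, w - iter n x v) \<le> (\<tau> + \<delta>) ^ n * M)"
    by blast
  then obtain h where "\<forall>x v. v \<in> fiber E x \<longrightarrow> h x v \<in> fiber E x \<and> (\<forall>n. \<nu> (x, h x v - iter n x v) \<le> (\<tau> + \<delta>) ^ n * M)"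
    unfolding choice_iff by blast
  then show ?thesis by (intro exI[of _ h]) (auto simp: fiber_map_def)
qed

text \<open>The iterates do not involve \<open>\<alpha>\<close>, so one \<open>h\<close> serves all
  admissible exponents and only \<open>K\<close> varies with \<open>\<alpha>\<close>. The constant
  is uniform over the base.\<close>

lemma ex_bounded_solution:
  "\<exists>h. fiber_map h \<and> solution h \<and> continuous_map E E (total_map id h) \<and>
     (\<forall>x. \<forall>v\<in>fiber E x. \<nu> (x, h x v) \<le> M) \<and>
     (\<forall>\<alpha>. 0 < \<alpha> \<longrightarrow> \<alpha> \<le> 1 \<longrightarrow> (\<tau> + \<delta>) * \<kappa> powr \<alpha> < 1 \<longrightarrow> \<tau> * (\<Lambda> powr \<alpha> + \<delta>) < 1 \<longrightarrow>
        (\<exists>K. \<forall>x. \<forall>u\<in>fiber E x. \<forall>v\<in>fiber E x. \<nu> (x, h x u - h x v) \<le> K * \<nu> (x, u - v) powr \<alpha>))"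
proof -
  obtain h where h: "fiber_map h"
    and lim: "\<And>n x v. v \<in> fiber E x \<Longrightarrow> \<nu> (x, h x v - iter n x v) \<le> (\<tau> + \<delta>) ^ n * M"
    using ex_limit by blast
  \<comment> \<open>Estimates for the iterates carry over to \<open>h\<close> up to a multiple of
    the vanishing rate; this removes that error.\<close>
  have le_lim: "r \<le> s" if "\<And>n. r \<le> s + c * ((\<tau> + \<delta>) ^ n * M)" for r s c
  proof (rule LIMSEQ_le_const)
    show "(\<lambda>n. s + c * ((\<tau> + \<delta>) ^ n * M)) \<longlonglongrightarrow> s"
      using tendsto_add[OF tendsto_const[of s] rate_tendsto] by simp
  qed (use that in blast)
  have cont: "continuous_map E E (total_map id h)"
    unfolding total_map_def case_prod_unfold id_apply
  proof (rule continuous_map_uniform_limit)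
    show "continuous_map E E (\<lambda>z. (fst z, iter k (fst z) (snd z)))" for k
      using iter_continuous[of k] by (simp add: total_map_def case_prod_unfold)
    show "(\<lambda>n. 1 * ((\<tau> + \<delta>) ^ n * M)) \<longlonglongrightarrow> 0" by (rule rate_tendsto)
  qed (use h lim in \<open>auto simp flip: mem_fiber_iff\<close>)
  have "graph_op h x w = h x w" if w: "w \<in> fiber E x" for x w
  proof -
    have m: "graph_op h x w \<in> fiber E x" "h x w \<in> fiber E x" "iter n x w \<in> fiber E x" for n
      using h w fiber_map_graph_op by auto
    \<comment> \<open>Both \<open>graph_op h\<close> and \<open>h\<close> lie within
      \<open>(\<tau> + \<delta>) ^ Suc n * M\<close> of \<open>iter (Suc n)\<close>, which accounts
      for the factor \<open>2\<close>.\<close>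
    have "\<nu> (x, graph_op h x w - h x w) \<le> 0 + 2 * (\<tau> + \<delta>) * ((\<tau> + \<delta>) ^ n * M)" for n
    proof -
      have "\<nu> (x, graph_op h x w - iter (Suc n) x w) \<le> (\<tau> + \<delta>) * ((\<tau> + \<delta>) ^ n * M)"
        using graph_op_contracts[OF h fiber_map_iter, of n "(\<tau> + \<delta>) ^ n * M" w x] lim w by (simp add: iter_simps)
      moreover have "\<nu> (x, iter (Suc n) x w - h x w) \<le> (\<tau> + \<delta>) * ((\<tau> + \<delta>) ^ n * M)"
        using lim[OF w, of "Suc n"] norm_diff_commute[OF m(2) m(3), of "Suc n"] by (simp add: mult.assoc)
      ultimately show ?thesis
        using norm_diff_triangle[OF m(1) m(3)[of "Suc n"] m(2)] by (simp only: mult.assoc)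
    qed
    then have "\<nu> (x, graph_op h x w - h x w) \<le> 0" by (rule le_lim)
    then show ?thesis using norm_eq_zero[of "graph_op h x w - h x w" x] m by simp
  qed
  then have sol: "solution h" using graph_op_fixed_iff[OF h] by simp
  have bd: "\<nu> (x, h x v) \<le> M" if v: "v \<in> fiber E x" for x v
  proof (rule le_lim)
    fix n
    show "\<nu> (x, h x v) \<le> M + 1 * ((\<tau> + \<delta>) ^ n * M)"
      using norm_triangle[of "h x v - iter n x v" x "iter n x v"] lim[OF v, of n] iter_bounded[OF v, of n] h v by simp
  qed
  have hoelder: "\<exists>K. \<forall>x. \<forall>u\<in>fiber E x. \<forall>v\<in>fiber E x. \<nu> (x, h x u - h x v) \<le> K * \<nu> (x, u - v) powr \<alpha>"
    if \<alpha>: "0 < \<alpha>" "\<alpha> \<le> 1" and r1: "(\<tau> + \<delta>) * \<kappa> powr \<alpha> < 1" and r2: "\<tau> * (\<Lambda> powr \<alpha> + \<delta>) < 1" for \<alpha>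
  proof -
    define r s where "r = (\<tau> + \<delta>) * \<kappa> powr \<alpha>" and "s = \<tau> * (\<Lambda> powr \<alpha> + \<delta>)"
    \<comment> \<open>The quotients solve \<open>r * t + \<delta> * \<kappa> = t\<close> and
      \<open>s * t + \<tau> * \<delta> = t\<close>. Since \<open>r\<close> and \<open>s\<close> are
      below \<open>1\<close>, every larger \<open>t\<close> satisfies the corresponding inequality,
      so the sum meets both and also covers \<open>2 * M\<close>.\<close>
    define K where "K = 2 * M + \<delta> * \<kappa> / (1 - r) + \<tau> * \<delta> / (1 - s)"
    have r: "r < 1" and s: "s < 1" using r1 r2 by (auto simp: r_def s_def)
    have p: "0 \<le> \<delta> * \<kappa> / (1 - r)" "0 \<le> \<tau> * \<delta> / (1 - s)" using r s \<tau> \<delta> \<kappa> by auto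
    then have K0: "0 \<le> K" and KM: "2 * M \<le> K" using M_nonneg by (auto simp: K_def)
    have "\<delta> * \<kappa> / (1 - r) \<le> K" "\<tau> * \<delta> / (1 - s) \<le> K" using p M_nonneg by (auto simp: K_def)
    then have "r * K + \<delta> * \<kappa> \<le> K" "s * K + \<tau> * \<delta> \<le> K"
      using r s by (simp_all add: pos_divide_le_eq algebra_simps)
    then have K1: "(\<tau> + \<delta>) * \<kappa> powr \<alpha> * K + \<delta> * \<kappa> \<le> K" and K2: "\<tau> * (\<Lambda> powr \<alpha> + \<delta>) * K + \<tau> * \<delta> \<le> K"
      by (simp_all only: r_def s_def)
    have it: "\<nu> (x, iter n x u - iter n x v) \<le> K * \<nu> (x, u - v) powr \<alpha>"
      if "u \<in> fiber E x" "v \<in> fiber E x" for n x u v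
      using that
    proof (induction n arbitrary: x u v)
      case 0
      then show ?case using K0 by (simp add: iter_simps)
    next
      case (Suc n)
      show ?case unfolding iter_simps
        by (rule graph_op_hoelder[OF fiber_map_iter iter_bounded \<alpha> K0 KM K1 K2 Suc.IH Suc.prems])
    qed
    have "\<nu> (x, h x u - h x v) \<le> K * \<nu> (x, u - v) powr \<alpha>" if u: "u \<in> fiber E x" and v: "v \<in> fiber E x" for x u v
    proof (rule le_lim)
      fix n
      have "\<nu> (x, h x u - h x v) \<le> \<nu> (x, h x u - iter n x u) + \<nu> (x, iter n x u - h x v)"
        using h u v by (intro norm_diff_triangle) auto
      also have "\<nu> (x, iter n x u - h x v) \<le> \<nu> (x, iter n x u - iter n x v) + \<nu> (x, iter n x v - h x v)"
        using h u v by (intro norm_diff_triangle) auto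
      finally show "\<nu> (x, h x u - h x v) \<le> K * \<nu> (x, u - v) powr \<alpha> + 2 * ((\<tau> + \<delta>) ^ n * M)"
        using it[OF u v, of n] lim[OF u, of n] lim[OF v, of n] norm_diff_commute[of "h x v" x "iter n x v"] h v by simp
    qed
    then show ?thesis by blast
  qed
  show ?thesis using h sol cont bd hoelder by (intro exI[of _ h]) blast
qed

end

subsection \<open>Linearization\<close>

text \<open>\<open>surj\<close> together with the lower bound obtained from
  \<open>\<delta> < l\<close> makes each fibre map \<open>A x + \<phi> x\<close> bijective with a
  Lipschitz inverse.\<close>

locale perturbed_cocycle = hyperbolic_cocycle E \<nu> f fi A Ai P Q \<tau> \<delta>
  for E :: "('x::topological_space \<times> 'v::real_vector) topology" and \<nu> f fi A Ai P Q \<tau> \<delta> +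
  fixes \<phi> :: "'x \<Rightarrow> 'v \<Rightarrow> 'v" and l L B :: real
  assumes fi_continuous: "continuous_on UNIV fi"
    and \<phi>_continuous: "continuous_map E E (total_map f \<phi>)"
    and \<phi>_lipschitz: "u \<in> fiber E x \<Longrightarrow> v \<in> fiber E x \<Longrightarrow> \<nu> (f x, \<phi> x u - \<phi> x v) \<le> \<delta> * \<nu> (x, u - v)"
    and \<phi>_bounded: "v \<in> fiber E x \<Longrightarrow> \<nu> (f x, \<phi> x v) \<le> B" and B: "0 \<le> B"
    and surj: "(\<lambda>v. A x v + \<phi> x v) ` fiber E x = fiber E (f x)"
    and l: "\<delta> < l" and l_L: "l \<le> L"
    and A_lower: "v \<in> fiber E x \<Longrightarrow> l * \<nu> (x, v) \<le> \<nu> (f x, A x v)"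
    and A_upper: "v \<in> fiber E x \<Longrightarrow> \<nu> (f x, A x v) \<le> L * \<nu> (x, v)"
begin

lemma \<phi>_mem [simp]: "v \<in> fiber E x \<Longrightarrow> \<phi> x v \<in> fiber E (f x)"
  using continuous_map_image_subset_topspace[OF \<phi>_continuous]
  by (fastforce simp: total_map_def mem_fiber_iff)

definition "G x v = A x v + \<phi> x v"
definition "Gi y w = inv_into (fiber E (fi y)) (G (fi y)) w"

lemma G_mem: "v \<in> fiber E x \<Longrightarrow> G x v \<in> fiber E (f x)"
  by (simp add: G_def)

text \<open>\<open>A\<close> stretches differences by at least \<open>l\<close> and
  \<open>\<phi>\<close> changes them by at most \<open>\<delta>\<close>. Injectivity of
  \<open>G x\<close> and the constant \<open>1 / (l - \<delta>)\<close> of its inverse come from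
  here.\<close>

lemma G_lower:
  assumes "u \<in> fiber E x" "v \<in> fiber E x"
  shows "(l - \<delta>) * \<nu> (x, u - v) \<le> \<nu> (f x, G x u - G x v)"
proof -
  have "A x (u - v) = (G x u - G x v) - (\<phi> x u - \<phi> x v)"
    using assms by (simp add: G_def linear_rules)
  then have "\<nu> (f x, A x (u - v)) \<le> \<nu> (f x, G x u - G x v) + \<nu> (f x, \<phi> x u - \<phi> x v)"
    using norm_diff_le[of "G x u - G x v" "f x" "\<phi> x u - \<phi> x v"] assms G_mem by simp
  then show ?thesis
    using A_lower[of "u - v" x] \<phi>_lipschitz[OF assms] assms by (simp add: algebra_simps)
qed

lemma G_upper:
  assumes "u \<in> fiber E x" "v \<in> fiber E x"
  shows "\<nu> (f x, G x u - G x v) \<le> (L + \<delta>) * \<nu> (x, u - v)"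
proof -
  have "G x u - G x v = A x (u - v) + (\<phi> x u - \<phi> x v)"
    using assms by (simp add: G_def linear_rules)
  then have "\<nu> (f x, G x u - G x v) \<le> \<nu> (f x, A x (u - v)) + \<nu> (f x, \<phi> x u - \<phi> x v)"
    using norm_triangle[of "A x (u - v)" "f x" "\<phi> x u - \<phi> x v"] assms by simp
  then show ?thesis
    using A_upper[of "u - v" x] \<phi>_lipschitz[OF assms] assms by (simp add: algebra_simps)
qed

lemma G_inj: "inj_on (G x) (fiber E x)"
proof (rule inj_onI)
  fix u v assume uv: "u \<in> fiber E x" "v \<in> fiber E x" and eq: "G x u = G x v"
  then have "(l - \<delta>) * \<nu> (x, u - v) \<le> 0" using G_lower[OF uv] by simp
  then have "\<nu> (x, u - v) \<le> 0" using l by (simp add: mult_le_0_iff)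
  then show "u = v" using norm_eq_zero[of "u - v" x] uv by simp
qed

lemma G_image: "G (fi y) ` fiber E (fi y) = fiber E y"
  using surj[of "fi y"] by (simp add: G_def)

lemma Gi_mem: "w \<in> fiber E y \<Longrightarrow> Gi y w \<in> fiber E (fi y)"
  and G_Gi: "w \<in> fiber E y \<Longrightarrow> G (fi y) (Gi y w) = w"
  unfolding Gi_def using G_image[of y] by (auto intro: inv_into_into f_inv_into_f)

lemma Gi_G: "v \<in> fiber E x \<Longrightarrow> Gi (f x) (G x v) = v"
  unfolding Gi_def using inv_into_f_f[OF G_inj] by simp

lemma G_continuous: "continuous_map E E (total_map f G)"
  using continuous_map_total_sum[OF A_continuous \<phi>_continuous, of 1 1] by (simp add: G_def[abs_def])

lemma Gi_lipschitz:
  assumes "u \<in> fiber E y" "v \<in> fiber E y"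
  shows "\<nu> (fi y, Gi y u - Gi y v) \<le> 1 / (l - \<delta>) * \<nu> (y, u - v)"
  using G_lower[OF Gi_mem[OF assms(1)] Gi_mem[OF assms(2)]] l assms by (simp add: G_Gi field_simps)

text \<open>Fibrewise Lipschitz bounds do not control variation with the base point. A local section
  through the preimage is therefore pushed forward by \<open>G\<close> and compared there with
  \<open>z\<close>, and the uniform Lipschitz constant of \<open>Gi\<close> carries the comparison
  back.\<close>

lemma Gi_continuous: "continuous_map E E (total_map fi Gi)"
  unfolding continuous_map_atin
proof
  fix q assume q: "q \<in> topspace E"
  define \<F> where "\<F> = atin E q"
  let ?y = "fst q" and ?w = "snd q"
  have w: "?w \<in> fiber E ?y" using q by (simp add: mem_fiber_iff)
  obtain \<sigma> where \<sigma>: "limitin E (\<lambda>x. (x, \<sigma> x)) (fi ?y, Gi ?y ?w) (nhds (fi ?y))"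
    using local_section[OF is_bundle Gi_mem[OF w]] by blast
  have id: "limitin E (\<lambda>z. z) (?y, ?w) \<F>"
    unfolding \<F>_def prod.collapse using q by (intro limitin_continuous_map) auto
  have "(fst \<longlongrightarrow> ?y) \<F>"
    using continuous_map_limit[OF vector_bundle_fst[OF is_bundle] id] by (simp add: o_def)
  then have "((\<lambda>z. fi (fst z)) \<longlongrightarrow> fi ?y) \<F>"
    using continuous_on_tendsto_compose[OF fi_continuous] by simp
  note S = limitin_compose_filterlim[OF \<sigma> this]
  have "limitin E (\<lambda>z. (fst z, G (fi (fst z)) (\<sigma> (fi (fst z))))) (?y, ?w) \<F>"
    using continuous_map_limit[OF G_continuous S] G_Gi[OF w] by (simp add: total_map_def o_def)
  from limitin_norm_diff[OF id this]
  have D: "((\<lambda>z. \<nu> (fst z, snd z - G (fi (fst z)) (\<sigma> (fi (fst z))))) \<longlongrightarrow> 0) \<F>" by simp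
  have inE: "\<forall>\<^sub>F z in \<F>. z \<in> topspace E" unfolding \<F>_def by (rule eventually_atin_topspace)
  have inS: "\<forall>\<^sub>F z in \<F>. \<sigma> (fi (fst z)) \<in> fiber E (fi (fst z))"
    using limitinD[OF S openin_topspace limitin_topspace[OF S]] by (simp add: mem_fiber_iff)
  have ev: "\<forall>\<^sub>F z in \<F>. 0 \<le> \<nu> (fi (fst z), Gi (fst z) (snd z) - \<sigma> (fi (fst z))) \<and>
      \<nu> (fi (fst z), Gi (fst z) (snd z) - \<sigma> (fi (fst z)))
        \<le> 1 / (l - \<delta>) * \<nu> (fst z, snd z - G (fi (fst z)) (\<sigma> (fi (fst z))))"
    using inE inS
  proof eventually_elim
    case (elim z)
    have z: "snd z \<in> fiber E (fst z)" using elim(1) by (rule snd_mem_fiber) simp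
    have "G (fi (fst z)) (\<sigma> (fi (fst z))) \<in> fiber E (fst z)" using G_mem[OF elim(2)] by simp
    from Gi_lipschitz[OF z this] Gi_G[OF elim(2)] show ?case
      using Gi_mem[OF z] elim by (simp add: norm_nonneg)
  qed
  have "limitin E (total_map fi Gi) (fi ?y, Gi ?y ?w) \<F>"
  proof (rule limitin_of_norm_diff[OF S])
    show "\<forall>\<^sub>F z in \<F>. total_map fi Gi z \<in> topspace E"
      using inE by eventually_elim
        (auto simp: total_map_def case_prod_unfold Gi_mem snd_mem_fiber simp flip: mem_fiber_iff)
    show "((\<lambda>z. \<nu> (fst (fi (fst z), \<sigma> (fi (fst z))), snd (total_map fi Gi z) - snd (fi (fst z), \<sigma> (fi (fst z))))) \<longlongrightarrow> 0) \<F>"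
    proof (rule tendsto_sandwich[OF _ _ tendsto_const])
      show "((\<lambda>z. 1 / (l - \<delta>) * \<nu> (fst z, snd z - G (fi (fst z)) (\<sigma> (fi (fst z))))) \<longlongrightarrow> 0) \<F>"
        using tendsto_mult_left[OF D, of "1 / (l - \<delta>)"] by simp
    qed (use ev in \<open>auto simp: total_map_def case_prod_unfold elim: eventually_mono\<close>)
  qed (simp add: total_map_def case_prod_unfold)
  then show "limitin E (total_map fi Gi) (total_map fi Gi q) (atin E q)"
    by (simp add: \<F>_def total_map_def case_prod_unfold)
qed

text \<open>The constant \<open>1 / l\<close> is deliberately weakened to the one of
  \<open>Gi\<close>, so that both conjugacy equations run with the same \<open>\<kappa>\<close> and
  have the same admissible exponents.\<close>

lemma Ai_lipschitz:
  assumes "u \<in> fiber E y" "v \<in> fiber E y"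
  shows "\<nu> (fi y, Ai y u - Ai y v) \<le> 1 / (l - \<delta>) * \<nu> (y, u - v)"
proof -
  have m: "Ai y (u - v) \<in> fiber E (fi y)" using assms by simp
  have "(l - \<delta>) * \<nu> (fi y, Ai y (u - v)) \<le> l * \<nu> (fi y, Ai y (u - v))"
    using norm_nonneg[OF m] \<delta> by (simp add: mult_right_mono)
  also have "\<dots> \<le> \<nu> (y, u - v)" using A_lower[OF m] assms by (simp add: A_Ai)
  finally show ?thesis using l assms by (simp add: linear_rules field_simps)
qed

lemma A_lipschitz:
  assumes "u \<in> fiber E x" "v \<in> fiber E x"
  shows "\<nu> (f x, A x u - A x v) \<le> (L + \<delta>) * \<nu> (x, u - v)"
proof -
  have "\<nu> (f x, A x (u - v)) \<le> L * \<nu> (x, u - v)" using A_upper assms by simp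
  also have "\<dots> \<le> (L + \<delta>) * \<nu> (x, u - v)"
    using norm_nonneg[of "u - v" x] \<delta> assms by (simp add: mult_right_mono)
  finally show ?thesis using assms by (simp add: linear_rules)
qed

sublocale conj: bounded_conjugacy_equation E \<nu> f fi A Ai P Q \<tau> \<delta> G Gi "\<lambda>x v k. - \<phi> x v" B "1 / (l - \<delta>)" "L + \<delta>"
proof unfold_locales
  show "continuous_map E E (total_map f (\<lambda>x v. - \<phi> x v))"
    using continuous_map_total_sum[OF \<phi>_continuous \<phi>_continuous, of "-1" 0] by simp
  fix x v v' k k' assume v: "v \<in> fiber E x" "v' \<in> fiber E x" "k \<in> fiber E x" "k' \<in> fiber E x"
  show "\<nu> (f x, - \<phi> x v - - \<phi> x v') \<le> \<delta> * \<nu> (x, v - v') + \<delta> * \<nu> (x, k - k')"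
    using \<phi>_lipschitz[OF v(1,2)] norm_diff_commute[of "\<phi> x v" "f x" "\<phi> x v'"]
      mult_nonneg_nonneg[OF \<delta>(1) norm_nonneg[of "k - k'" x]] v by simp
qed (use l l_L B \<delta> in \<open>auto simp: G_mem Gi_mem G_Gi Gi_G norm_nonneg norm_minus \<phi>_bounded
      G_continuous Gi_continuous G_upper Gi_lipschitz[simplified]\<close>)

text \<open>As \<open>B\<close> is the same as for \<open>conj\<close>, and \<open>M\<close> is
  computed from \<open>\<tau>\<close> and \<open>B\<close>, both displacements obey the same
  supremum bound.\<close>

sublocale coconj: bounded_conjugacy_equation E \<nu> f fi A Ai P Q \<tau> \<delta> A Ai "\<lambda>x v k. \<phi> x (v + k)" B "1 / (l - \<delta>)" "L + \<delta>"
proof unfold_locales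
  show "continuous_map E E (total_map f (\<lambda>x v. \<phi> x (v + h x v)))"
    if h: "continuous_map E E (total_map id h)" for h
  proof -
    have "continuous_map E E (total_map id (\<lambda>x v. v))" by (simp add: total_map_def case_prod_unfold)
    from continuous_map_compose[OF continuous_map_total_sum[OF this h, of 1 1] \<phi>_continuous]
    show ?thesis by (simp add: total_map_def o_def case_prod_unfold)
  qed
  fix x v v' k k' assume v: "v \<in> fiber E x" "v' \<in> fiber E x" "k \<in> fiber E x" "k' \<in> fiber E x"
  have "\<nu> (f x, \<phi> x (v + k) - \<phi> x (v' + k')) \<le> \<delta> * \<nu> (x, (v - v') + (k - k'))"
    using \<phi>_lipschitz[of "v + k" x "v' + k'"] v by (simp add: algebra_simps)
  also have "\<dots> \<le> \<delta> * (\<nu> (x, v - v') + \<nu> (x, k - k'))"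
    using v \<delta> norm_triangle[of "v - v'" x "k - k'"] by (intro mult_left_mono) auto
  finally show "\<nu> (f x, \<phi> x (v + k) - \<phi> x (v' + k')) \<le> \<delta> * \<nu> (x, v - v') + \<delta> * \<nu> (x, k - k')"
    by (simp add: algebra_simps)
next
  fix x v k k' assume v: "v \<in> fiber E x" "k \<in> fiber E x" "k' \<in> fiber E x"
  show "\<nu> (f x, \<phi> x (v + k) - \<phi> x (v + k')) \<le> \<delta> * \<nu> (x, k - k')"
    using \<phi>_lipschitz[of "v + k" x "v + k'"] v by simp
qed (use l l_L B \<delta> in \<open>auto simp: A_Ai Ai_A \<phi>_bounded A_continuous Ai_continuous A_lipschitz Ai_lipschitz[simplified]\<close>)

text \<open>An admissible \<alpha> makes both quotients positive. Since
  \<open>ln (\<tau> + \<delta>) < 0 < ln ((1 - \<delta>) / \<tau>)\<close>, this forces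
  \<open>l - \<delta> < 1 < L + \<delta>\<close>, which decides the direction of the inequalities
  when denominators are cleared and excludes division by zero.\<close>

lemma rate_conditions:
  assumes \<alpha>: "0 < \<alpha>" "\<alpha> < ln (\<tau> + \<delta>) / ln (l - \<delta>)" "\<alpha> < ln ((1 - \<delta>) / \<tau>) / ln (L + \<delta>)"
  shows "(\<tau> + \<delta>) * (1 / (l - \<delta>)) powr \<alpha> < 1" "\<tau> * ((L + \<delta>) powr \<alpha> + \<delta>) < 1"
proof -
  have m: "0 < l - \<delta>" "0 < L + \<delta>" using l l_L \<delta> by auto
  have "ln (\<tau> + \<delta>) < 0" using \<tau> \<delta> by simp
  moreover have "0 < ln (\<tau> + \<delta>) / ln (l - \<delta>)" using \<alpha> by linarith
  ultimately have "ln (l - \<delta>) < 0" by (simp add: zero_less_divide_iff)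
  then have "ln (\<tau> + \<delta>) < \<alpha> * ln (l - \<delta>)" using \<alpha>(2) by (simp add: neg_less_divide_eq)
  then have "\<tau> + \<delta> < (l - \<delta>) powr \<alpha>"
    using m \<tau> \<delta> by (subst ln_less_cancel_iff[symmetric]) (auto simp: ln_powr)
  then show "(\<tau> + \<delta>) * (1 / (l - \<delta>)) powr \<alpha> < 1" using m by (simp add: powr_divide)
  have "0 < ln ((1 - \<delta>) / \<tau>)" using \<tau> \<delta> by simp
  moreover have "0 < ln ((1 - \<delta>) / \<tau>) / ln (L + \<delta>)" using \<alpha> by linarith
  ultimately have "0 < ln (L + \<delta>)" by (simp add: zero_less_divide_iff)
  then have "\<alpha> * ln (L + \<delta>) < ln ((1 - \<delta>) / \<tau>)" using \<alpha>(3) by (simp add: pos_less_divide_eq)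
  then have "(L + \<delta>) powr \<alpha> < (1 - \<delta>) / \<tau>"
    using m \<tau> \<delta> by (subst ln_less_cancel_iff[symmetric]) (auto simp: ln_powr)
  then have "\<tau> * (L + \<delta>) powr \<alpha> + \<delta> < 1" using \<tau> by (simp add: pos_less_divide_eq mult.commute)
  \<comment> \<open>The exponent bound yields
    \<open>\<tau> * (L + \<delta>) powr \<alpha> + \<delta> < 1\<close>; replacing \<delta> by the
    smaller \<open>\<tau> * \<delta>\<close> gives the required form.\<close>
  moreover have "\<tau> * \<delta> \<le> \<delta>" using mult_right_mono[of \<tau> 1 \<delta>] \<tau> \<delta> by simp
  ultimately show "\<tau> * ((L + \<delta>) powr \<alpha> + \<delta>) < 1" by (simp add: algebra_simps)
qed

text \<open>A nonzero vector has a nonzero stable or unstable component, whence \<open>l \<le> \<tau>\<close> or \<open>1 / \<tau> \<le> L\<close>.\<close>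

lemma exponent_le_1:
  assumes v: "v \<in> fiber E x" "v \<noteq> 0"
    and \<alpha>: "0 < \<alpha>" "\<alpha> < ln (\<tau> + \<delta>) / ln (l - \<delta>)" "\<alpha> < ln ((1 - \<delta>) / \<tau>) / ln (L + \<delta>)"
  shows "\<alpha> \<le> 1"
proof (cases "P x v = 0")
  case False
  then have p: "0 < \<nu> (x, P x v)" using v norm_pos by simp
  have "l * \<nu> (x, P x v) \<le> \<tau> * \<nu> (x, P x v)"
    using A_lower[of "P x v" x] A_contracts[OF v(1)] v by simp
  then have "l - \<delta> \<le> \<tau> + \<delta>" using p \<delta> by simp
  moreover have "0 < l - \<delta>" using l by simp
  ultimately have "ln (l - \<delta>) \<le> ln (\<tau> + \<delta>)" "ln (\<tau> + \<delta>) < 0" using \<tau> \<delta> by auto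
  \<comment> \<open>Both logarithms are negative and the denominator is at least as negative as the
    numerator.\<close>
  then have "ln (\<tau> + \<delta>) / ln (l - \<delta>) \<le> 1" by (simp add: divide_le_eq)
  then show ?thesis using \<alpha> by linarith
next
  case True
  then have qv: "Q x v = v" using P_Q[OF v(1)] by simp
  \<comment> \<open>The unstable vector \<open>v\<close> is compared with its preimage:
    \<open>Ai\<close> contracts by at least the factor \<tau>, while \<open>A\<close> expands by at
    most \<open>L\<close>.\<close>
  let ?w = "Ai x v"
  have w: "?w \<in> fiber E (fi x)" using v by simp
  have p: "0 < \<nu> (x, v)" using v norm_pos by simp
  have "\<nu> (x, v) \<le> L * \<nu> (fi x, ?w)" using A_upper[OF w] v by (simp add: A_Ai)
  also have "\<dots> \<le> L * (\<tau> * \<nu> (x, v))"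
    using Ai_contracts[OF v(1)] qv l l_L \<delta> by (intro mult_left_mono) auto
  finally have "1 \<le> L * \<tau>" using p by (simp flip: mult.assoc)
  then have "1 / \<tau> \<le> L" using \<tau> by (simp add: divide_le_eq)
  moreover have "(1 - \<delta>) / \<tau> \<le> 1 / \<tau>" using \<tau> \<delta> by (simp add: divide_right_mono)
  ultimately have le: "(1 - \<delta>) / \<tau> \<le> L + \<delta>" using \<delta> by linarith
  have gt: "1 < (1 - \<delta>) / \<tau>" using \<tau> \<delta> by simp
  have "ln ((1 - \<delta>) / \<tau>) \<le> ln (L + \<delta>)" "0 < ln ((1 - \<delta>) / \<tau>)"
    using le gt by (simp_all del: ln_divide_pos add: less_trans[OF zero_less_one])
  then have "ln ((1 - \<delta>) / \<tau>) / ln (L + \<delta>) \<le> 1" by (simp add: divide_le_eq)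
  then show ?thesis using \<alpha> by linarith
qed

section \<open>The two conjugacies and their compositions\<close>

theorem global_linearization:
  "\<exists>H h h'.
     homeomorphic_map E E (total_map id H) \<and>
     (\<forall>x. \<forall>v\<in>fiber E x. H (f x) (A x v + \<phi> x v) = A x (H x v)) \<and>
     (\<forall>x. h x ` fiber E x \<subseteq> fiber E x \<and> h' x ` fiber E x \<subseteq> fiber E x) \<and>
     (\<forall>x. \<forall>v\<in>fiber E x. H x v = v + h x v) \<and>
     (\<forall>x. \<forall>v\<in>fiber E x. inv_into (fiber E x) (H x) v = v + h' x v) \<and>
     (\<forall>x. bounded_on_fiber E \<nu> x (h x) \<and> bounded_on_fiber E \<nu> x (h' x)) \<and>
     (\<forall>\<alpha>. 0 < \<alpha> \<and>
           \<alpha> < min (ln (\<tau> + \<delta>) / ln (l - \<delta>)) (ln ((1 - \<delta>) / \<tau>) / ln (L + \<delta>)) \<longrightarrow>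
           (\<forall>x. holder_on_fiber E \<nu> \<alpha> x (h x) \<and> holder_on_fiber E \<nu> \<alpha> x (h' x)))"
proof -
  obtain h where h: "conj.fiber_map h" and h_sol: "conj.solution h"
    and h_cont: "continuous_map E E (total_map id h)"
    and h_bd: "\<forall>x. \<forall>v\<in>fiber E x. \<nu> (x, h x v) \<le> conj.M"
    and h_hoelder: "\<forall>\<alpha>. 0 < \<alpha> \<longrightarrow> \<alpha> \<le> 1 \<longrightarrow> (\<tau> + \<delta>) * (1 / (l - \<delta>)) powr \<alpha> < 1 \<longrightarrow> \<tau> * ((L + \<delta>) powr \<alpha> + \<delta>) < 1 \<longrightarrow>
        (\<exists>K. \<forall>x. \<forall>u\<in>fiber E x. \<forall>v\<in>fiber E x. \<nu> (x, h x u - h x v) \<le> K * \<nu> (x, u - v) powr \<alpha>)"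
    using conj.ex_bounded_solution by (elim exE conjE)
  obtain h' where h': "conj.fiber_map h'" and h'_sol: "coconj.solution h'"
    and h'_cont: "continuous_map E E (total_map id h')"
    and h'_bd: "\<forall>x. \<forall>v\<in>fiber E x. \<nu> (x, h' x v) \<le> conj.M"
    and h'_hoelder: "\<forall>\<alpha>. 0 < \<alpha> \<longrightarrow> \<alpha> \<le> 1 \<longrightarrow> (\<tau> + \<delta>) * (1 / (l - \<delta>)) powr \<alpha> < 1 \<longrightarrow> \<tau> * ((L + \<delta>) powr \<alpha> + \<delta>) < 1 \<longrightarrow>
        (\<exists>K. \<forall>x. \<forall>u\<in>fiber E x. \<forall>v\<in>fiber E x. \<nu> (x, h' x u - h' x v) \<le> K * \<nu> (x, u - v) powr \<alpha>)"
    using coconj.ex_bounded_solution by (elim exE conjE)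
  define H H' where "H x v = v + h x v" and "H' x v = v + h' x v" for x v
  have mem [simp]: "h x v \<in> fiber E x" "h' x v \<in> fiber E x" if "v \<in> fiber E x" for x v
    using h h' that by auto
  have Hmem [simp]: "H x v \<in> fiber E x" "H' x v \<in> fiber E x" if "v \<in> fiber E x" for x v
    using that by (simp_all add: H_def H'_def)
  have h_eq: "h (f x) (G x v) = A x (h x v) - \<phi> x v" if "v \<in> fiber E x" for x v
    using h_sol that by (simp add: conj.solution_def)
  have h'_eq: "h' (f x) (A x v) = A x (h' x v) + \<phi> x (H' x v)" if "v \<in> fiber E x" for x v
    using h'_sol that by (simp add: coconj.solution_def H'_def)
  have H_G: "H (f x) (G x v) = A x (H x v)" if "v \<in> fiber E x" for x v
    using that by (simp add: H_def h_eq linear_rules) (simp add: G_def)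
  have H'_A: "H' (f x) (A x v) = G x (H' x v)" if "v \<in> fiber E x" for x v
    using that h'_eq[OF that] by (simp add: H'_def G_def linear_rules)
  have bd: "\<nu> (x, s) \<le> conj.M + conj.M"
    if "\<nu> (x, u) \<le> conj.M" "\<nu> (x, w) \<le> conj.M" "u \<in> fiber E x" "w \<in> fiber E x" "s = u + w" for x u w s
    using norm_triangle[OF that(3,4)] that by simp
  have H_H': "H x (H' x v) = v" if v: "v \<in> fiber E x" for x v
  proof -
    interpret lin: conjugacy_equation E \<nu> f fi A Ai P Q \<tau> \<delta> A Ai "\<lambda>x v k. 0"
      by unfold_locales (use \<delta> in \<open>auto simp: A_Ai Ai_A norm_nonneg\<close>)
    \<comment> \<open>With this \<open>k\<close>, \<open>H (H' v) = v + k v\<close>. The composition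
      commutes with \<open>A\<close>, so \<open>k\<close> solves the homogeneous equation, and as a
      sum of two bounded terms it lies at bounded distance from the solution
      \<open>0\<close>.\<close>
    define k where "k x v = h' x v + h x (H' x v)" for x v
    have "lin.solution k" unfolding lin.solution_def
    proof (intro allI ballI)
      fix x v assume v: "v \<in> fiber E x"
      have "k (f x) (A x v) = h' (f x) (A x v) + h (f x) (G x (H' x v))" using v by (simp add: k_def H'_A)
      then show "k (f x) (A x v) = A x (k x v) + 0" using v by (simp add: h'_eq h_eq k_def linear_rules)
    qed
    moreover have "lin.solution (\<lambda>x v. 0)"
      unfolding lin.solution_def using A_linear[of 0 _ 0 0 0] by simp
    moreover have "lin.fiber_map k" "lin.fiber_map (\<lambda>x v. 0)" by (simp_all add: lin.fiber_map_def k_def)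
    moreover have "\<nu> (x, k x v - 0) \<le> conj.M + conj.M" if "v \<in> fiber E x" for x v
      using that h_bd h'_bd by (intro bd[of x "h' x v" "h x (H' x v)"]) (auto simp: k_def)
    ultimately have "k x v = 0" using lin.solution_unique[of k "\<lambda>x v. 0"] v by blast
    then show ?thesis by (simp add: k_def H_def H'_def)
  qed
  have H'_H: "H' x (H x v) = v" if v: "v \<in> fiber E x" for x v
  proof -
    interpret pert: conjugacy_equation E \<nu> f fi A Ai P Q \<tau> \<delta> G Gi "\<lambda>x v k. \<phi> x (v + k) - \<phi> x v"
      by unfold_locales
        (auto simp: G_mem Gi_mem G_Gi Gi_G intro: order_trans[OF \<phi>_lipschitz])
    \<comment> \<open>Now \<open>H' (H v) = v + k v\<close> commutes with \<open>A + \<phi>\<close>.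
      Subtracting the same relation for the identity leaves
      \<open>\<phi> (v + k) - \<phi> v\<close>, which vanishes at \<open>k = 0\<close>, so
      \<open>0\<close> is again a solution.\<close>
    define k where "k x v = h x v + h' x (H x v)" for x v
    have "pert.solution k" unfolding pert.solution_def
    proof (intro allI ballI)
      fix x v assume v: "v \<in> fiber E x"
      have "H' x (H x v) = v + k x v" by (simp add: k_def H_def H'_def add.assoc)
      moreover have "k (f x) (G x v) = h (f x) (G x v) + h' (f x) (A x (H x v))" using v by (simp add: k_def H_G)
      ultimately show "k (f x) (G x v) = A x (k x v) + (\<phi> x (v + k x v) - \<phi> x v)"
        using v h'_eq[of "H x v" x] by (simp add: h_eq k_def linear_rules)
    qed
    moreover have "pert.solution (\<lambda>x v. 0)"
      unfolding pert.solution_def using A_linear[of 0 _ 0 0 0] by simp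
    moreover have "pert.fiber_map k" "pert.fiber_map (\<lambda>x v. 0)" by (simp_all add: pert.fiber_map_def k_def)
    moreover have "\<nu> (x, k x v - 0) \<le> conj.M + conj.M" if "v \<in> fiber E x" for x v
      using that h_bd h'_bd by (intro bd[of x "h x v" "h' x (H x v)"]) (auto simp: k_def)
    ultimately have "k x v = 0" using pert.solution_unique[of k "\<lambda>x v. 0"] v by blast
    then show ?thesis by (simp add: k_def H_def H'_def add.assoc)
  qed
  have idc: "continuous_map E E (total_map id (\<lambda>x v. v))" by (simp add: total_map_def case_prod_unfold)
  have "continuous_map E E (total_map id H)" "continuous_map E E (total_map id H')"
    using continuous_map_total_sum[OF idc h_cont, of 1 1] continuous_map_total_sum[OF idc h'_cont, of 1 1]
    by (simp_all add: H_def[abs_def] H'_def[abs_def])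
  then have "homeomorphic_maps E E (total_map id H) (total_map id H')"
    unfolding homeomorphic_maps_def by (auto simp: total_map_def H_H' H'_H simp flip: mem_fiber_iff)
  then have homeo: "homeomorphic_map E E (total_map id H)" using homeomorphic_map_maps by blast
  have inv: "inv_into (fiber E x) (H x) v = v + h' x v" if v: "v \<in> fiber E x" for x v
  proof -
    have "inj_on (H x) (fiber E x)" by (rule inj_on_inverseI[of _ "H' x"]) (rule H'_H)
    then have "inv_into (fiber E x) (H x) v = H' x v" using v by (intro inv_into_f_eq) (auto simp: H_H')
    then show ?thesis by (simp add: H'_def)
  qed
  have hoelder: "holder_on_fiber E \<nu> \<alpha> x (h x) \<and> holder_on_fiber E \<nu> \<alpha> x (h' x)"
    if \<alpha>: "0 < \<alpha>" "\<alpha> < ln (\<tau> + \<delta>) / ln (l - \<delta>)" "\<alpha> < ln ((1 - \<delta>) / \<tau>) / ln (L + \<delta>)" for \<alpha> x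
  \<comment> \<open>The bound \<open>\<alpha> \<le> 1\<close> is drawn from a nonzero vector of the
    fibre; over a zero fibre the Hoelder estimate is trivial.\<close>
  proof (cases "fiber E x = {0}")
    case True
    then show ?thesis using mem[of 0 x] by (auto simp: holder_on_fiber_def)
  next
    case False
    then obtain v where "v \<in> fiber E x" "v \<noteq> 0" using fiber_closed(1)[of x] by blast
    then have "\<alpha> \<le> 1" using exponent_le_1 \<alpha> by blast
    then show ?thesis
      using h_hoelder[rule_format, OF \<alpha>(1) _ rate_conditions[OF \<alpha>]]
        h'_hoelder[rule_format, OF \<alpha>(1) _ rate_conditions[OF \<alpha>]]
      unfolding holder_on_fiber_def by blast
  qed
  show ?thesis
  proof (rule exI[of _ H], rule exI[of _ h], rule exI[of _ h'], intro conjI allI ballI impI)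
    show "homeomorphic_map E E (total_map id H)" by (rule homeo)
    show "H (f x) (A x v + \<phi> x v) = A x (H x v)" if "v \<in> fiber E x" for x v
      using H_G[OF that] by (simp add: G_def)
    show "bounded_on_fiber E \<nu> x (h x)" "bounded_on_fiber E \<nu> x (h' x)" for x
      using h_bd h'_bd unfolding bounded_on_fiber_def by blast+
  qed (use hoelder inv in \<open>auto simp: H_def\<close>)
qed

end

section \<open>Instantiation by the hyperbolic splitting and its adapted norm\<close>

theorem theorem1p1:
  fixes E :: "('x::metric_space \<times> 'v::real_vector) topology"
    and g :: "'x \<Rightarrow> 'v \<Rightarrow> 'v \<Rightarrow> real"
    and f :: "'x \<Rightarrow> 'x"
    and A \<phi> :: "'x \<Rightarrow> 'v \<Rightarrow> 'v"
    and Es Eu :: "'x \<Rightarrow> 'v set"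
    and C lam \<tau> l L \<delta> :: real
    and N :: nat
  defines "nrm \<equiv> adapted_norm E f A (metric_norm g) Es Eu N"
  assumes "compact (UNIV :: 'x set)"
    and "vector_bundle E"
    and "riemannian_metric E g"
    and "homeomorphic_map euclidean euclidean f"
    and "bundle_automorphism E f A"
    and "hyperbolic_splitting E f A (metric_norm g) Es Eu C lam"
    and "1 \<le> N" and "C * lam ^ N < 1"
    and "0 < \<tau>" and "\<tau> < 1"
    and "\<And>x v. v \<in> Es x \<Longrightarrow> nrm (total_map f A (x, v)) \<le> \<tau> * nrm (x, v)"
    and "\<And>x v. v \<in> Eu x \<Longrightarrow> nrm (total_inv E f A (x, v)) \<le> \<tau> * nrm (x, v)"
    and "0 < l" and "l \<le> L"
    and "\<And>x v. v \<in> fiber E x \<Longrightarrow>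
           l * nrm (x, v) \<le> nrm (f x, A x v) \<and> nrm (f x, A x v) \<le> L * nrm (x, v)"
    and "\<delta> < min (1 - \<tau>) l"
    and "\<phi> \<in> perturbation_class E f A nrm \<delta>"
  shows "\<exists>H h h'.
           homeomorphic_map E E (total_map id H) \<and>
           (\<forall>x. \<forall>v\<in>fiber E x. H (f x) (A x v + \<phi> x v) = A x (H x v)) \<and>
           (\<forall>x. h x ` fiber E x \<subseteq> fiber E x \<and> h' x ` fiber E x \<subseteq> fiber E x) \<and>
           (\<forall>x. \<forall>v\<in>fiber E x. H x v = v + h x v) \<and>
           (\<forall>x. \<forall>v\<in>fiber E x. inv_into (fiber E x) (H x) v = v + h' x v) \<and>
           (\<forall>x. bounded_on_fiber E nrm x (h x) \<and> bounded_on_fiber E nrm x (h' x)) \<and>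
           (\<forall>\<alpha>. 0 < \<alpha> \<and>
                 \<alpha> < min (ln (\<tau> + \<delta>) / ln (l - \<delta>)) (ln ((1 - \<delta>) / \<tau>) / ln (L + \<delta>)) \<longrightarrow>
                 (\<forall>x. holder_on_fiber E nrm \<alpha> x (h x) \<and> holder_on_fiber E nrm \<alpha> x (h' x)))"
proof -
  from assms(7) have splitting: "subbundle E Es" "subbundle E Eu"
      "\<forall>x. Es x \<inter> Eu x = {0} \<and> fiber E x = {s + u |s u. s \<in> Es x \<and> u \<in> Eu x}"
      "\<forall>x. A x ` Es x = Es (f x) \<and> A x ` Eu x = Eu (f x)"
    unfolding hyperbolic_splitting_def by - (elim conjE, assumption)+
  interpret ad: adapted_splitting E "metric_norm g" Es Eu f A N
  proof -
    interpret normed_bundle E "metric_norm g" by (rule normed_bundle_metric_norm[OF assms(3,4)])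
    show "adapted_splitting E (metric_norm g) Es Eu f A N"
      by (unfold_locales; rule splitting assms(5,6,8) splitting(3)[rule_format, THEN conjunct1]
          splitting(3)[rule_format, THEN conjunct2])
  qed
  interpret nb: normed_bundle E nrm
    unfolding nrm_def by (rule ad.adapted_normed_bundle)
  note swap = ad.splitting_swap
  from assms(18) have \<phi>: "continuous_map E E (total_map f \<phi>)" "0 \<le> \<delta>"
      "\<forall>x. \<forall>u\<in>fiber E x. \<forall>v\<in>fiber E x. nrm (f x, \<phi> x u - \<phi> x v) \<le> \<delta> * nrm (x, u - v)"
      "\<forall>x. homeomorphic_map (fiber_space E x) (fiber_space E (f x)) (total_map f (\<lambda>y v. A y v + \<phi> y v))"
      "bdd_above {nrm (f x, \<phi> x v) |x v. v \<in> fiber E x}"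
    unfolding perturbation_class_def mem_Collect_eq by - (elim conjE, assumption)+
  have f: "f (inv f x) = x" "inv f (f x) = x" for x
    using ad.inj_f ad.surj_f by (simp_all add: surj_f_inv_f)
  have AEs: "A x v \<in> Es (f x)" if "v \<in> Es x" for x v using splitting(4) that by blast
  have AEu: "A x v \<in> Eu (f x)" if "v \<in> Eu x" for x v using splitting(4) that by blast
  \<comment> \<open>Both subbundles are invariant, so \<open>A\<close> maps a decomposition to a
    decomposition, and uniqueness identifies the components.\<close>
  have A_P: "component Es Eu (f x) (A x v) = A x (component Es Eu x v)" if v: "v \<in> fiber E x" for x v
  proof (rule ad.component_eqI)
    have "A x v - A x (component Es Eu x v) = A x (v - component Es Eu x v)"
      using ad.A_linear[OF v ad.component_fiber(1)[OF v], of 1 "-1"] by simp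
    then show "A x v - A x (component Es Eu x v) \<in> Eu (f x)" using AEu ad.component_mem(2)[OF v] by simp
    show "A x (component Es Eu x v) \<in> Es (f x)" using AEs ad.component_mem(1)[OF v] .
  qed
  obtain B0 where B0: "\<And>x v. v \<in> fiber E x \<Longrightarrow> nrm (f x, \<phi> x v) \<le> B0"
  proof -
    from \<phi>(5) obtain b where "\<forall>y\<in>{nrm (f x, \<phi> x v) |x v. v \<in> fiber E x}. y \<le> b"
      unfolding bdd_above_def by (elim exE)
    then have "\<And>x v. v \<in> fiber E x \<Longrightarrow> nrm (f x, \<phi> x v) \<le> b" by blast
    then show thesis by (rule that)
  qed
  have surj: "(\<lambda>v. A x v + \<phi> x v) ` fiber E x = fiber E (f x)" for x
  proof -
    have "topspace (fiber_space E y) = Pair y ` fiber E y" for y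
      by (auto simp: fiber_space_def fiber_def)
    moreover have "total_map f (\<lambda>y v. A y v + \<phi> y v) ` topspace (fiber_space E x) = topspace (fiber_space E (f x))"
      using homeomorphic_imp_surjective_map[OF \<phi>(4)[rule_format]] .
    \<comment> \<open>The homeomorphism acts on points of the total space; the base point can be
      stripped because \<open>Pair (f x)\<close> is injective.\<close>
    ultimately have "Pair (f x) ` (\<lambda>v. A x v + \<phi> x v) ` fiber E x = Pair (f x) ` fiber E (f x)"
      by (simp add: image_image total_map_def)
    then show ?thesis by (simp add: inj_image_eq_iff inj_on_def)
  qed
  \<comment> \<open>\<open>max B0 0\<close> supplies a nonnegative bound without examining the sign
    of \<open>B0\<close>, and \<open>\<delta> < min (1 - \<tau>) l\<close> splits into
    \<open>\<tau> + \<delta> < 1\<close> and \<open>\<delta> < l\<close>.\<close>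
  interpret perturbed_cocycle E nrm f "inv f" A ad.Ai "component Es Eu" "component Eu Es" \<tau> \<delta> \<phi> l L "max B0 0"
  proof unfold_locales
    fix x v assume v: "v \<in> fiber E x"
    show "component Es Eu x (component Es Eu x v) = component Es Eu x v"
      using ad.component_of_S(1)[OF ad.component_mem(1)[OF v]] .
    show "nrm (x, v) = max (nrm (x, component Es Eu x v)) (nrm (x, component Eu Es x v))"
      using ad.adapted_norm_max[OF v] by (simp add: nrm_def)
    show "nrm (f x, A x (component Es Eu x v)) \<le> \<tau> * nrm (x, component Es Eu x v)"
      using assms(12)[OF ad.component_mem(1)[OF v]] by (simp add: total_map_def)
    show "nrm (inv f x, ad.Ai x (component Eu Es x v)) \<le> \<tau> * nrm (x, component Eu Es x v)"
      using assms(13)[OF ad.T_component_mem[OF v]] ad.total_inv_eq(1)[OF ad.component_fiber(2)[OF v]] by simp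
    show "nrm (f x, \<phi> x v) \<le> max B0 0" using B0[OF v] by simp
    show "l * nrm (x, v) \<le> nrm (f x, A x v)" "nrm (f x, A x v) \<le> L * nrm (x, v)"
      using assms(16)[OF v] by auto
  next
    show "continuous_map E E (total_map id (component Es Eu))" "continuous_map E E (total_map id (component Eu Es))"
      using ad.component_continuous bundle_splitting.component_continuous[OF swap]
      by (simp_all add: total_map_def case_prod_unfold)
  qed (use \<phi> assms(10,11,14,15,17) in \<open>auto simp: f surj A_P ad.A_mem ad.Ai_A ad.A_linear ad.Ai_linear
      ad.total_inv_eq(2,3) ad.component_fiber ad.component_linear bundle_splitting.component_linear[OF swap]
      ad.component_sum ad.continuous_total_A ad.continuous_total_Ai ad.continuous_inv_f\<close>)
  show ?thesis by (rule global_linearization)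
qed

end
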